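(* Let $C$ be a finitely aligned higher rank graph with a finite number of identities which has no sources and is row finite. If $C$ is aperiodic and cofinal then there are two possibilities: (1) the Boolean inverse monoid $\mathsf{B}(C)$ is finite and isomorphic to a finite symmetric inverse monoid, and its group of units is a finite symmetric group; or (2) the Boolean inverse monoid $\mathsf{B}(C)$ is countably infinite, and its group of units is isomorphic to a full subgroup of the group of self-homeomorphisms of the Cantor space which acts minimally and in which each element has clopen support.
   Context: Categories. $\mathbb{N}=\{0,1,2,\dots\}$ and $\mathbb{N}^k$ is ordered componentwise. A category $C$ is regarded as a set of arrows, with the set of identities $C_o\subseteq C$; each arrow $a$ has a domain $\mathbf{d}(a)\in C_o$ and codomain $\mathbf{r}(a)\in C_o$, and $ab$ is defined exactly when $\mathbf{d}(a)=\mathbf{r}(b)$. Put $aC=\{ac : ac \text{ defined}\}$ and $XC=\bigcup_{x\in X}xC$. $C$ is finitely aligned if for all $a,b\in C$ there is a finite (possibly empty) set $X$ with $aC\cap bC=XC$. Elements $a,b$ are independent if $aC\cap bC=\varnothing$, otherwise dependent. A subset $X\subseteq aC$ is large in $aC$ if every $b\in aC$ is dependent on some element of $X$. Higher rank graphs. A $k$-graph ($k\ge 1$) is a countable category $C$ with a functor $d\colon C\to\mathbb{N}^k$ (the degree) such that whenever $d(a)=\mathbf{m}+\mathbf{n}$ there are unique $a_1,a_2\in C$ with $a=a_1a_2$, $d(a_1)=\mathbf{m}$, $d(a_2)=\mathbf{n}$. A higher rank graph is a $k$-graph for some $k$. It has no sources if for each $e\in C_o$ and $\mathbf{m}\in\mathbb{N}^k$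 there is $x\in C$ with $\mathbf{r}(x)=e$, $d(x)=\mathbf{m}$; it is row finite if for each $e\in C_o$ and $\mathbf{m}\in\mathbb{N}^k$ the set of $x\in eC$ with $d(x)=\mathbf{m}$ is finite. $C$ is aperiodic if for all $a\neq b$ in $C$ with $\mathbf{d}(a)=\mathbf{d}(b)$ there is $u\in C$ (with $au,bu$ defined) such that $au$ and $bu$ are independent. $C$ is cofinal if for all $e,f\in C_o$ there is a finite large subset $X$ of $fC$ such that for every $x\in X$ there is an arrow $a$ with $\mathbf{r}(a)=e$ and $\mathbf{d}(a)=\mathbf{d}(x)$. The monoid $\mathsf{B}(C)$. A right ideal of $C$ is a (possibly empty) subset $R$ with $RC\subseteq R$; it is finitely generated if $R=XC$ with $X$ finite. A bijective morphism $\theta\colon R_1\to R_2$ of right ideals is a bijection with $\mathbf{d}(\theta(r))=\mathbf{d}(r)$ and $\theta(rc)=\theta(r)c$ whenever $rc$ is defined. $\mathsf{R}(C)$ is the inverse monoid of all bijective morphisms between finitely generated right ideals of $C$, under composition of partial bijections; its zero is the empty function. On an inverse semigroup with zero, the natural partial order is $a\le b\Leftrightarrow a=ba^{-1}a$; the Lenz congruence $\equiv$ is: $s\equiv t$ iff for each $0<x\le s$ there is a non-zero element below both $x$ and $t$, and for each $0<y\le t$ there is a non-zero element below both $y$ and $s$. Put $\mathsf{B}(C)=\mathsf{R}(C)/{\equiv}$; under the stated hypotheses it is a Boolean inverse monoid (an inverse monoid in which every compatible pair $a,b$, i.e. $a^{-1}b$ and $ab^{-1}$ idempotent, has a join, multiplication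 distributes over such joins, and the idempotents form a Boolean algebra). Other terms. A finite symmetric inverse monoid is the monoid of all partial bijections of a finite set. A subgroup $G$ of the group of self-homeomorphisms of a space $X$ is full if every self-homeomorphism $g$ of $X$ which agrees on some neighbourhood of each point with an element of $G$ lies in $G$; it acts minimally if every orbit is dense; the support of $g$ is the closure of $\{x: g(x)\ne x\}$. *)

theory Defs
  imports "HOL-Analysis.Analysis" "HOL-Algebra.Lattice" "HOL-Algebra.Sym_Groups"
begin

section \<open>Categories as sets of arrows\<close>

text \<open>
  The product \<open>cmp C a b\<close> is only meaningful when \<open>src C a = tgt C b\<close>; \<open>src\<close> and \<open>tgt\<close> are
  the domain and codomain maps \<open>d\<close> and \<open>r\<close>, and \<open>Ids\<close> is the set of identities.
\<close>

record 'a cat =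
  Arr :: "'a set"
  Ids :: "'a set"
  src :: "'a \<Rightarrow> 'a"
  tgt :: "'a \<Rightarrow> 'a"
  cmp :: "'a \<Rightarrow> 'a \<Rightarrow> 'a"

locale arrow_category =
  fixes C :: "'a cat"
  assumes Ids_subset: "Ids C \<subseteq> Arr C"
    and src_Ids: "a \<in> Arr C \<Longrightarrow> src C a \<in> Ids C"
    and tgt_Ids: "a \<in> Arr C \<Longrightarrow> tgt C a \<in> Ids C"
    and src_id: "e \<in> Ids C \<Longrightarrow> src C e = e"
    and tgt_id: "e \<in> Ids C \<Longrightarrow> tgt C e = e"
    and cmp_closed: "\<lbrakk>a \<in> Arr C; b \<in> Arr C; src C a = tgt C b\<rbrakk> \<Longrightarrow> cmp C a b \<in> Arr C"
    and src_cmp: "\<lbrakk>a \<in> Arr C; b \<in> Arr C; src C a = tgt C b\<rbrakk> \<Longrightarrow> src C (cmp C a b) = src C b"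
    and tgt_cmp: "\<lbrakk>a \<in> Arr C; b \<in> Arr C; src C a = tgt C b\<rbrakk> \<Longrightarrow> tgt C (cmp C a b) = tgt C a"
    and cmp_assoc:
      "\<lbrakk>a \<in> Arr C; b \<in> Arr C; c \<in> Arr C; src C a = tgt C b; src C b = tgt C c\<rbrakk>
        \<Longrightarrow> cmp C (cmp C a b) c = cmp C a (cmp C b c)"
    and cmp_src: "a \<in> Arr C \<Longrightarrow> cmp C a (src C a) = a"
    and tgt_cmp_id: "a \<in> Arr C \<Longrightarrow> cmp C (tgt C a) a = a"

text \<open>The sets \<open>aC\<close> and \<open>XC\<close>.\<close>

definition principal :: "'a cat \<Rightarrow> 'a \<Rightarrow> 'a set" where
  "principal C a = {cmp C a c | c. c \<in> Arr C \<and> src C a = tgt C c}"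

definition generated :: "'a cat \<Rightarrow> 'a set \<Rightarrow> 'a set" where
  "generated C X = (\<Union>x\<in>X. principal C x)"

definition finitely_aligned :: "'a cat \<Rightarrow> bool" where
  "finitely_aligned C \<longleftrightarrow>
    (\<forall>a\<in>Arr C. \<forall>b\<in>Arr C. \<exists>X. finite X \<and> X \<subseteq> Arr C \<and>
        principal C a \<inter> principal C b = generated C X)"

definition independent :: "'a cat \<Rightarrow> 'a \<Rightarrow> 'a \<Rightarrow> bool" where
  "independent C a b \<longleftrightarrow> principal C a \<inter> principal C b = {}"

definition large_in :: "'a cat \<Rightarrow> 'a set \<Rightarrow> 'a \<Rightarrow> bool" where
  "large_in C X a \<longleftrightarrow>
    X \<subseteq> principal C a \<and> (\<forall>b\<in>principal C a. \<exists>x\<in>X. \<not> independent C b x)"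


section \<open>Higher rank graphs\<close>

text \<open>
  \<open>\<nat>\<^sup>k\<close> is rendered as \<open>nat ^ 'k\<close> with \<open>'k\<close> a finite (hence nonempty) index type; a functor into
  this additive monoid sends identities to \<open>0\<close> and composites to sums.
\<close>

locale k_graph = arrow_category C for C :: "'a cat" +
  fixes deg :: "'a \<Rightarrow> nat ^ 'k::finite"
  assumes countable_Arr: "countable (Arr C)"
    and deg_id: "e \<in> Ids C \<Longrightarrow> deg e = 0"
    and deg_cmp: "\<lbrakk>a \<in> Arr C; b \<in> Arr C; src C a = tgt C b\<rbrakk> \<Longrightarrow> deg (cmp C a b) = deg a + deg b"
    and unique_factorization: "\<lbrakk>a \<in> Arr C; deg a = m + n\<rbrakk> \<Longrightarrow>
      \<exists>!p. fst p \<in> Arr C \<and> snd p \<in> Arr C \<and> src C (fst p) = tgt C (snd p) \<and>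
        a = cmp C (fst p) (snd p) \<and> deg (fst p) = m \<and> deg (snd p) = n"

definition no_sources :: "'a cat \<Rightarrow> ('a \<Rightarrow> nat ^ 'k::finite) \<Rightarrow> bool" where
  "no_sources C deg \<longleftrightarrow> (\<forall>e\<in>Ids C. \<forall>m. \<exists>x\<in>Arr C. tgt C x = e \<and> deg x = m)"

definition row_finite :: "'a cat \<Rightarrow> ('a \<Rightarrow> nat ^ 'k::finite) \<Rightarrow> bool" where
  "row_finite C deg \<longleftrightarrow> (\<forall>e\<in>Ids C. \<forall>m. finite {x \<in> principal C e. deg x = m})"

definition aperiodic :: "'a cat \<Rightarrow> bool" where
  "aperiodic C \<longleftrightarrow>
    (\<forall>a\<in>Arr C. \<forall>b\<in>Arr C. a \<noteq> b \<longrightarrow> src C a = src C b \<longrightarrow>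
      (\<exists>u\<in>Arr C. src C a = tgt C u \<and> independent C (cmp C a u) (cmp C b u)))"

definition cofinal_category :: "'a cat \<Rightarrow> bool" where
  "cofinal_category C \<longleftrightarrow>
    (\<forall>e\<in>Ids C. \<forall>f\<in>Ids C. \<exists>X. finite X \<and> large_in C X f \<and>
      (\<forall>x\<in>X. \<exists>a\<in>Arr C. tgt C a = e \<and> src C a = src C x))"


section \<open>Boolean inverse monoids\<close>

definition idempotents :: "('a, 'b) monoid_scheme \<Rightarrow> 'a set" where
  "idempotents S = {e \<in> carrier S. e \<otimes>\<^bsub>S\<^esub> e = e}"

locale inverse_monoid = monoid S for S (structure) +
  assumes unique_inverse:
    "a \<in> carrier S \<Longrightarrow> \<exists>!b. b \<in> carrier S \<and> a \<otimes> b \<otimes> a = a \<and> b \<otimes> a \<otimes> b = b"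

text \<open>
  The inverse in the sense of inverse semigroups, as opposed to \<^const>\<open>m_inv\<close>, which is the
  inverse of a unit.
\<close>

definition s_inv :: "('a, 'b) monoid_scheme \<Rightarrow> 'a \<Rightarrow> 'a" where
  "s_inv S a = (THE b. b \<in> carrier S \<and> a \<otimes>\<^bsub>S\<^esub> b \<otimes>\<^bsub>S\<^esub> a = a \<and> b \<otimes>\<^bsub>S\<^esub> a \<otimes>\<^bsub>S\<^esub> b = b)"

definition nat_le :: "('a, 'b) monoid_scheme \<Rightarrow> 'a \<Rightarrow> 'a \<Rightarrow> bool" where
  "nat_le S a b \<longleftrightarrow> a = b \<otimes>\<^bsub>S\<^esub> s_inv S a \<otimes>\<^bsub>S\<^esub> a"

definition nat_order :: "('a, 'b) monoid_scheme \<Rightarrow> 'a gorder" where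
  "nat_order S = \<lparr>carrier = carrier S, eq = (=), le = nat_le S\<rparr>"

definition idempotent_order :: "('a, 'b) monoid_scheme \<Rightarrow> 'a gorder" where
  "idempotent_order S = \<lparr>carrier = idempotents S, eq = (=), le = nat_le S\<rparr>"

definition compatible :: "('a, 'b) monoid_scheme \<Rightarrow> 'a \<Rightarrow> 'a \<Rightarrow> bool" where
  "compatible S a b \<longleftrightarrow>
    s_inv S a \<otimes>\<^bsub>S\<^esub> b \<in> idempotents S \<and> a \<otimes>\<^bsub>S\<^esub> s_inv S b \<in> idempotents S"

locale boolean_algebra_order = bounded_lattice L for L (structure) +
  assumes meet_join_distrib: "\<lbrakk>x \<in> carrier L; y \<in> carrier L; z \<in> carrier L\<rbrakk>
      \<Longrightarrow> x \<sqinter> (y \<squnion> z) = (x \<sqinter> y) \<squnion> (x \<sqinter> z)"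
    and complemented: "x \<in> carrier L \<Longrightarrow> \<exists>y\<in>carrier L. x \<sqinter> y = \<bottom> \<and> x \<squnion> y = \<top>"

locale boolean_inverse_monoid = inverse_monoid S for S (structure) +
  assumes compatible_joins:
    "\<lbrakk>a \<in> carrier S; b \<in> carrier S; compatible S a b\<rbrakk> \<Longrightarrow>
      \<exists>j. is_lub (nat_order S) j {a, b} \<and>
        (\<forall>c\<in>carrier S. is_lub (nat_order S) (c \<otimes> j) {c \<otimes> a, c \<otimes> b} \<and>
                       is_lub (nat_order S) (j \<otimes> c) {a \<otimes> c, b \<otimes> c})"
    and idempotents_boolean: "boolean_algebra_order (idempotent_order S)"

definition symmetric_inverse_monoid :: "'a set \<Rightarrow> ('a \<rightharpoonup> 'a) monoid" where
  "symmetric_inverse_monoid X =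
    \<lparr>carrier = {f. dom f \<subseteq> X \<and> ran f \<subseteq> X \<and> inj_on f (dom f)},
     mult = (\<circ>\<^sub>m), one = Some |` X\<rparr>"


section \<open>The Lenz congruence\<close>

text \<open>The parameter \<open>z\<close> is the zero of the inverse semigroup.\<close>

definition lenz :: "('a, 'b) monoid_scheme \<Rightarrow> 'a \<Rightarrow> ('a \<times> 'a) set" where
  "lenz S z = {(s, t). s \<in> carrier S \<and> t \<in> carrier S \<and>
    (\<forall>x\<in>carrier S. x \<noteq> z \<and> nat_le S x s \<longrightarrow>
      (\<exists>w\<in>carrier S. w \<noteq> z \<and> nat_le S w x \<and> nat_le S w t)) \<and>
    (\<forall>y\<in>carrier S. y \<noteq> z \<and> nat_le S y t \<longrightarrow>
      (\<exists>w\<in>carrier S. w \<noteq> z \<and> nat_le S w y \<and> nat_le S w s))}"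

definition quotient_monoid :: "('a, 'b) monoid_scheme \<Rightarrow> ('a \<times> 'a) set \<Rightarrow> 'a set monoid" where
  "quotient_monoid S r =
    \<lparr>carrier = carrier S // r,
     mult = (\<lambda>X Y. r `` {x \<otimes>\<^bsub>S\<^esub> y | x y. x \<in> X \<and> y \<in> Y}),
     one = r `` {\<one>\<^bsub>S\<^esub>}\<rparr>"


section \<open>The inverse monoids of a category\<close>

definition right_ideal :: "'a cat \<Rightarrow> 'a set \<Rightarrow> bool" where
  "right_ideal C R \<longleftrightarrow>
    R \<subseteq> Arr C \<and> (\<forall>r\<in>R. \<forall>c\<in>Arr C. src C r = tgt C c \<longrightarrow> cmp C r c \<in> R)"

definition fg_right_ideal :: "'a cat \<Rightarrow> 'a set \<Rightarrow> bool" where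
  "fg_right_ideal C R \<longleftrightarrow>
    right_ideal C R \<and> (\<exists>X. finite X \<and> X \<subseteq> Arr C \<and> R = generated C X)"

definition bijective_morphism :: "'a cat \<Rightarrow> 'a set \<Rightarrow> 'a set \<Rightarrow> ('a \<rightharpoonup> 'a) \<Rightarrow> bool" where
  "bijective_morphism C R1 R2 \<theta> \<longleftrightarrow>
    dom \<theta> = R1 \<and> bij_betw (\<lambda>r. the (\<theta> r)) R1 R2 \<and>
    (\<forall>r\<in>R1. src C (the (\<theta> r)) = src C r) \<and>
    (\<forall>r\<in>R1. \<forall>c\<in>Arr C. src C r = tgt C c \<longrightarrow>
       the (\<theta> (cmp C r c)) = cmp C (the (\<theta> r)) c)"

definition R_monoid :: "'a cat \<Rightarrow> ('a \<rightharpoonup> 'a) monoid" where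
  "R_monoid C =
    \<lparr>carrier = {\<theta>. \<exists>R1 R2. fg_right_ideal C R1 \<and> fg_right_ideal C R2 \<and>
                          bijective_morphism C R1 R2 \<theta>},
     mult = (\<circ>\<^sub>m), one = Some |` Arr C\<rparr>"

definition B_monoid :: "'a cat \<Rightarrow> ('a \<rightharpoonup> 'a) set monoid" where
  "B_monoid C = quotient_monoid (R_monoid C) (lenz (R_monoid C) Map.empty)"


section \<open>Groups of self-homeomorphisms\<close>

definition homeo_group :: "'a topology \<Rightarrow> ('a \<Rightarrow> 'a) monoid" where
  "homeo_group X =
    \<lparr>carrier = {g \<in> extensional (topspace X). homeomorphic_map X X g},
     mult = compose (topspace X), one = (\<lambda>x\<in>topspace X. x)\<rparr>"

definition full_in :: "'a topology \<Rightarrow> ('a \<Rightarrow> 'a) set \<Rightarrow> bool" where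
  "full_in X G \<longleftrightarrow>
    (\<forall>g\<in>carrier (homeo_group X).
      (\<forall>x\<in>topspace X. \<exists>U. openin X U \<and> x \<in> U \<and> (\<exists>h\<in>G. \<forall>y\<in>U. g y = h y)) \<longrightarrow> g \<in> G)"

definition acts_minimally :: "'a topology \<Rightarrow> ('a \<Rightarrow> 'a) set \<Rightarrow> bool" where
  "acts_minimally X G \<longleftrightarrow> (\<forall>x\<in>topspace X. X closure_of ((\<lambda>g. g x) ` G) = topspace X)"

definition support_in :: "'a topology \<Rightarrow> ('a \<Rightarrow> 'a) \<Rightarrow> 'a set" where
  "support_in X g = X closure_of {x \<in> topspace X. g x \<noteq> x}"

definition cantor_space :: "(nat \<Rightarrow> bool) topology" where
  "cantor_space = product_topology (\<lambda>_. discrete_topology UNIV) UNIV"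

end

theory Submission
  imports Defs
begin

text \<open>
  Call \<open>a\<close> a prefix of \<open>b\<close> if \<open>b \<in> aC\<close>.  An infinite path is a coherent choice of one arrow of each
  degree, its initial segments.  The paths through a given arrow form the basic open sets of a
  topology on the set of all paths.  Without sources, every arrow lies on a path; with row finiteness
  and finitely many identities, the space of paths is compact (\<open>paths_compact\<close>, a form of Koenig's
  lemma).  A bijective morphism \<open>\<theta>\<close> acts on those paths that have an initial segment \<open>a\<close> in its domain,
  by replacing \<open>a\<close> with \<open>\<theta> a\<close>.

  Aperiodicity says that this action forgets as little as possible: if two bijective morphisms are
  defined at \<open>c\<close> and act in the same way on the paths through \<open>c\<close>, then they have the same value at \<open>c\<close>
  (\<open>values_eq\<close>), since otherwise a further extension of \<open>c\<close> would have independent images.  It follows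
  that the Lenz congruence is equality of actions (\<open>lenz_iff\<close>), so that \<open>B_monoid C\<close> is faithfully
  represented by partial bijections between compact open sets of paths.  These partial
  bijections are closed under inverses and finite compatible unions, and contain the identity on the
  complement of each of their domains; this alone makes the monoid Boolean (\<open>boolean_rep\<close>).
  Cofinality says that every path can be moved into every nonempty open set.

  The dichotomy is now topological.  If some path is an isolated point then all are, because each can be
  moved to the isolated one; by compactness there are finitely many, and all their partial bijections
  are represented.  Otherwise the compact open sets form a countable atomless field of sets, and
  the space is the Cantor space (\<open>stone_cantor\<close>), or it is empty, which again is the finite case.  In
  the Cantor case the units become homeomorphisms.  The group they form is full because, by
  compactness, a homeomorphism that is locally a unit is a finite union of represented partial
  bijections (\<open>glue\<close>).  It acts minimally because a partial bijection that moves \<open>x\<close> into a compact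
  open set \<open>A\<close> not containing \<open>x\<close> can be cut down to have disjoint domain and range, and then be extended
  to an involution (\<open>unit_minimal\<close>).  Supports are clopen because the arrows fixed by \<open>\<theta>\<close> form
  a finitely generated right ideal: the paths that meet it are fixed, and by aperiodicity every
  nonempty open set of other paths contains a path that is moved.
\<close>

section \<open>Partial bijections\<close>

definition pinv :: "('x \<rightharpoonup> 'y) \<Rightarrow> 'y \<rightharpoonup> 'x" where
  "pinv f y = (if y \<in> ran f then Some (SOME x. f x = Some y) else None)"

lemma map_eqI: "(\<And>x y. f x = Some y \<longleftrightarrow> g x = Some y) \<Longrightarrow> f = g"
  by (metis ext option.exhaust)

lemma pinv_Some_iff:
  assumes "inj_on f (dom f)"
  shows "pinv f y = Some x \<longleftrightarrow> f x = Some y"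
proof
  assume "pinv f y = Some x"
  then have "y \<in> ran f" "x = (SOME x. f x = Some y)"
    by (auto simp: pinv_def split: if_splits)
  then show "f x = Some y"
    by (auto simp: ran_def intro: someI)
next
  assume x: "f x = Some y"
  then have "(SOME x. f x = Some y) = x"
    using assms by (intro some_equality) (auto simp: inj_on_def dom_def)
  with x show "pinv f y = Some x"
    by (auto simp: pinv_def ran_def)
qed

lemma inj_mapD: "inj_on f (dom f) \<Longrightarrow> f x = Some y \<Longrightarrow> f x' = Some y \<Longrightarrow> x = x'"
  by (auto simp: inj_on_def dom_def)

lemma inj_mapI: "(\<And>x x' y. f x = Some y \<Longrightarrow> f x' = Some y \<Longrightarrow> x = x') \<Longrightarrow> inj_on f (dom f)"
  by (auto simp: inj_on_def dom_def)

lemma restrict_Some_iff: "(f |` A) x = Some y \<longleftrightarrow> x \<in> A \<and> f x = Some y"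
  by (auto simp: restrict_map_def)

lemma dom_pinv: "inj_on f (dom f) \<Longrightarrow> dom (pinv f) = ran f"
  by (auto simp: pinv_def ran_def dom_def)

section \<open>Monoids represented by partial bijections\<close>

text \<open>
  Faithfulness reduces every identity in the monoid to a pointwise statement about partial
  bijections.  The locale is used twice: for the bijective morphisms of a category, which act on
  arrows, and for their quotient by the Lenz congruence, which acts on infinite paths.
\<close>

locale partial_bij_rep =
  fixes S :: "('s, 'm) monoid_scheme" (structure)
    and \<Phi> :: "'s \<Rightarrow> 'x \<rightharpoonup> 'x"
    and X :: "'x set"
  assumes mult_closed: "a \<in> carrier S \<Longrightarrow> b \<in> carrier S \<Longrightarrow> a \<otimes> b \<in> carrier S"
    and unit_closed: "\<one> \<in> carrier S"
    and rep_mult: "a \<in> carrier S \<Longrightarrow> b \<in> carrier S \<Longrightarrow> \<Phi> (a \<otimes> b) = \<Phi> a \<circ>\<^sub>m \<Phi> b"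
    and rep_one: "\<Phi> \<one> = Some |` X"
    and rep_faithful: "inj_on \<Phi> (carrier S)"
    and rep_dom: "a \<in> carrier S \<Longrightarrow> dom (\<Phi> a) \<subseteq> X"
    and rep_inj: "a \<in> carrier S \<Longrightarrow> inj_on (\<Phi> a) (dom (\<Phi> a))"
    and rep_inv: "a \<in> carrier S \<Longrightarrow> \<exists>b\<in>carrier S. \<Phi> b = pinv (\<Phi> a)"
begin

lemma rep_eqI:
  assumes "a \<in> carrier S" "b \<in> carrier S" "\<And>x y. \<Phi> a x = Some y \<longleftrightarrow> \<Phi> b x = Some y"
  shows "a = b"
  using rep_faithful assms map_eqI[of "\<Phi> a" "\<Phi> b"] by (auto simp: inj_on_def)

lemma rep_mult_iff:
  "a \<in> carrier S \<Longrightarrow> b \<in> carrier S \<Longrightarrow>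
    \<Phi> (a \<otimes> b) x = Some z \<longleftrightarrow> (\<exists>y. \<Phi> b x = Some y \<and> \<Phi> a y = Some z)"
  by (auto simp: rep_mult map_comp_Some_iff)

lemma rep_fun_inj: "a \<in> carrier S \<Longrightarrow> \<Phi> a x = Some y \<Longrightarrow> \<Phi> a x' = Some y \<Longrightarrow> x = x'"
  using inj_mapD[OF rep_inj] .

lemma rep_source: "a \<in> carrier S \<Longrightarrow> \<Phi> a x = Some y \<Longrightarrow> x \<in> X"
  using rep_dom by blast

lemma rep_target: "a \<in> carrier S \<Longrightarrow> \<Phi> a x = Some y \<Longrightarrow> y \<in> X"
  using rep_inv[of a] rep_source pinv_Some_iff[OF rep_inj] by metis

lemma rep_one_iff: "\<Phi> \<one> x = Some y \<longleftrightarrow> x \<in> X \<and> y = x"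
  by (auto simp: rep_one restrict_Some_iff)

lemma monoid: "Group.monoid S"
proof
  fix a b c assume "a \<in> carrier S" "b \<in> carrier S" "c \<in> carrier S"
  then show "a \<otimes> b \<otimes> c = a \<otimes> (b \<otimes> c)"
    by (intro rep_eqI) (auto simp: mult_closed rep_mult_iff)
next
  fix a assume a: "a \<in> carrier S"
  show "\<one> \<otimes> a = a"
    using a rep_target by (intro rep_eqI) (auto simp: mult_closed unit_closed rep_mult_iff rep_one_iff)
  show "a \<otimes> \<one> = a"
    using a rep_source by (intro rep_eqI) (auto simp: mult_closed unit_closed rep_mult_iff rep_one_iff)
qed (auto simp: mult_closed unit_closed)

text \<open>
  Evaluating \<open>b \<otimes> a \<otimes> b = b\<close> at a point and cancelling the injective map of \<open>b\<close> shows that \<open>b\<close>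
  is inverted by \<open>a\<close>, and symmetrically; so the weak inverse can only be the inverse partial bijection.
\<close>

lemma weak_inverse_iff:
  assumes a: "a \<in> carrier S" and b: "b \<in> carrier S"
  shows "a \<otimes> b \<otimes> a = a \<and> b \<otimes> a \<otimes> b = b \<longleftrightarrow> \<Phi> b = pinv (\<Phi> a)"
proof
  assume eq: "a \<otimes> b \<otimes> a = a \<and> b \<otimes> a \<otimes> b = b"
  note aba = rep_mult_iff[OF mult_closed[OF a b] a] rep_mult_iff[OF a b]
  note bab = rep_mult_iff[OF mult_closed[OF b a] b] rep_mult_iff[OF b a]
  show "\<Phi> b = pinv (\<Phi> a)"
  proof (rule map_eqI)
    fix y x
    show "\<Phi> b y = Some x \<longleftrightarrow> pinv (\<Phi> a) y = Some x"
      unfolding pinv_Some_iff[OF rep_inj[OF a]]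
    proof
      assume y: "\<Phi> b y = Some x"
      have "\<Phi> (b \<otimes> a \<otimes> b) y = Some x" using eq y by simp
      then obtain z where "\<Phi> a x = Some z" "\<Phi> b z = Some x"
        using y unfolding bab by auto
      then show "\<Phi> a x = Some y" using rep_fun_inj[OF b y] by auto
    next
      assume x: "\<Phi> a x = Some y"
      have "\<Phi> (a \<otimes> b \<otimes> a) x = Some y" using eq x by simp
      then obtain z where "\<Phi> b y = Some z" "\<Phi> a z = Some y"
        using x unfolding aba by auto
      then show "\<Phi> b y = Some x" using rep_fun_inj[OF a x] by auto
    qed
  qed
next
  assume eq: "\<Phi> b = pinv (\<Phi> a)"
  have b_iff: "\<Phi> b y = Some x \<longleftrightarrow> \<Phi> a x = Some y" for x y
    by (simp add: eq pinv_Some_iff[OF rep_inj[OF a]])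
  show "a \<otimes> b \<otimes> a = a \<and> b \<otimes> a \<otimes> b = b"
  proof
    show "a \<otimes> b \<otimes> a = a"
      using a b rep_fun_inj[OF a] by (intro rep_eqI) (auto simp: mult_closed rep_mult_iff b_iff)
    show "b \<otimes> a \<otimes> b = b"
      using a b by (intro rep_eqI) (auto simp: mult_closed rep_mult_iff b_iff)
  qed
qed

lemma inverse_monoid: "inverse_monoid S"
proof -
  interpret Group.monoid S by (rule monoid)
  show ?thesis
  proof
    fix a assume a: "a \<in> carrier S"
    obtain b where b: "b \<in> carrier S" "\<Phi> b = pinv (\<Phi> a)" using rep_inv[OF a] by auto
    show "\<exists>!b. b \<in> carrier S \<and> a \<otimes> b \<otimes> a = a \<and> b \<otimes> a \<otimes> b = b"
    proof (rule ex1I[of _ b])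
      show "b \<in> carrier S \<and> a \<otimes> b \<otimes> a = a \<and> b \<otimes> a \<otimes> b = b"
        using weak_inverse_iff[OF a b(1)] b by simp
      fix c assume "c \<in> carrier S \<and> a \<otimes> c \<otimes> a = a \<and> c \<otimes> a \<otimes> c = c"
      then show "c = b"
        using weak_inverse_iff[OF a, of c] b rep_faithful by (auto simp: inj_on_def)
    qed
  qed
qed

lemma s_inv_closed: "a \<in> carrier S \<Longrightarrow> s_inv S a \<in> carrier S"
  and rep_s_inv: "a \<in> carrier S \<Longrightarrow> \<Phi> (s_inv S a) = pinv (\<Phi> a)"
proof -
  assume a: "a \<in> carrier S"
  have "s_inv S a \<in> carrier S \<and> a \<otimes> s_inv S a \<otimes> a = a \<and> s_inv S a \<otimes> a \<otimes> s_inv S a = s_inv S a"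
    unfolding s_inv_def by (rule theI') (rule inverse_monoid.unique_inverse[OF inverse_monoid a])
  then show "s_inv S a \<in> carrier S" "\<Phi> (s_inv S a) = pinv (\<Phi> a)"
    using weak_inverse_iff[OF a] by auto
qed

lemma rep_s_inv_iff: "a \<in> carrier S \<Longrightarrow> \<Phi> (s_inv S a) y = Some x \<longleftrightarrow> \<Phi> a x = Some y"
  by (simp add: rep_s_inv pinv_Some_iff rep_inj)

text \<open>
  Since \<open>s_inv S a \<otimes> a\<close> is the identity on the domain of \<open>a\<close>, the product
  \<open>b \<otimes> s_inv S a \<otimes> a\<close> is the restriction of \<open>b\<close> to that domain.
\<close>

lemma nat_le_iff:
  assumes a: "a \<in> carrier S" and b: "b \<in> carrier S"
  shows "nat_le S a b \<longleftrightarrow> \<Phi> a \<subseteq>\<^sub>m \<Phi> b"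
proof -
  have c: "b \<otimes> s_inv S a \<otimes> a \<in> carrier S"
    using a b s_inv_closed mult_closed by simp
  have val: "\<Phi> (b \<otimes> s_inv S a \<otimes> a) x = Some z \<longleftrightarrow> x \<in> dom (\<Phi> a) \<and> \<Phi> b x = Some z" for x z
    using a b rep_fun_inj[OF a]
    by (auto simp: rep_mult_iff s_inv_closed mult_closed rep_s_inv_iff)
  have "nat_le S a b \<longleftrightarrow> (\<forall>x z. \<Phi> a x = Some z \<longleftrightarrow> x \<in> dom (\<Phi> a) \<and> \<Phi> b x = Some z)"
    unfolding nat_le_def using rep_eqI[OF a c] val by metis
  also have "\<dots> \<longleftrightarrow> \<Phi> a \<subseteq>\<^sub>m \<Phi> b"
    unfolding map_le_def by (metis domI domD)
  finally show ?thesis .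
qed

lemma idempotent_iff:
  assumes e: "e \<in> carrier S"
  shows "e \<in> idempotents S \<longleftrightarrow> (\<forall>x y. \<Phi> e x = Some y \<longrightarrow> y = x)"
proof
  assume "e \<in> idempotents S"
  then have ee: "e \<otimes> e = e" by (simp add: idempotents_def)
  show "\<forall>x y. \<Phi> e x = Some y \<longrightarrow> y = x"
  proof (intro allI impI)
    fix x y assume x: "\<Phi> e x = Some y"
    then have "\<Phi> (e \<otimes> e) x = Some y" using ee by simp
    then have "\<Phi> e y = Some y" using x e by (auto simp: rep_mult_iff)
    then show "y = x" using rep_fun_inj[OF e x] by auto
  qed
next
  assume r: "\<forall>x y. \<Phi> e x = Some y \<longrightarrow> y = x"
  have "\<Phi> (e \<otimes> e) x = Some y \<longleftrightarrow> \<Phi> e x = Some y" for x y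
    unfolding rep_mult_iff[OF e e] using r by blast
  then have "e \<otimes> e = e" by (intro rep_eqI mult_closed e)
  then show "e \<in> idempotents S" using e by (simp add: idempotents_def)
qed

text \<open>
  In the application these are the compact open subsets of the represented space.
\<close>

definition domains :: "'x set set" where
  "domains = {dom (\<Phi> a) | a. a \<in> carrier S}"

lemma domainsI: "a \<in> carrier S \<Longrightarrow> A = dom (\<Phi> a) \<Longrightarrow> A \<in> domains"
  by (auto simp only: domains_def)

lemma domains_subset: "A \<in> domains \<Longrightarrow> A \<subseteq> X"
  using rep_dom by (auto simp: domains_def)

lemma partial_identity_iff: "(\<exists>e\<in>carrier S. \<Phi> e = Some |` A) \<longleftrightarrow> A \<in> domains"
proof
  assume "\<exists>e\<in>carrier S. \<Phi> e = Some |` A"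
  then obtain e where e: "e \<in> carrier S" "\<Phi> e = Some |` A" by auto
  then have "A = dom (\<Phi> e)" by (auto simp: restrict_Some_iff dom_def)
  then show "A \<in> domains" by (rule domainsI[OF e(1)])
next
  assume "A \<in> domains"
  then obtain a where a: "a \<in> carrier S" "A = dom (\<Phi> a)" by (auto simp: domains_def)
  have "\<Phi> (s_inv S a \<otimes> a) = Some |` A"
    using a rep_fun_inj[OF a(1)]
    by (intro map_eqI) (auto simp: rep_mult_iff s_inv_closed rep_s_inv_iff restrict_Some_iff)
  then show "\<exists>e\<in>carrier S. \<Phi> e = Some |` A"
    using a s_inv_closed mult_closed by blast
qed

lemma idempotent_partial_identity:
  assumes "e \<in> idempotents S"
  shows "e \<in> carrier S" "\<Phi> e = Some |` dom (\<Phi> e)" "dom (\<Phi> e) \<in> domains"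
proof -
  show e: "e \<in> carrier S" using assms by (simp add: idempotents_def)
  show "\<Phi> e = Some |` dom (\<Phi> e)"
    using assms unfolding idempotent_iff[OF e]
    by (intro map_eqI) (auto simp: restrict_Some_iff dom_def)
  show "dom (\<Phi> e) \<in> domains" by (rule domainsI[OF e refl])
qed

lemma restriction_exists:
  assumes "a \<in> carrier S" "A \<in> domains"
  shows "\<exists>b\<in>carrier S. \<Phi> b = \<Phi> a |` A"
proof -
  obtain e where e: "e \<in> carrier S" "\<Phi> e = Some |` A" using partial_identity_iff assms(2) by auto
  have "\<Phi> (a \<otimes> e) = \<Phi> a |` A"
    using assms e by (intro map_eqI) (auto simp: rep_mult_iff restrict_Some_iff)
  then show ?thesis using assms(1) e mult_closed by blast
qed

lemma domains_Int:
  assumes "A \<in> domains" "B \<in> domains"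
  shows "A \<inter> B \<in> domains"
proof -
  obtain e where e: "e \<in> carrier S" "\<Phi> e = Some |` A" using partial_identity_iff assms by auto
  obtain b where b: "b \<in> carrier S" "\<Phi> b = \<Phi> e |` B" using restriction_exists assms e by blast
  have "A \<inter> B = dom (\<Phi> b)" using e b by (auto simp: restrict_Some_iff dom_def)
  then show ?thesis by (rule domainsI[OF b(1)])
qed

lemma domains_preimage:
  assumes "a \<in> carrier S" "A \<in> domains"
  shows "{x. \<exists>y\<in>A. \<Phi> a x = Some y} \<in> domains"
proof -
  obtain e where e: "e \<in> carrier S" "\<Phi> e = Some |` A" using partial_identity_iff assms by auto
  have "{x. \<exists>y\<in>A. \<Phi> a x = Some y} = dom (\<Phi> (e \<otimes> a))"
    using assms e by (auto simp: rep_mult_iff restrict_Some_iff dom_def)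
  then show ?thesis by (rule domainsI[OF mult_closed[OF e(1) assms(1)]])
qed

lemma domains_image:
  assumes "a \<in> carrier S" "A \<in> domains"
  shows "{y. \<exists>x\<in>A. \<Phi> a x = Some y} \<in> domains"
  using domains_preimage[OF s_inv_closed[OF assms(1)] assms(2)] assms(1)
  by (simp add: rep_s_inv_iff)

lemma X_in_domains: "X \<in> domains"
  using partial_identity_iff[of X] unit_closed rep_one by auto

end

section \<open>Boolean inverse monoids of partial bijections\<close>

text \<open>
  These two closure properties give the compatible joins and the Boolean algebra of idempotents.
\<close>

locale boolean_rep = partial_bij_rep +
  assumes rep_union: "\<lbrakk>a \<in> carrier S; b \<in> carrier S;
      \<And>x y z. \<Phi> a x = Some y \<Longrightarrow> \<Phi> b x = Some z \<Longrightarrow> y = z;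
      \<And>x y z. \<Phi> a x = Some z \<Longrightarrow> \<Phi> b y = Some z \<Longrightarrow> x = y\<rbrakk>
      \<Longrightarrow> \<exists>c\<in>carrier S. \<Phi> c = \<Phi> a ++ \<Phi> b"
    and rep_compl: "a \<in> carrier S \<Longrightarrow> \<exists>c\<in>carrier S. \<Phi> c = Some |` (X - dom (\<Phi> a))"
begin

lemma domains_Compl: "A \<in> domains \<Longrightarrow> X - A \<in> domains"
  using rep_compl partial_identity_iff by (auto simp: domains_def)

lemma domains_Diff: "A \<in> domains \<Longrightarrow> B \<in> domains \<Longrightarrow> A - B \<in> domains"
proof -
  assume AB: "A \<in> domains" "B \<in> domains"
  then have "A - B = A \<inter> (X - B)" using domains_subset by auto
  then show ?thesis using AB domains_Int domains_Compl by simp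
qed

lemma domains_Un:
  assumes "A \<in> domains" "B \<in> domains" shows "A \<union> B \<in> domains"
proof -
  have "A \<union> B = X - ((X - A) \<inter> (X - B))" using assms domains_subset by auto
  then show ?thesis using assms domains_Int domains_Compl by simp
qed

lemma domains_empty: "{} \<in> domains"
  using domains_Compl[OF X_in_domains] by simp

lemma union_iff:
  assumes "\<And>x y z. f x = Some y \<Longrightarrow> g x = Some z \<Longrightarrow> y = z"
  shows "(f ++ g) x = Some y \<longleftrightarrow> f x = Some y \<or> g x = Some y"
proof
  assume "f x = Some y \<or> g x = Some y"
  then show "(f ++ g) x = Some y"
    using assms by (cases "g x") (auto simp: map_add_Some_iff)
qed (auto simp: map_add_Some_iff)

lemma is_lub_nat_orderI:
  assumes "a \<in> carrier S" "b \<in> carrier S" "j \<in> carrier S"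
    and j: "\<And>x y. \<Phi> j x = Some y \<longleftrightarrow> \<Phi> a x = Some y \<or> \<Phi> b x = Some y"
  shows "is_lub (nat_order S) j {a, b}"
proof -
  have le: "nat_le S c d \<longleftrightarrow> (\<forall>x y. \<Phi> c x = Some y \<longrightarrow> \<Phi> d x = Some y)"
    if "c \<in> carrier S" "d \<in> carrier S" for c d
    unfolding nat_le_iff[OF that] by (auto simp: map_le_def dom_def)
  show ?thesis
    unfolding least_def
  proof (intro conjI ballI)
    show "j \<in> Upper (nat_order S) {a, b}"
      using assms(1-3) by (auto simp: Upper_def nat_order_def le j)
    fix u assume "u \<in> Upper (nat_order S) {a, b}"
    then have "u \<in> carrier S" "nat_le S a u" "nat_le S b u"
      using assms(1,2) by (auto simp: Upper_def nat_order_def)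
    then show "le (nat_order S) j u"
      using assms(1-3) by (auto simp: nat_order_def le j)
  qed (auto simp: Upper_def)
qed

text \<open>
  Compatibility says that two partial bijections agree where both are defined and that so do their
  inverses.  Hence their union is a partial bijection, and composition distributes over unions.
\<close>

lemma compatible_join:
  assumes a: "a \<in> carrier S" and b: "b \<in> carrier S" and comp: "compatible S a b"
  shows "\<exists>j. is_lub (nat_order S) j {a, b} \<and>
        (\<forall>c\<in>carrier S. is_lub (nat_order S) (c \<otimes> j) {c \<otimes> a, c \<otimes> b} \<and>
                       is_lub (nat_order S) (j \<otimes> c) {a \<otimes> c, b \<otimes> c})"
proof -
  have i: "s_inv S a \<otimes> b \<in> carrier S" "a \<otimes> s_inv S b \<in> carrier S"
    using a b by (auto simp: s_inv_closed mult_closed)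
  have inj: "x = y" if "\<Phi> a x = Some z" "\<Phi> b y = Some z" for x y z
  proof -
    have "\<Phi> (s_inv S a \<otimes> b) y = Some x"
      using that a b by (auto simp: rep_mult_iff s_inv_closed rep_s_inv_iff)
    then show ?thesis using comp idempotent_iff[OF i(1)] by (auto simp: compatible_def)
  qed
  have agree: "y = z" if "\<Phi> a x = Some y" "\<Phi> b x = Some z" for x y z
  proof -
    have "\<Phi> (a \<otimes> s_inv S b) z = Some y"
      using that a b by (auto simp: rep_mult_iff s_inv_closed rep_s_inv_iff)
    then show ?thesis using comp idempotent_iff[OF i(2)] by (auto simp: compatible_def)
  qed
  obtain j where j: "j \<in> carrier S" "\<Phi> j = \<Phi> a ++ \<Phi> b"
    using rep_union[OF a b] agree inj by meson
  have j_iff: "\<Phi> j x = Some y \<longleftrightarrow> \<Phi> a x = Some y \<or> \<Phi> b x = Some y" for x y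
    unfolding j(2) by (rule union_iff) (rule agree)
  show ?thesis
    using a b j(1) by (intro exI[of _ j] conjI ballI is_lub_nat_orderI)
      (auto simp: mult_closed rep_mult_iff j_iff)
qed

lemma idempotent_carrier [simp]: "carrier (idempotent_order S) = idempotents S"
  by (simp add: idempotent_order_def)

lemma idempotent_le_iff:
  assumes "e \<in> idempotents S" "f \<in> idempotents S"
  shows "le (idempotent_order S) e f \<longleftrightarrow> dom (\<Phi> e) \<subseteq> dom (\<Phi> f)"
proof -
  note e = idempotent_partial_identity[OF assms(1)] and f = idempotent_partial_identity[OF assms(2)]
  have "le (idempotent_order S) e f \<longleftrightarrow> \<Phi> e \<subseteq>\<^sub>m \<Phi> f"
    using nat_le_iff e f by (simp add: idempotent_order_def)
  also have "\<dots> \<longleftrightarrow> Some |` dom (\<Phi> e) \<subseteq>\<^sub>m Some |` dom (\<Phi> f)"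
    by (rule arg_cong2[OF e(2) f(2)])
  also have "\<dots> \<longleftrightarrow> dom (\<Phi> e) \<subseteq> dom (\<Phi> f)"
    by (auto simp: map_le_def restrict_map_def dom_def split: if_splits)
  finally show ?thesis .
qed

lemma idempotent_exists:
  assumes "A \<in> domains"
  obtains e where "e \<in> idempotents S" "dom (\<Phi> e) = A"
proof -
  obtain e where e: "e \<in> carrier S" "\<Phi> e = Some |` A" using partial_identity_iff assms by auto
  then have "e \<in> idempotents S" "dom (\<Phi> e) = A"
    by (auto simp: idempotent_iff restrict_Some_iff dom_def)
  then show ?thesis by (rule that)
qed

lemma idempotent_eqI:
  assumes "e \<in> idempotents S" "f \<in> idempotents S" "dom (\<Phi> e) = dom (\<Phi> f)"
  shows "e = f"
proof -
  have "\<Phi> e = \<Phi> f"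
    using idempotent_partial_identity(2)[OF assms(1)] idempotent_partial_identity(2)[OF assms(2)]
      assms(3) by simp
  then show ?thesis
    using rep_faithful idempotent_partial_identity(1) assms(1,2) by (auto simp: inj_on_def)
qed

lemma idempotents_lub:
  assumes "e \<in> idempotents S" "f \<in> idempotents S" "g \<in> idempotents S"
    and "dom (\<Phi> g) = dom (\<Phi> e) \<union> dom (\<Phi> f)"
  shows "least (idempotent_order S) g (Upper (idempotent_order S) {e, f})"
  unfolding least_def
proof (intro conjI ballI)
  fix u assume "u \<in> Upper (idempotent_order S) {e, f}"
  then have "u \<in> idempotents S" "le (idempotent_order S) e u" "le (idempotent_order S) f u"
    using assms(1,2) by (auto simp: Upper_def)
  then show "le (idempotent_order S) g u" using assms by (simp add: idempotent_le_iff)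
qed (use assms in \<open>auto simp: Upper_def idempotent_le_iff\<close>)

lemma idempotents_glb:
  assumes "e \<in> idempotents S" "f \<in> idempotents S" "g \<in> idempotents S"
    and "dom (\<Phi> g) = dom (\<Phi> e) \<inter> dom (\<Phi> f)"
  shows "greatest (idempotent_order S) g (Lower (idempotent_order S) {e, f})"
  unfolding greatest_def
proof (intro conjI ballI)
  fix u assume "u \<in> Lower (idempotent_order S) {e, f}"
  then have "u \<in> idempotents S" "le (idempotent_order S) u e" "le (idempotent_order S) u f"
    using assms(1,2) by (auto simp: Lower_def)
  then show "le (idempotent_order S) u g" using assms by (simp add: idempotent_le_iff)
qed (use assms in \<open>auto simp: Lower_def idempotent_le_iff\<close>)

text \<open>
  The idempotents are the partial identities, so their order is the inclusion order of the field of
  domains.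
\<close>

lemma idempotents_boolean: "boolean_algebra_order (idempotent_order S)"
proof -
  let ?L = "idempotent_order S"
  have D: "dom (\<Phi> e) \<in> domains" if "e \<in> idempotents S" for e
    using idempotent_partial_identity(3)[OF that] .
  obtain z where z: "z \<in> idempotents S" "dom (\<Phi> z) = {}"
    using idempotent_exists[OF domains_empty] .
  obtain u where u: "u \<in> idempotents S" "dom (\<Phi> u) = X"
    using idempotent_exists[OF X_in_domains] .
  have ub: "dom (\<Phi> e) \<subseteq> X" if "e \<in> idempotents S" for e
    using domains_subset[OF D[OF that]] .
  interpret bounded_lattice ?L
  proof
    fix e f assume ef: "e \<in> carrier ?L" "f \<in> carrier ?L"
    show "\<exists>s. least ?L s (Upper ?L {e, f})"
      using ef idempotent_exists[OF domains_Un[OF D D]] idempotents_lub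
      by (metis idempotent_carrier)
    show "\<exists>s. greatest ?L s (Lower ?L {e, f})"
      using ef idempotent_exists[OF domains_Int[OF D D]] idempotents_glb
      by (metis idempotent_carrier)
  next
    show "\<exists>b. least ?L b (carrier ?L)"
      using z by (auto simp: least_def idempotent_le_iff)
    show "\<exists>t. greatest ?L t (carrier ?L)"
      using u ub by (intro exI[of _ u]) (auto simp: greatest_def idempotent_le_iff)
  next
    show "(.=\<^bsub>?L\<^esub>) = (=)" by (simp add: idempotent_order_def)
  next
    fix e f assume "e \<sqsubseteq>\<^bsub>?L\<^esub> f" "f \<sqsubseteq>\<^bsub>?L\<^esub> e" "e \<in> carrier ?L" "f \<in> carrier ?L"
    then have "e = f" by (intro idempotent_eqI) (auto simp: idempotent_le_iff)
    then show "e .=\<^bsub>?L\<^esub> f" by (simp add: idempotent_order_def)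
  qed (auto simp: idempotent_le_iff, auto simp: idempotent_order_def)
  have dom_join: "join ?L e f \<in> idempotents S" "dom (\<Phi> (join ?L e f)) = dom (\<Phi> e) \<union> dom (\<Phi> f)"
    if ef: "e \<in> idempotents S" "f \<in> idempotents S" for e f
  proof -
    obtain g where g: "g \<in> idempotents S" "dom (\<Phi> g) = dom (\<Phi> e) \<union> dom (\<Phi> f)"
      using idempotent_exists[OF domains_Un[OF D D]] ef by metis
    have "join ?L e f = g"
      using joinI[of e f "\<lambda>l. l = g"] least_unique idempotents_lub[OF ef g] ef by auto
    then show "join ?L e f \<in> idempotents S" "dom (\<Phi> (join ?L e f)) = dom (\<Phi> e) \<union> dom (\<Phi> f)"
      using g by auto
  qed
  have dom_meet: "meet ?L e f \<in> idempotents S" "dom (\<Phi> (meet ?L e f)) = dom (\<Phi> e) \<inter> dom (\<Phi> f)"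
    if ef: "e \<in> idempotents S" "f \<in> idempotents S" for e f
  proof -
    obtain g where g: "g \<in> idempotents S" "dom (\<Phi> g) = dom (\<Phi> e) \<inter> dom (\<Phi> f)"
      using idempotent_exists[OF domains_Int[OF D D]] ef by metis
    have "meet ?L e f = g"
      using meetI[of e f "\<lambda>l. l = g"] greatest_unique idempotents_glb[OF ef g] ef by auto
    then show "meet ?L e f \<in> idempotents S" "dom (\<Phi> (meet ?L e f)) = dom (\<Phi> e) \<inter> dom (\<Phi> f)"
      using g by auto
  qed
  have bot: "\<bottom>\<^bsub>?L\<^esub> = z"
    using bottom_eq[of z] z by (auto simp: idempotent_le_iff)
  have top: "\<top>\<^bsub>?L\<^esub> = u"
    using top_eq[of u] u ub by (auto simp: idempotent_le_iff)
  show ?thesis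
  proof
    fix x y w assume "x \<in> carrier ?L" "y \<in> carrier ?L" "w \<in> carrier ?L"
    then show "meet ?L x (join ?L y w) = join ?L (meet ?L x y) (meet ?L x w)"
      by (intro idempotent_eqI) (auto simp: dom_join dom_meet)
  next
    fix x assume x: "x \<in> carrier ?L"
    then have x': "x \<in> idempotents S" by simp
    obtain y where y: "y \<in> idempotents S" "dom (\<Phi> y) = X - dom (\<Phi> x)"
      using idempotent_exists[OF domains_Compl[OF D[OF x']]] .
    have "meet ?L x y = z"
      by (rule idempotent_eqI) (use x' y z in \<open>auto simp: dom_meet\<close>)
    moreover have "join ?L x y = u"
      by (rule idempotent_eqI) (use x' y u ub[OF x'] in \<open>auto simp: dom_join\<close>)
    ultimately show "\<exists>y\<in>carrier ?L. meet ?L x y = \<bottom>\<^bsub>?L\<^esub> \<and> join ?L x y = \<top>\<^bsub>?L\<^esub>"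
      using y bot top by auto
  qed
qed

lemma boolean_inverse_monoid: "boolean_inverse_monoid S"
  using inverse_monoid compatible_join idempotents_boolean
  unfolding boolean_inverse_monoid_def boolean_inverse_monoid_axioms_def by blast

end

section \<open>Countable atomless fields of sets and the Cantor space\<close>

lemma topspace_cantor [simp]: "topspace cantor_space = UNIV"
  by (simp add: cantor_space_def)

definition cylinder :: "(nat \<Rightarrow> bool) \<Rightarrow> nat \<Rightarrow> (nat \<Rightarrow> bool) set" where
  "cylinder t n = {t'. \<forall>i<n. t' i = t i}"

lemma openin_cantor_iff: "openin cantor_space K \<longleftrightarrow> (\<forall>t\<in>K. \<exists>n. cylinder t n \<subseteq> K)"
proof
  assume K: "openin cantor_space K"
  show "\<forall>t\<in>K. \<exists>n. cylinder t n \<subseteq> K"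
  proof
    fix t assume "t \<in> K"
    then obtain U where fin: "finite {i. U i \<noteq> UNIV}" and t: "t \<in> Pi\<^sub>E UNIV U" and U: "Pi\<^sub>E UNIV U \<subseteq> K"
      using K unfolding cantor_space_def openin_product_topology_alt by auto
    obtain n where n: "{i. U i \<noteq> UNIV} \<subseteq> {..<n}"
      using fin finite_nat_iff_bounded by blast
    have "t' \<in> K" if "t' \<in> cylinder t n" for t'
    proof -
      have "t' i \<in> U i" for i
      proof (cases "i < n")
        case True then show ?thesis using that t by (auto simp: cylinder_def)
      next
        case False then show ?thesis using n by auto
      qed
      then show ?thesis using U by auto
    qed
    then show "\<exists>n. cylinder t n \<subseteq> K" by blast
  qed
next
  assume K: "\<forall>t\<in>K. \<exists>n. cylinder t n \<subseteq> K"
  show "openin cantor_space K"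
    unfolding cantor_space_def openin_product_topology_alt
  proof
    fix t assume "t \<in> K"
    then obtain n where n: "cylinder t n \<subseteq> K" using K by auto
    define U where "U = (\<lambda>i. if i < n then {t i} else UNIV)"
    have "{i. U i \<noteq> UNIV} \<subseteq> {..<n}" by (auto simp: U_def)
    then have "finite {i. U i \<noteq> UNIV}" by (rule finite_subset) simp
    moreover have "Pi\<^sub>E UNIV U \<subseteq> cylinder t n"
    proof
      fix s assume s: "s \<in> Pi\<^sub>E UNIV U"
      have "s i = t i" if "i < n" for i using PiE_mem[OF s, of i] that by (simp add: U_def)
      then show "s \<in> cylinder t n" by (simp add: cylinder_def)
    qed
    moreover have "t \<in> Pi\<^sub>E UNIV U" by (auto simp: U_def PiE_iff)
    ultimately show "\<exists>U. finite {i \<in> UNIV. U i \<noteq> topspace (discrete_topology UNIV)} \<and>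
        (\<forall>i\<in>UNIV. openin (discrete_topology UNIV) (U i)) \<and> t \<in> Pi\<^sub>E UNIV U \<and> Pi\<^sub>E UNIV U \<subseteq> K"
      using n by (intro exI[of _ U]) auto
  qed
qed

lemma homeo_group_cantor:
  "carrier (homeo_group cantor_space) = {g. homeomorphic_map cantor_space cantor_space g}"
  "mult (homeo_group cantor_space) = (\<circ>)"
  "one (homeo_group cantor_space) = id"
  by (auto simp: homeo_group_def extensional_UNIV compose_def fun_eq_iff)

lemma group_homeo_cantor: "group (homeo_group cantor_space)"
proof (rule groupI)
  fix g assume "g \<in> carrier (homeo_group cantor_space)"
  then obtain g' where "homeomorphic_maps cantor_space cantor_space g g'"
    by (auto simp: homeo_group_cantor homeomorphic_map_maps)
  then have "homeomorphic_map cantor_space cantor_space g'" "g' \<circ> g = id"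
    by (auto simp: homeomorphic_maps_map)
  then show "\<exists>g'\<in>carrier (homeo_group cantor_space). g' \<otimes>\<^bsub>homeo_group cantor_space\<^esub> g = \<one>\<^bsub>homeo_group cantor_space\<^esub>"
    by (auto simp: homeo_group_cantor)
qed (auto simp: homeo_group_cantor intro: homeomorphic_map_compose)

lemma cylinder_clopen: "openin cantor_space (cylinder t n)" "closedin cantor_space (cylinder t n)"
proof -
  show "openin cantor_space (cylinder t n)"
    unfolding openin_cantor_iff
    by (intro ballI exI[of _ n]) (auto simp: cylinder_def)
  have "openin cantor_space (UNIV - cylinder t n)"
    unfolding openin_cantor_iff
    by (intro ballI exI[of _ n]) (auto simp: cylinder_def)
  then show "closedin cantor_space (cylinder t n)" by (simp add: closedin_def)
qed

lemma in_cylinder: "t \<in> cylinder t n"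
  by (simp add: cylinder_def)

text \<open>
  The compact open subsets of a compact Hausdorff space with a countable basis of such sets and without
  isolated points, described without mention of the topology.
\<close>

locale cantor_field =
  fixes X :: "'x set" and \<A> :: "'x set set"
  assumes subset: "A \<in> \<A> \<Longrightarrow> A \<subseteq> X"
    and nonempty: "X \<noteq> {}"
    and whole: "X \<in> \<A>"
    and Int: "A \<in> \<A> \<Longrightarrow> B \<in> \<A> \<Longrightarrow> A \<inter> B \<in> \<A>"
    and Diff: "A \<in> \<A> \<Longrightarrow> B \<in> \<A> \<Longrightarrow> A - B \<in> \<A>"
    and countable: "countable \<A>"
    and separating: "x \<in> X \<Longrightarrow> y \<in> X \<Longrightarrow> x \<noteq> y \<Longrightarrow> \<exists>A\<in>\<A>. x \<in> A \<and> y \<notin> A"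
    and compact: "\<V> \<subseteq> \<A> \<Longrightarrow> X \<subseteq> \<Union>\<V> \<Longrightarrow> \<exists>\<W>\<subseteq>\<V>. finite \<W> \<and> X \<subseteq> \<Union>\<W>"
    and atomless: "A \<in> \<A> \<Longrightarrow> A \<noteq> {} \<Longrightarrow> \<exists>B\<in>\<A>. B \<noteq> {} \<and> B \<subset> A"
begin

lemma Un: "A \<in> \<A> \<Longrightarrow> B \<in> \<A> \<Longrightarrow> A \<union> B \<in> \<A>"
proof -
  assume AB: "A \<in> \<A>" "B \<in> \<A>"
  then have "A \<union> B = X - ((X - A) - B)" using subset by blast
  then show ?thesis using AB Diff whole by simp
qed

lemma finite_Union: "finite \<V> \<Longrightarrow> \<V> \<subseteq> \<A> \<Longrightarrow> \<Union>\<V> \<in> \<A>"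
proof (induction rule: finite_induct)
  case empty
  then show ?case using Diff[OF whole whole] by simp
qed (auto intro: Un)

text \<open>
  The cells of the construction form a binary tree.  A cell is divided by the \<open>n\<close>-th set of the field if
  that set cuts it, so that every set is eventually a union of cells; otherwise atomlessness supplies
  some division, so that both branches stay nonempty.
\<close>

definition part :: "nat \<Rightarrow> 'x set \<Rightarrow> 'x set" where
  "part n U = (let A = from_nat_into \<A> n in
     if U \<inter> A \<noteq> {} \<and> U - A \<noteq> {} then U \<inter> A else (SOME B. B \<in> \<A> \<and> B \<noteq> {} \<and> B \<subset> U))"

lemma enum: "from_nat_into \<A> n \<in> \<A>"
  using from_nat_into[of \<A>] whole by blast

lemma part_props:
  assumes "U \<in> \<A>" "U \<noteq> {}"
  shows "part n U \<in> \<A>" "part n U \<noteq> {}" "part n U \<subset> U"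
proof -
  have "part n U \<in> \<A> \<and> part n U \<noteq> {} \<and> part n U \<subset> U"
  proof (cases "U \<inter> from_nat_into \<A> n \<noteq> {} \<and> U - from_nat_into \<A> n \<noteq> {}")
    case True
    then have eq: "part n U = U \<inter> from_nat_into \<A> n" by (simp add: part_def)
    show ?thesis unfolding eq using True Int[OF assms(1) enum[of n]] by blast
  next
    case False
    then have eq: "part n U = (SOME B. B \<in> \<A> \<and> B \<noteq> {} \<and> B \<subset> U)" by (auto simp: part_def)
    show ?thesis unfolding eq by (rule someI_ex) (use atomless[OF assms] in blast)
  qed
  then show "part n U \<in> \<A>" "part n U \<noteq> {}" "part n U \<subset> U" by auto
qed

primrec cell :: "(nat \<Rightarrow> bool) \<Rightarrow> nat \<Rightarrow> 'x set" where
  "cell t 0 = X"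
| "cell t (Suc n) = (if t n then part n (cell t n) else cell t n - part n (cell t n))"

primrec cell_of :: "'x \<Rightarrow> nat \<Rightarrow> 'x set" where
  "cell_of x 0 = X"
| "cell_of x (Suc n) =
    (if x \<in> part n (cell_of x n) then part n (cell_of x n) else cell_of x n - part n (cell_of x n))"

text \<open>
  The turns taken by a point on its way down the tree; they are the coordinates of its image in
  the Cantor space.
\<close>

definition code :: "'x \<Rightarrow> nat \<Rightarrow> bool" where
  "code x n \<longleftrightarrow> x \<in> part n (cell_of x n)"

lemma cell_in: "cell t n \<in> \<A>" and cell_nonempty: "cell t n \<noteq> {}"
proof -
  have "cell t n \<in> \<A> \<and> cell t n \<noteq> {}"
  proof (induction n)
    case 0 then show ?case using whole nonempty by simp
  next
    case (Suc n)
    then show ?case using part_props[of "cell t n" n] Diff by auto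
  qed
  then show "cell t n \<in> \<A>" "cell t n \<noteq> {}" by auto
qed

lemma cell_of_code: "cell (code x) n = cell_of x n"
  by (induction n) (auto simp: code_def)

lemma in_own_cell: "x \<in> X \<Longrightarrow> x \<in> cell (code x) n"
  by (induction n) (auto simp: cell_of_code code_def)

lemma cell_cong: "(\<And>i. i < n \<Longrightarrow> t i = s i) \<Longrightarrow> cell t n = cell s n"
  by (induction n) auto

lemma cell_decreasing: "m \<le> n \<Longrightarrow> cell t n \<subseteq> cell t m"
proof (induction n)
  case (Suc n)
  have "cell t (Suc n) \<subseteq> cell t n"
    using part_props(3)[OF cell_in cell_nonempty, of n t n] by auto
  then show ?case using Suc by (cases "m = Suc n") auto
qed simp

lemma in_cell_iff: "x \<in> X \<Longrightarrow> x \<in> cell t n \<longleftrightarrow> (\<forall>i<n. code x i = t i)"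
proof (induction n)
  case (Suc n)
  show ?case
  proof (cases "x \<in> cell t n")
    case True
    then have eq: "\<And>i. i < n \<Longrightarrow> code x i = t i" using Suc by auto
    then have "cell t n = cell_of x n" using cell_cong[of n "code x" t] cell_of_code by auto
    then show ?thesis using True eq by (auto simp: code_def less_Suc_eq)
  next
    case False
    then show ?thesis using Suc cell_decreasing[of n "Suc n" t] by (auto simp: less_Suc_eq)
  qed
qed simp

text \<open>
  Dividing by the set in question at the step at which it is enumerated leaves no cell that it cuts.
\<close>

lemma cell_decides:
  assumes "A \<in> \<A>" shows "\<exists>n. \<forall>t. cell t n \<subseteq> A \<or> cell t n \<inter> A = {}"
proof -
  obtain n where n: "from_nat_into \<A> n = A"
    using from_nat_into_surj[OF countable assms] by auto
  have "cell t (Suc n) \<subseteq> A \<or> cell t (Suc n) \<inter> A = {}" for t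
  proof (cases "cell t n \<inter> A \<noteq> {} \<and> cell t n - A \<noteq> {}")
    case True
    then have "part n (cell t n) = cell t n \<inter> A" by (simp add: part_def n)
    then show ?thesis by auto
  next
    case False
    then show ?thesis using cell_decreasing[of n "Suc n" t] by auto
  qed
  then show ?thesis by blast
qed

lemma code_inj: "inj_on code X"
proof (rule inj_onI, rule ccontr)
  fix x y assume xy: "x \<in> X" "y \<in> X" "code x = code y" "x \<noteq> y"
  then obtain A where A: "A \<in> \<A>" "x \<in> A" "y \<notin> A" using separating by blast
  obtain n where "\<forall>t. cell t n \<subseteq> A \<or> cell t n \<inter> A = {}" using cell_decides[OF A(1)] by auto
  then show False using in_own_cell[OF xy(1), of n] in_own_cell[OF xy(2), of n] xy(3) A by auto
qed

text \<open>
  A branch of the tree is a decreasing sequence of nonempty cells, which have a common point by compactness.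
\<close>

lemma code_surj: "\<exists>x\<in>X. code x = t"
proof (rule ccontr)
  assume none: "\<not> ?thesis"
  \<comment> \<open>were no point coded by \<open>t\<close>, the complements of the cells along \<open>t\<close> would cover the space\<close>
  let ?V = "range (\<lambda>n. X - cell t n)"
  have "X \<subseteq> \<Union>?V"
  proof
    fix x assume x: "x \<in> X"
    with none have "code x \<noteq> t" by auto
    then obtain i where "code x i \<noteq> t i" by auto
    then have "x \<notin> cell t (Suc i)" using in_cell_iff[OF x, of t "Suc i"] by auto
    then show "x \<in> \<Union>?V" using x by blast
  qed
  moreover have "?V \<subseteq> \<A>" using Diff[OF whole cell_in] by auto
  ultimately obtain \<W> where W: "\<W> \<subseteq> ?V" "finite \<W>" "X \<subseteq> \<Union>\<W>" using compact by meson
  then obtain N where N: "finite N" "\<W> = (\<lambda>n. X - cell t n) ` N"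
    using finite_subset_image[of \<W> "\<lambda>n. X - cell t n" UNIV] by auto
  obtain m where m: "\<And>n. n \<in> N \<Longrightarrow> n \<le> m" using N(1) unfolding finite_nat_set_iff_bounded_le by auto
  obtain x where x: "x \<in> cell t m" using cell_nonempty by blast
  then have "x \<in> X" using subset[OF cell_in] by auto
  then obtain n where "n \<in> N" "x \<notin> cell t n" using W(3) N(2) by auto
  then show False using cell_decreasing[OF m] x by auto
qed

lemma code_bij: "bij_betw code X UNIV"
  unfolding bij_betw_def using code_inj code_surj by (auto simp: set_eq_iff image_iff eq_commute[of _ "code _"])

lemma code_image_open:
  assumes "A \<in> \<A>" shows "openin cantor_space (code ` A)"
  unfolding openin_cantor_iff
proof
  fix t assume "t \<in> code ` A"
  then obtain x where x: "x \<in> A" "t = code x" by auto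
  obtain n where n: "\<forall>t. cell t n \<subseteq> A \<or> cell t n \<inter> A = {}" using cell_decides[OF assms] by auto
  have sub: "cell t n \<subseteq> A" using n x in_own_cell[of x n] subset[OF assms] by auto
  have "cylinder t n \<subseteq> code ` A"
  proof
    fix t' assume t': "t' \<in> cylinder t n"
    obtain y where y: "y \<in> X" "code y = t'" using code_surj by blast
    then have "y \<in> cell t n" using in_cell_iff t' by (simp add: cylinder_def)
    then show "t' \<in> code ` A" using sub y by auto
  qed
  then show "\<exists>n. cylinder t n \<subseteq> code ` A" by blast
qed

lemma code_image_clopen:
  assumes "A \<in> \<A>" shows "openin cantor_space (code ` A) \<and> closedin cantor_space (code ` A)"
proof
  have "code ` X = UNIV" using code_bij by (simp add: bij_betw_def)
  then have "UNIV - code ` A = code ` (X - A)"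
    using inj_on_image_set_diff[OF code_inj, of X A] subset[OF assms] by simp
  then show "closedin cantor_space (code ` A)"
    using code_image_open[OF Diff[OF whole assms]] by (simp add: closedin_def)
qed (rule code_image_open[OF assms])

text \<open>
  The cells contained in the preimage or disjoint from it cover the space; finitely many of them already do.
\<close>

lemma clopen_preimage:
  assumes K: "openin cantor_space K" and K': "closedin cantor_space K"
  shows "{x\<in>X. code x \<in> K} \<in> \<A>"
proof -
  define P where "P = {x\<in>X. code x \<in> K}"
  let ?V = "{cell t n | t n. cell t n \<subseteq> P \<or> cell t n \<inter> P = {}}"
  have "X \<subseteq> \<Union>?V"
  proof
    fix x assume x: "x \<in> X"
    define L where "L = (if x \<in> P then K else UNIV - K)"
    have "openin cantor_space L" "code x \<in> L"
      using K K' x by (auto simp: L_def closedin_def P_def)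
    then obtain n where n: "cylinder (code x) n \<subseteq> L"
      unfolding openin_cantor_iff by blast
    have "code y \<in> L" "y \<in> X" if y: "y \<in> cell (code x) n" for y
    proof -
      show y': "y \<in> X" using subset[OF cell_in] y by auto
      show "code y \<in> L" using n in_cell_iff[OF y', of "code x" n] y by (auto simp: cylinder_def)
    qed
    then have "cell (code x) n \<subseteq> P \<or> cell (code x) n \<inter> P = {}"
      by (cases "x \<in> P") (auto simp: L_def P_def)
    then show "x \<in> \<Union>?V" using in_own_cell[OF x, of n] by blast
  qed
  moreover have "?V \<subseteq> \<A>" using cell_in by auto
  ultimately obtain \<W> where W: "\<W> \<subseteq> ?V" "finite \<W>" "X \<subseteq> \<Union>\<W>" using compact by meson
  have "P = \<Union>{W\<in>\<W>. W \<subseteq> P}"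
  proof
    show "P \<subseteq> \<Union>{W\<in>\<W>. W \<subseteq> P}"
    proof
      fix x assume x: "x \<in> P"
      then obtain W where "W \<in> \<W>" "x \<in> W" using W(3) by (auto simp: P_def)
      then show "x \<in> \<Union>{W\<in>\<W>. W \<subseteq> P}" using x W(1) by auto
    qed
  qed auto
  moreover have "{W\<in>\<W>. W \<subseteq> P} \<subseteq> \<A>" using W(1) cell_in by auto
  ultimately show ?thesis using finite_Union[of "{W\<in>\<W>. W \<subseteq> P}"] W(2) by (simp add: P_def)
qed

text \<open>
  Stone duality for the countable atomless Boolean algebra.
\<close>

theorem stone_cantor:
  "\<exists>h. bij_betw h X UNIV \<and>
     (\<forall>A\<subseteq>X. A \<in> \<A> \<longleftrightarrow> openin cantor_space (h ` A) \<and> closedin cantor_space (h ` A))"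
proof (intro exI[of _ code] conjI allI impI iffI)
  fix A assume A: "A \<subseteq> X" "openin cantor_space (code ` A) \<and> closedin cantor_space (code ` A)"
  have "{x\<in>X. code x \<in> code ` A} = A"
    using A(1) inj_on_image_mem_iff[OF code_inj] by auto
  then show "A \<in> \<A>" using clopen_preimage[of "code ` A"] A(2) by simp
next
  fix A assume "A \<in> \<A>"
  then show "openin cantor_space (code ` A)" "closedin cantor_space (code ` A)"
    using code_image_clopen by auto
qed (rule code_bij)

lemma infinite: "infinite \<A>"
proof
  assume fin: "finite \<A>"
  have "X \<in> \<A> - {{}}" using whole nonempty by simp
  then obtain A where A: "A \<in> \<A>" "A \<noteq> {}" "\<forall>B\<in>\<A> - {{}}. B \<subseteq> A \<longrightarrow> A = B"
    using finite_has_minimal[of "\<A> - {{}}"] fin by auto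
  then obtain B where "B \<in> \<A>" "B \<noteq> {}" "B \<subset> A" using atomless by meson
  then show False using A(3) by auto
qed

end

section \<open>Minimal effective representations on compact spaces\<close>

text \<open>
  With the domains as a basis, the represented set becomes a compact Hausdorff space, in which every
  orbit of the partial bijections is dense.  The last condition says that the interior of the set of fixed
  points of each partial bijection is again a domain.
\<close>

locale ample_rep = boolean_rep S \<Phi> X
  for S :: "('s, 'm) monoid_scheme" (structure) and \<Phi> :: "'s \<Rightarrow> 'x \<rightharpoonup> 'x" and X +
  assumes countable_carrier: "countable (carrier S)"
    and separating: "x \<in> X \<Longrightarrow> y \<in> X \<Longrightarrow> x \<noteq> y \<Longrightarrow> \<exists>A\<in>domains. x \<in> A \<and> y \<notin> A"
    and compact: "\<V> \<subseteq> domains \<Longrightarrow> X \<subseteq> \<Union>\<V> \<Longrightarrow> \<exists>\<W>\<subseteq>\<V>. finite \<W> \<and> X \<subseteq> \<Union>\<W>"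
    and minimal: "x \<in> X \<Longrightarrow> A \<in> domains \<Longrightarrow> A \<noteq> {} \<Longrightarrow> \<exists>a\<in>carrier S. \<exists>y\<in>A. \<Phi> a x = Some y"
    and fixed_domain: "a \<in> carrier S \<Longrightarrow> \<exists>A\<in>domains. (\<forall>x\<in>A. \<Phi> a x = Some x) \<and>
      (\<forall>B\<in>domains. B \<noteq> {} \<and> B \<inter> A = {} \<and> B \<subseteq> dom (\<Phi> a) \<longrightarrow> (\<exists>x\<in>B. \<Phi> a x \<noteq> Some x))"
begin

lemma glue_finite:
  assumes f: "inj_on f (dom f)" and fin: "finite \<W>" and sub: "\<W> \<subseteq> domains"
    and loc: "\<And>W. W \<in> \<W> \<Longrightarrow> \<exists>a\<in>carrier S. \<Phi> a = f |` W"
  shows "\<exists>a\<in>carrier S. \<Phi> a = f |` (\<Union>\<W>)"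
  using fin sub loc
proof (induction rule: finite_induct)
  case empty
  obtain a where "a \<in> carrier S" "\<Phi> a = Some |` {}"
    using partial_identity_iff domains_empty by blast
  then show ?case by (intro bexI[of _ a]) (auto simp: restrict_map_def)
next
  case (insert W \<W>)
  obtain a where a: "a \<in> carrier S" "\<Phi> a = f |` W" using insert.prems(2) by blast
  have "\<exists>b\<in>carrier S. \<Phi> b = f |` (\<Union>\<W>)" using insert by simp
  then obtain b where b: "b \<in> carrier S" "\<Phi> b = f |` (\<Union>\<W>)" by blast
  have agree: "y = z" if "\<Phi> a x = Some y" "\<Phi> b x = Some z" for x y z
    using that a b by (simp add: restrict_Some_iff)
  have inj: "x = y" if "\<Phi> a x = Some z" "\<Phi> b y = Some z" for x y z
    using that a b inj_mapD[OF f] by (simp add: restrict_Some_iff)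
  have "\<exists>c\<in>carrier S. \<Phi> c = \<Phi> a ++ \<Phi> b"
    by (rule rep_union[OF a(1) b(1)]) (fact agree, fact inj)
  moreover have "\<Phi> a ++ \<Phi> b = f |` \<Union>(insert W \<W>)"
    unfolding a b by (rule ext) (auto simp: restrict_map_def map_add_def split: option.split)
  ultimately show ?case by simp
qed

text \<open>
  By compactness finitely many local representatives suffice, and they are compatible because all are
  restrictions of the same injection.
\<close>

lemma glue:
  assumes f: "inj_on f (dom f)" and D: "dom f \<in> domains"
    and loc: "\<And>x. x \<in> dom f \<Longrightarrow> \<exists>A\<in>domains. x \<in> A \<and> (\<exists>a\<in>carrier S. \<Phi> a |` A = f |` A)"
  shows "\<exists>a\<in>carrier S. \<Phi> a = f"
proof -
  let ?V = "{W\<in>domains. \<exists>a\<in>carrier S. \<Phi> a = f |` W}"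
  have cover: "X \<subseteq> \<Union>?V"
  proof
    fix x assume x: "x \<in> X"
    show "x \<in> \<Union>?V"
    proof (cases "x \<in> dom f")
      case True
      then obtain A a where A: "A \<in> domains" "x \<in> A" "a \<in> carrier S" "\<Phi> a |` A = f |` A"
        using loc by blast
      then obtain b where "b \<in> carrier S" "\<Phi> b = f |` A" using restriction_exists by metis
      then show ?thesis using A by blast
    next
      case False
      obtain a where a: "a \<in> carrier S" "\<Phi> a = Some |` {}"
        using partial_identity_iff domains_empty by blast
      then have "\<Phi> a = f |` (X - dom f)" by (auto simp: restrict_map_def fun_eq_iff domIff)
      then show ?thesis using a(1) domains_Compl[OF D] x False by blast
    qed
  qed
  have "?V \<subseteq> domains" by blast
  from compact[OF this cover] obtain \<W> where W: "\<W> \<subseteq> ?V" "finite \<W>" "X \<subseteq> \<Union>\<W>" by blast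
  have "\<exists>a\<in>carrier S. \<Phi> a = f |` (\<Union>\<W>)" using W by (intro glue_finite[OF f]) auto
  moreover have "f |` (\<Union>\<W>) = f"
  proof -
    have "dom f \<subseteq> \<Union>\<W>" using W(3) domains_subset[OF D] by blast
    then show ?thesis by (auto simp: restrict_map_def fun_eq_iff) (metis domIff subsetD UnionE)
  qed
  ultimately show ?thesis by simp
qed

subsection \<open>Units\<close>

lemma unit_iff: "u \<in> Units S \<longleftrightarrow> u \<in> carrier S \<and> dom (\<Phi> u) = X \<and> ran (\<Phi> u) = X"
proof
  assume "u \<in> Units S"
  then obtain v where u: "u \<in> carrier S" and v: "v \<in> carrier S" and eq: "v \<otimes> u = \<one>" "u \<otimes> v = \<one>"
    by (auto simp: Units_def)
  have 1: "\<exists>y. \<Phi> u x = Some y" if "x \<in> X" for x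
  proof -
    have "\<Phi> (v \<otimes> u) x = Some x" using that by (simp add: eq rep_one_iff)
    then show ?thesis by (auto simp: rep_mult_iff u v)
  qed
  have 2: "\<exists>y. \<Phi> u y = Some x" if "x \<in> X" for x
  proof -
    have "\<Phi> (u \<otimes> v) x = Some x" using that by (simp add: eq rep_one_iff)
    then show ?thesis by (auto simp: rep_mult_iff u v)
  qed
  show "u \<in> carrier S \<and> dom (\<Phi> u) = X \<and> ran (\<Phi> u) = X"
    using u 1 2 rep_source[OF u] rep_target[OF u] by (auto simp: dom_def ran_def)
next
  assume u: "u \<in> carrier S \<and> dom (\<Phi> u) = X \<and> ran (\<Phi> u) = X"
  let ?v = "s_inv S u"
  have v: "?v \<in> carrier S" using s_inv_closed u by simp
  have "?v \<otimes> u = \<one>"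
    using u v rep_fun_inj[of u]
    by (intro rep_eqI) (auto simp: mult_closed unit_closed rep_mult_iff rep_one_iff rep_s_inv_iff dom_def)
  moreover have "u \<otimes> ?v = \<one>"
    using u v
    by (intro rep_eqI) (auto simp: mult_closed unit_closed rep_mult_iff rep_one_iff rep_s_inv_iff ran_def)
  ultimately show "u \<in> Units S" using u v by (auto simp: Units_def)
qed

text \<open>
  Units read in the coordinates of a bijection of the represented space onto another set; points
  outside that set are fixed, so that the result permutes it.
\<close>

definition unit_perm :: "('x \<Rightarrow> 'y) \<Rightarrow> 's \<Rightarrow> 'y \<Rightarrow> 'y" where
  "unit_perm h u y = (if y \<in> h ` X then h (the (\<Phi> u (inv_into X h y))) else y)"

context
  fixes h :: "'x \<Rightarrow> 'y"
  assumes h: "inj_on h X"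
begin

lemma unit_perm_eq:
  assumes "u \<in> Units S" "\<Phi> u x = Some z"
  shows "unit_perm h u (h x) = h z"
proof -
  have "x \<in> X" using assms rep_source by (auto simp: unit_iff)
  then show ?thesis using assms(2) h by (simp add: unit_perm_def)
qed

lemma unit_value:
  assumes "u \<in> Units S" "x \<in> X"
  obtains z where "\<Phi> u x = Some z" "z \<in> X" "unit_perm h u (h x) = h z"
proof -
  have "x \<in> dom (\<Phi> u)" using assms by (simp add: unit_iff)
  then obtain z where z: "\<Phi> u x = Some z" by blast
  show ?thesis
    using that[OF z _ unit_perm_eq[OF assms(1) z]] rep_target[OF _ z] assms(1) by (simp add: unit_iff)
qed

lemma unit_perm_outside: "y \<notin> h ` X \<Longrightarrow> unit_perm h u y = y"
  by (simp add: unit_perm_def)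

lemma unit_perm_mult:
  assumes u: "u \<in> Units S" and v: "v \<in> Units S"
  shows "unit_perm h (u \<otimes> v) = unit_perm h u \<circ> unit_perm h v"
proof
  fix y
  have uv: "u \<otimes> v \<in> Units S" using monoid.Units_m_closed[OF monoid u v] .
  have c: "u \<in> carrier S" "v \<in> carrier S" using u v by (auto simp: unit_iff)
  show "unit_perm h (u \<otimes> v) y = (unit_perm h u \<circ> unit_perm h v) y"
  proof (cases "y \<in> h ` X")
    case True
    then obtain x where x: "x \<in> X" "y = h x" by blast
    obtain z where z: "\<Phi> v x = Some z" "z \<in> X" "unit_perm h v (h x) = h z"
      using unit_value[OF v x(1)] .
    obtain w where w: "\<Phi> u z = Some w" "w \<in> X" "unit_perm h u (h z) = h w"
      using unit_value[OF u z(2)] .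
    have "\<Phi> (u \<otimes> v) x = Some w" using z w c by (auto simp: rep_mult_iff)
    then show ?thesis using unit_perm_eq[OF uv] x z w by simp
  qed (simp add: unit_perm_outside)
qed

lemma unit_perm_inverse:
  assumes u: "u \<in> Units S"
  obtains v where "v \<in> Units S" "unit_perm h v \<circ> unit_perm h u = id" "unit_perm h u \<circ> unit_perm h v = id"
proof -
  obtain v where v: "v \<in> Units S" "v \<otimes> u = \<one>" "u \<otimes> v = \<one>" using u unfolding Units_def by blast
  have "unit_perm h \<one> = id" using h by (auto simp: unit_perm_def rep_one fun_eq_iff)
  then show ?thesis using that[OF v(1)] unit_perm_mult[OF v(1) u] unit_perm_mult[OF u v(1)] v(2,3) by simp
qed

lemma unit_perm_permutes:
  assumes u: "u \<in> Units S"
  shows "unit_perm h u permutes (h ` X)"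
proof -
  obtain v where "unit_perm h v \<circ> unit_perm h u = id" "unit_perm h u \<circ> unit_perm h v = id"
    using unit_perm_inverse[OF u] .
  then have "bij (unit_perm h u)" by (rule o_bij)
  then show ?thesis unfolding permutes_def bij_iff using unit_perm_outside by blast
qed

lemma unit_perm_inj: "inj_on (unit_perm h) (Units S)"
proof (rule inj_onI)
  fix u v assume u: "u \<in> Units S" and v: "v \<in> Units S" and eq: "unit_perm h u = unit_perm h v"
  have c: "u \<in> carrier S" "v \<in> carrier S" using u v by (auto simp: unit_iff)
  have same: "\<Phi> u x = \<Phi> v x" for x
  proof (cases "x \<in> X")
    case x: True
    obtain z where z: "\<Phi> u x = Some z" "z \<in> X" "unit_perm h u (h x) = h z"
      using unit_value[OF u x] .
    obtain z' where z': "\<Phi> v x = Some z'" "z' \<in> X" "unit_perm h v (h x) = h z'"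
      using unit_value[OF v x] .
    have "z = z'" using eq z z' h by (auto simp: inj_on_def)
    then show ?thesis using z z' by simp
  next
    case False
    then have "x \<notin> dom (\<Phi> u)" "x \<notin> dom (\<Phi> v)" using u v by (auto simp: unit_iff)
    then show ?thesis by (simp add: domIff)
  qed
  show "u = v" by (rule rep_eqI[OF c]) (simp add: same)
qed

definition pullback :: "('y \<Rightarrow> 'y) \<Rightarrow> 'x \<rightharpoonup> 'x" where
  "pullback p x = (if x \<in> X then Some (inv_into X h (p (h x))) else None)"

lemma pullback_bij:
  assumes p: "p permutes (h ` X)"
  shows "inj_on (pullback p) (dom (pullback p))" "dom (pullback p) = X" "ran (pullback p) \<subseteq> X"
proof -
  have in_img: "p (h x) \<in> h ` X" if "x \<in> X" for x
    using that permutes_in_image[OF p] by blast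
  show "inj_on (pullback p) (dom (pullback p))"
  proof (rule inj_mapI)
    fix x x' z assume "pullback p x = Some z" "pullback p x' = Some z"
    then have x: "x \<in> X" "x' \<in> X" "inv_into X h (p (h x)) = inv_into X h (p (h x'))"
      by (auto simp: pullback_def split: if_splits)
    then have "p (h x) = p (h x')" using inv_into_injective[OF x(3)] in_img by blast
    then have "h x = h x'" using permutes_inj[OF p] by (simp add: inj_eq)
    then show "x = x'" using h x by (auto simp: inj_on_def)
  qed
  show "dom (pullback p) = X" by (auto simp: pullback_def dom_def)
  show "ran (pullback p) \<subseteq> X"
    using in_img inv_into_into[of _ h X] by (auto simp: pullback_def ran_def split: if_splits)
qed

lemma unit_perm_surj:
  assumes p: "p permutes (h ` X)" and a: "a \<in> carrier S" "\<Phi> a = pullback p"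
  shows "a \<in> Units S" "unit_perm h a = p"
proof -
  have in_img: "p (h x) \<in> h ` X" if "x \<in> X" for x
    using that permutes_in_image[OF p] by blast
  have val: "\<Phi> a x = Some (inv_into X h (p (h x)))" if "x \<in> X" for x
    using that by (simp add: a(2) pullback_def)
  have "dom (\<Phi> a) = X" using pullback_bij(2)[OF p] by (simp add: a(2))
  moreover have "ran (\<Phi> a) = X"
  proof
    show "ran (\<Phi> a) \<subseteq> X" using pullback_bij(3)[OF p] by (simp add: a(2))
    show "X \<subseteq> ran (\<Phi> a)"
    proof
      fix z assume z: "z \<in> X"
      then have "h z \<in> p ` h ` X" using permutes_image[OF p] by blast
      then obtain x where "x \<in> X" "p (h x) = h z" by auto
      then have "\<Phi> a x = Some z" using z h by (simp add: val)
      then show "z \<in> ran (\<Phi> a)" by (auto simp: ran_def)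
    qed
  qed
  ultimately show a': "a \<in> Units S" using a(1) by (simp add: unit_iff)
  show "unit_perm h a = p"
  proof
    fix y
    show "unit_perm h a y = p y"
    proof (cases "y \<in> h ` X")
      case True
      then obtain x where x: "x \<in> X" "y = h x" by blast
      then have "\<Phi> a x = Some (inv_into X h (p (h x)))" by (simp add: val)
      from unit_perm_eq[OF a' this] show ?thesis
        using x f_inv_into_f[OF in_img[OF x(1)]] by simp
    next
      case False
      then show ?thesis using permutes_not_in[OF p False] by (simp add: unit_perm_outside)
    qed
  qed
qed

end

subsection \<open>The finite case\<close>

text \<open>
  If points are open then minimality supplies every map between two singletons, and every partial
  bijection is a finite union of such maps.
\<close>

lemma finite_all_partial_bijections:
  assumes fin: "finite X" and sing: "\<And>x. x \<in> X \<Longrightarrow> {x} \<in> domains"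
    and f: "inj_on f (dom f)" "dom f \<subseteq> X" "ran f \<subseteq> X"
  shows "\<exists>a\<in>carrier S. \<Phi> a = f"
proof (rule glue[OF f(1)])
  have "A \<in> domains" if "finite A" "A \<subseteq> X" for A
    using that
  proof (induction rule: finite_induct)
    case empty
    show ?case by (rule domains_empty)
  next
    case (insert x A)
    then show ?case using domains_Un[of "{x}" A] sing by simp
  qed
  then show "dom f \<in> domains" using finite_subset[OF f(2) fin] f(2) by blast
  fix x assume x: "x \<in> dom f"
  then obtain y where y: "f x = Some y" by blast
  then have "y \<in> X" using f(3) by (auto simp: ran_def)
  then obtain a where a: "a \<in> carrier S" "\<Phi> a x = Some y"
    using minimal[of x "{y}"] sing x f(2) by blast
  have "\<Phi> a |` {x} = f |` {x}" using a y by (auto simp: restrict_map_def fun_eq_iff)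
  then show "\<exists>A\<in>domains. x \<in> A \<and> (\<exists>a\<in>carrier S. \<Phi> a |` A = f |` A)"
    using a(1) sing x f(2) by blast
qed

definition conj_map :: "('x \<Rightarrow> 'y) \<Rightarrow> 's \<Rightarrow> 'y \<rightharpoonup> 'y" where
  "conj_map h a y = (if y \<in> h ` X then map_option h (\<Phi> a (inv_into X h y)) else None)"

lemma finite_case:
  assumes fin: "finite X" and sing: "\<And>x. x \<in> X \<Longrightarrow> {x} \<in> domains"
  shows "finite (carrier S) \<and> (\<exists>Y :: nat set. finite Y \<and> S \<cong> symmetric_inverse_monoid Y) \<and>
    (\<exists>n. units_of S \<cong> sym_group n)"
proof -
  obtain n and h :: "'x \<Rightarrow> nat" where h: "bij_betw h X {1..n}"
    using fin by (metis bij_betw_iff_card card_atLeastAtMost diff_Suc_1 finite_atLeastAtMost)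
  then have inj: "inj_on h X" and img: "h ` X = {1..n}" by (auto simp: bij_betw_def)
  have conj_iff: "conj_map h a y = Some w \<longleftrightarrow> (\<exists>x z. \<Phi> a x = Some z \<and> y = h x \<and> w = h z)"
    if a: "a \<in> carrier S" for a y w
  proof
    assume "conj_map h a y = Some w"
    then obtain z where "y \<in> h ` X" "\<Phi> a (inv_into X h y) = Some z" "w = h z"
      by (auto simp: conj_map_def split: if_splits)
    then show "\<exists>x z. \<Phi> a x = Some z \<and> y = h x \<and> w = h z" using f_inv_into_f[of y h X] by metis
  next
    assume "\<exists>x z. \<Phi> a x = Some z \<and> y = h x \<and> w = h z"
    then obtain x z where x: "\<Phi> a x = Some z" "y = h x" "w = h z" by blast
    then have "x \<in> X" using rep_source[OF a] by simp
    then show "conj_map h a y = Some w" using x inj by (simp add: conj_map_def)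
  qed
  let ?T = "symmetric_inverse_monoid {1..n}"
  have iso: "conj_map h \<in> iso S ?T"
    unfolding iso_iff
  proof (intro conjI)
    show "conj_map h \<in> hom S ?T"
    proof (rule homI)
      fix a assume a: "a \<in> carrier S"
      have "dom (conj_map h a) \<subseteq> {1..n}"
        unfolding img[symmetric] by (auto simp: conj_map_def split: if_splits)
      moreover have "ran (conj_map h a) \<subseteq> {1..n}"
        unfolding img[symmetric] using rep_target[OF a] by (auto simp: ran_def conj_iff[OF a])
      moreover have "inj_on (conj_map h a) (dom (conj_map h a))"
      proof (rule inj_mapI)
        fix y y' w assume "conj_map h a y = Some w" "conj_map h a y' = Some w"
        then obtain x z x' z' where x: "\<Phi> a x = Some z" "y = h x" "w = h z"
          "\<Phi> a x' = Some z'" "y' = h x'" "w = h z'" unfolding conj_iff[OF a] by blast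
        then have "z = z'" using inj rep_target[OF a] by (auto simp: inj_on_def)
        then show "y = y'" using x rep_fun_inj[OF a x(1)] by simp
      qed
      ultimately show "conj_map h a \<in> carrier ?T" by (simp add: symmetric_inverse_monoid_def)
    next
      fix a b assume a: "a \<in> carrier S" and b: "b \<in> carrier S"
      have "conj_map h (a \<otimes> b) = conj_map h a \<circ>\<^sub>m conj_map h b"
      proof (rule map_eqI)
        fix y w
        show "conj_map h (a \<otimes> b) y = Some w \<longleftrightarrow> (conj_map h a \<circ>\<^sub>m conj_map h b) y = Some w"
        proof
          assume "conj_map h (a \<otimes> b) y = Some w"
          then show "(conj_map h a \<circ>\<^sub>m conj_map h b) y = Some w"
            unfolding conj_iff[OF mult_closed[OF a b]] map_comp_Some_iff conj_iff[OF a] conj_iff[OF b]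
              rep_mult_iff[OF a b] by blast
        next
          assume "(conj_map h a \<circ>\<^sub>m conj_map h b) y = Some w"
          then obtain v where "conj_map h b y = Some v" "conj_map h a v = Some w"
            unfolding map_comp_Some_iff by blast
          then obtain x z x' z' where x: "\<Phi> b x = Some z" "y = h x" "v = h z"
            "\<Phi> a x' = Some z'" "v = h x'" "w = h z'" unfolding conj_iff[OF a] conj_iff[OF b] by blast
          then have "z = x'"
            using inj rep_target[OF b] rep_source[OF a] by (auto simp: inj_on_def)
          then show "conj_map h (a \<otimes> b) y = Some w"
            unfolding conj_iff[OF mult_closed[OF a b]] rep_mult_iff[OF a b] using x by blast
        qed
      qed
      then show "conj_map h (a \<otimes> b) = conj_map h a \<otimes>\<^bsub>?T\<^esub> conj_map h b"
        by (simp add: symmetric_inverse_monoid_def)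
    qed
    then have sub: "conj_map h ` carrier S \<subseteq> carrier ?T" by (auto simp: hom_def)
    show "conj_map h ` carrier S = carrier ?T"
    proof (rule equalityI[OF sub], rule subsetI)
      fix g assume "g \<in> carrier ?T"
      then have g: "dom g \<subseteq> h ` X" "ran g \<subseteq> h ` X" "inj_on g (dom g)"
        by (auto simp: symmetric_inverse_monoid_def img)
      define f where "f x = (if x \<in> X then map_option (inv_into X h) (g (h x)) else None)" for x
      have f_iff: "f x = Some z \<longleftrightarrow> x \<in> X \<and> z \<in> X \<and> g (h x) = Some (h z)" for x z
      proof
        assume "f x = Some z"
        then obtain w where w: "x \<in> X" "g (h x) = Some w" "z = inv_into X h w"
          by (auto simp: f_def split: if_splits)
        then have "w \<in> h ` X" using g(2) by (auto simp: ran_def)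
        then show "x \<in> X \<and> z \<in> X \<and> g (h x) = Some (h z)"
          using w f_inv_into_f[of w h X] inv_into_into[of w h X] by simp
      next
        assume "x \<in> X \<and> z \<in> X \<and> g (h x) = Some (h z)"
        then show "f x = Some z" using inj by (simp add: f_def)
      qed
      have "inj_on f (dom f)"
      proof (rule inj_mapI)
        fix x x' z assume "f x = Some z" "f x' = Some z"
        then have x: "x \<in> X" "x' \<in> X" "g (h x) = Some (h z)" "g (h x') = Some (h z)"
          unfolding f_iff by auto
        then show "x = x'" using inj_mapD[OF g(3) x(3,4)] inj by (auto simp: inj_on_def)
      qed
      moreover have "dom f \<subseteq> X" "ran f \<subseteq> X" by (auto simp: dom_def ran_def f_iff)
      ultimately obtain a where a: "a \<in> carrier S" "\<Phi> a = f"
        using finite_all_partial_bijections[OF fin sing] by blast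
      have "conj_map h a = g"
      proof (rule map_eqI)
        fix y w
        show "conj_map h a y = Some w \<longleftrightarrow> g y = Some w"
        proof
          assume "g y = Some w"
          moreover from this have "y \<in> h ` X" "w \<in> h ` X" using g by (auto simp: ran_def)
          ultimately show "conj_map h a y = Some w"
            unfolding conj_iff[OF a(1)] a(2) f_iff by blast
        qed (auto simp: conj_iff[OF a(1)] a(2) f_iff)
      qed
      then show "g \<in> conj_map h ` carrier S" using a(1) by blast
    qed
    show "inj_on (conj_map h) (carrier S)"
    proof (rule inj_onI)
      fix a b assume a: "a \<in> carrier S" and b: "b \<in> carrier S" and eq: "conj_map h a = conj_map h b"
      have sub: "\<Phi> d x = Some z"
        if c: "c \<in> carrier S" and d: "d \<in> carrier S" and eq: "conj_map h c = conj_map h d"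
          and x: "\<Phi> c x = Some z" for c d x z
      proof -
        have "conj_map h c (h x) = Some (h z)" using x unfolding conj_iff[OF c] by blast
        then have "conj_map h d (h x) = Some (h z)" using eq by simp
        then obtain x' z' where x': "\<Phi> d x' = Some z'" "h x = h x'" "h z = h z'"
          unfolding conj_iff[OF d] by blast
        have "x' = x" "z' = z"
          using x' inj rep_source[OF d x'(1)] rep_target[OF d x'(1)] rep_source[OF c x] rep_target[OF c x]
          by (auto simp: inj_on_def)
        then show ?thesis using x' by simp
      qed
      show "a = b" using sub[OF a b eq] sub[OF b a eq[symmetric]] by (intro rep_eqI a b) blast
    qed
  qed
  have "carrier ?T \<subseteq> (\<Union>A\<in>Pow {1..n}. {m. dom m = A \<and> ran m \<subseteq> {1..n}})"
    by (auto simp: symmetric_inverse_monoid_def)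
  moreover have "finite (\<Union>A\<in>Pow {1..n}. {m :: nat \<rightharpoonup> nat. dom m = A \<and> ran m \<subseteq> {1..n}})"
    by (intro finite_UN_I finite_set_of_finite_maps) (auto intro: finite_subset)
  ultimately have "finite (carrier ?T)" by (rule finite_subset)
  then have "finite (carrier S)" using iso_finite[OF is_isoI[OF iso]] by simp
  moreover have "unit_perm h \<in> iso (units_of S) (sym_group n)"
    unfolding iso_iff
  proof (intro conjI)
    show "unit_perm h \<in> hom (units_of S) (sym_group n)"
      using unit_perm_permutes[OF inj] unit_perm_mult[OF inj]
      by (intro homI) (auto simp: units_of_def sym_group_def img)
    then have sub: "unit_perm h ` carrier (units_of S) \<subseteq> carrier (sym_group n)" by (auto simp: hom_def)
    show "unit_perm h ` carrier (units_of S) = carrier (sym_group n)"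
    proof (rule equalityI[OF sub], rule subsetI)
      fix p assume "p \<in> carrier (sym_group n)"
      then have p: "p permutes (h ` X)" by (simp add: sym_group_def img)
      obtain a where a: "a \<in> carrier S" "\<Phi> a = pullback h p"
        using finite_all_partial_bijections[OF fin sing] pullback_bij[OF inj p] by blast
      have "a \<in> Units S" "unit_perm h a = p" using unit_perm_surj[OF inj p a] .
      then show "p \<in> unit_perm h ` carrier (units_of S)" by (auto simp: units_of_def)
    qed
    show "inj_on (unit_perm h) (carrier (units_of S))"
      using unit_perm_inj[OF inj] by (simp add: units_of_def)
  qed
  ultimately show ?thesis using is_isoI[OF iso] is_isoI by blast
qed

subsection \<open>The Cantor case\<close>

text \<open>
  Minimality only gives a partial bijection \<open>a\<close> that moves \<open>x\<close> into \<open>A\<close>.  Restricted to the points outside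
  \<open>A\<close> that are moved into \<open>A\<close>, its domain is disjoint from its range, so its union with its inverse is
  an involution, which extends by the identity to a unit.
\<close>

lemma unit_minimal:
  assumes x: "x \<in> X" and A: "A \<in> domains" "A \<noteq> {}"
  shows "\<exists>u\<in>Units S. \<exists>y\<in>A. \<Phi> u x = Some y"
proof (cases "x \<in> A")
  case True
  have "\<one> \<in> Units S" using monoid.Units_one_closed[OF monoid] .
  moreover have "\<Phi> \<one> x = Some x" using x by (simp add: rep_one_iff)
  ultimately show ?thesis using True by blast
next
  case False
  obtain a y where a: "a \<in> carrier S" "y \<in> A" "\<Phi> a x = Some y" using minimal[OF x A] by blast
  define D where "D = {x'. \<exists>y\<in>A. \<Phi> a x' = Some y} - A"
  have D: "D \<in> domains" unfolding D_def by (intro domains_Diff domains_preimage a A)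
  obtain b where b: "b \<in> carrier S" "\<Phi> b = \<Phi> a |` D" using restriction_exists[OF a(1) D] by blast
  have b_iff: "\<Phi> b s = Some t \<longleftrightarrow> s \<in> D \<and> \<Phi> a s = Some t" for s t
    by (simp add: b restrict_Some_iff)
  have b_sep: "s \<notin> A \<and> t \<in> A" if "\<Phi> b s = Some t" for s t
    using that by (auto simp: b_iff D_def)
  define c where "c = s_inv S b"
  have c: "c \<in> carrier S" using s_inv_closed[OF b(1)] by (simp add: c_def)
  have c_iff: "\<Phi> c t = Some s \<longleftrightarrow> \<Phi> b s = Some t" for s t
    using rep_s_inv_iff[OF b(1)] by (simp add: c_def)
  have "\<exists>d\<in>carrier S. \<Phi> d = \<Phi> b ++ \<Phi> c"
  proof (rule rep_union[OF b(1) c])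
    fix s t t' assume "\<Phi> b s = Some t" "\<Phi> c s = Some t'"
    then show "t = t'" using b_sep c_iff by blast
  next
    fix s t t' assume "\<Phi> b s = Some t'" "\<Phi> c t = Some t'"
    then show "s = t" using b_sep c_iff by blast
  qed
  then obtain d where d: "d \<in> carrier S" "\<Phi> d = \<Phi> b ++ \<Phi> c" by blast
  have d_iff: "\<Phi> d s = Some t \<longleftrightarrow> \<Phi> b s = Some t \<or> \<Phi> b t = Some s" for s t
  proof -
    have "\<Phi> d s = Some t \<longleftrightarrow> \<Phi> b s = Some t \<or> \<Phi> c s = Some t"
      unfolding d(2) by (rule union_iff) (use b_sep c_iff in blast)
    then show ?thesis by (simp add: c_iff)
  qed
  define R where "R = X - dom (\<Phi> d)"
  have "R \<in> domains" unfolding R_def by (rule domains_Compl) (rule domainsI[OF d(1) refl])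
  then obtain e where e: "e \<in> carrier S" "\<Phi> e = Some |` R" using partial_identity_iff by blast
  have e_iff: "\<Phi> e s = Some t \<longleftrightarrow> s \<in> R \<and> t = s" for s t
    by (auto simp: e restrict_Some_iff)
  have ran_d: "t \<notin> R" if "\<Phi> d s = Some t" for s t
    using that d_iff by (auto simp: R_def dom_def)
  have "\<exists>u\<in>carrier S. \<Phi> u = \<Phi> d ++ \<Phi> e"
  proof (rule rep_union[OF d(1) e(1)])
    fix s t t' assume "\<Phi> d s = Some t" "\<Phi> e s = Some t'"
    then show "t = t'" by (auto simp: e_iff R_def)
  next
    fix s t t' assume "\<Phi> d s = Some t'" "\<Phi> e t = Some t'"
    then show "s = t" using ran_d[of s t'] by (auto simp: e_iff)
  qed
  then obtain u where u: "u \<in> carrier S" "\<Phi> u = \<Phi> d ++ \<Phi> e" by blast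
  have u_iff: "\<Phi> u s = Some t \<longleftrightarrow> \<Phi> d s = Some t \<or> \<Phi> e s = Some t" for s t
    unfolding u(2) by (rule union_iff) (auto simp: e_iff R_def)
  have "X \<subseteq> dom (\<Phi> u)"
  proof
    fix s assume "s \<in> X"
    then show "s \<in> dom (\<Phi> u)" by (cases "s \<in> R") (auto simp: u_iff e_iff R_def dom_def)
  qed
  moreover have "X \<subseteq> ran (\<Phi> u)"
  proof
    fix t assume t: "t \<in> X"
    show "t \<in> ran (\<Phi> u)"
    proof (cases "t \<in> R")
      case True
      then have "\<Phi> u t = Some t" by (simp add: u_iff e_iff)
      then show ?thesis by (rule ranI)
    next
      case False
      then obtain s where "\<Phi> d t = Some s" using t by (auto simp: R_def)
      then have "\<Phi> u s = Some t" unfolding u_iff d_iff by blast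
      then show ?thesis by (rule ranI)
    qed
  qed
  moreover have "dom (\<Phi> u) \<subseteq> X" "ran (\<Phi> u) \<subseteq> X"
    using rep_dom[OF u(1)] rep_target[OF u(1)] by (auto simp: ran_def)
  ultimately have "u \<in> Units S" using u(1) by (simp add: unit_iff)
  moreover have "\<Phi> u x = Some y" unfolding u_iff d_iff b_iff using a False by (auto simp: D_def)
  ultimately show ?thesis using a(2) by blast
qed

text \<open>
  Fullness of the group of units is the gluing lemma; the support of a unit is the complement of the
  interior of its set of fixed points.
\<close>

lemma cantor_case:
  assumes ne: "X \<noteq> {}" and nosing: "\<And>x. x \<in> X \<Longrightarrow> {x} \<notin> domains"
  shows "infinite (carrier S) \<and>
    (\<exists>G. subgroup G (homeo_group cantor_space) \<and>
           units_of S \<cong> (homeo_group cantor_space)\<lparr>carrier := G\<rparr> \<and>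
           full_in cantor_space G \<and>
           acts_minimally cantor_space G \<and>
           (\<forall>g\<in>G. openin cantor_space (support_in cantor_space g) \<and>
                  closedin cantor_space (support_in cantor_space g)))"
proof -
  have dom_image: "domains = (\<lambda>a. dom (\<Phi> a)) ` carrier S" by (auto simp: domains_def)
  interpret F: cantor_field X domains
  proof
    show "countable domains" unfolding dom_image using countable_carrier by simp
    fix A assume A: "A \<in> domains" "A \<noteq> {}"
    then obtain x where x: "x \<in> A" by blast
    then have "x \<in> X" "A \<noteq> {x}" using domains_subset A nosing by auto
    then obtain y where y: "y \<in> A" "y \<noteq> x" using x by blast
    then obtain B where B: "B \<in> domains" "x \<in> B" "y \<notin> B"
      using separating[of x y] x A domains_subset by blast
    show "\<exists>B\<in>domains. B \<noteq> {} \<and> B \<subset> A"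
    proof (intro bexI conjI)
      show "A \<inter> B \<in> domains" using A(1) B(1) by (rule domains_Int)
      show "A \<inter> B \<noteq> {}" "A \<inter> B \<subset> A" using x y B by auto
    qed
  next
    fix A assume "A \<in> domains" then show "A \<subseteq> X" by (rule domains_subset)
  next
    show "X \<noteq> {}" by (rule ne)
    show "X \<in> domains" by (rule X_in_domains)
  next
    fix A B assume AB: "A \<in> domains" "B \<in> domains"
    show "A \<inter> B \<in> domains" using AB by (rule domains_Int)
    show "A - B \<in> domains" using AB by (rule domains_Diff)
  next
    fix x y assume "x \<in> X" "y \<in> X" "x \<noteq> y"
    then show "\<exists>A\<in>domains. x \<in> A \<and> y \<notin> A" by (rule separating)
  next
    fix \<V> assume "\<V> \<subseteq> domains" "X \<subseteq> \<Union>\<V>"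
    then show "\<exists>\<W>\<subseteq>\<V>. finite \<W> \<and> X \<subseteq> \<Union>\<W>" by (rule compact)
  qed
  obtain h where h: "bij_betw h X UNIV"
    and clopen: "\<And>A. A \<subseteq> X \<Longrightarrow> A \<in> domains \<longleftrightarrow> openin cantor_space (h ` A) \<and> closedin cantor_space (h ` A)"
    using F.stone_cantor by blast
  have inj: "inj_on h X" and img: "h ` X = UNIV" using h by (auto simp: bij_betw_def)
  have preimage: "\<exists>A\<in>domains. h ` A = K" if "openin cantor_space K" "closedin cantor_space K" for K
  proof -
    define A where "A = {x\<in>X. h x \<in> K}"
    have "h ` A = K"
    proof
      show "K \<subseteq> h ` A"
      proof
        fix t assume "t \<in> K"
        moreover obtain x where "x \<in> X" "t = h x" using img by blast
        ultimately show "t \<in> h ` A" by (simp add: A_def)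
      qed
    qed (auto simp: A_def)
    moreover have "A \<in> domains" using clopen[of A] that calculation by (simp add: A_def)
    ultimately show ?thesis by blast
  qed
  define \<pi> where "\<pi> = unit_perm h"
  note \<pi>_mult = unit_perm_mult[OF inj, folded \<pi>_def] and \<pi>_eq = unit_perm_eq[OF inj, folded \<pi>_def]
    and \<pi>_permutes = unit_perm_permutes[OF inj, folded \<pi>_def, unfolded img]
    and \<pi>_inj = unit_perm_inj[OF inj, folded \<pi>_def] and unit_value' = unit_value[OF inj, folded \<pi>_def]
  define G where "G = \<pi> ` Units S"
  have open_image: "openin cantor_space (\<pi> u ` K)" if u: "u \<in> Units S" and K: "openin cantor_space K" for u K
    unfolding openin_subopen[of _ "\<pi> u ` K"]
  proof
    have uc: "u \<in> carrier S" using u by (simp add: unit_iff)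
    fix y assume "y \<in> \<pi> u ` K"
    then obtain t where t: "t \<in> K" "y = \<pi> u t" by blast
    then obtain n where n: "cylinder t n \<subseteq> K" using K unfolding openin_cantor_iff by blast
    obtain A where A: "A \<in> domains" "h ` A = cylinder t n" using preimage[OF cylinder_clopen] by blast
    define B where "B = {y. \<exists>x\<in>A. \<Phi> u x = Some y}"
    have B: "B \<in> domains" unfolding B_def by (rule domains_image[OF uc A(1)])
    have "h ` B = \<pi> u ` cylinder t n"
    proof
      show "h ` B \<subseteq> \<pi> u ` cylinder t n"
        unfolding A(2)[symmetric] by (auto simp: B_def \<pi>_eq[OF u, symmetric])
      show "\<pi> u ` cylinder t n \<subseteq> h ` B"
        unfolding A(2)[symmetric]
      proof clarify
        fix x assume x: "x \<in> A"
        then have "x \<in> X" using domains_subset[OF A(1)] by blast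
        from unit_value'[OF u this] obtain z where "\<Phi> u x = Some z" "\<pi> u (h x) = h z" .
        then show "\<pi> u (h x) \<in> h ` B" using x by (auto simp: B_def)
      qed
    qed
    then have "openin cantor_space (\<pi> u ` cylinder t n)"
      using clopen[OF domains_subset[OF B]] B by simp
    moreover have "y \<in> \<pi> u ` cylinder t n" using t in_cylinder by blast
    moreover have "\<pi> u ` cylinder t n \<subseteq> \<pi> u ` K" using n by blast
    ultimately show "\<exists>T. openin cantor_space T \<and> y \<in> T \<and> T \<subseteq> \<pi> u ` K" by blast
  qed
  have bij: "bij (\<pi> u)" if "u \<in> Units S" for u
    using permutes_bij[OF \<pi>_permutes[OF that]] .
  have homeo: "homeomorphic_map cantor_space cantor_space (\<pi> u)" if u: "u \<in> Units S" for u
  proof (rule bijective_open_imp_homeomorphic_map)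
    obtain v where v: "v \<in> Units S" "\<pi> v \<circ> \<pi> u = id" "\<pi> u \<circ> \<pi> v = id"
      using unit_perm_inverse[OF inj u, folded \<pi>_def] .
    have inv: "\<pi> v (\<pi> u t) = t" "\<pi> u (\<pi> v t) = t" for t
      using v(2,3) by (simp_all add: fun_eq_iff)
    have "{t. \<pi> u t \<in> K} = \<pi> v ` K" for K
    proof
      show "{t. \<pi> u t \<in> K} \<subseteq> \<pi> v ` K"
      proof
        fix t assume "t \<in> {t. \<pi> u t \<in> K}"
        then have "\<pi> v (\<pi> u t) \<in> \<pi> v ` K" by (intro imageI) simp
        then show "t \<in> \<pi> v ` K" by (simp add: inv)
      qed
    qed (auto simp: inv)
    then show "continuous_map cantor_space cantor_space (\<pi> u)"
      using open_image[OF v(1)] by (simp add: continuous_map_def)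
    show "open_map cantor_space cantor_space (\<pi> u)"
      using open_image[OF u] by (simp add: open_map_def)
  qed (use bij[OF u] in \<open>auto simp: bij_def\<close>)
  have hom: "\<pi> \<in> hom (units_of S) (homeo_group cantor_space)"
    using homeo \<pi>_mult by (intro homI) (auto simp: units_of_def homeo_group_cantor)
  have gh: "group_hom (units_of S) (homeo_group cantor_space) \<pi>"
    unfolding group_hom_def group_hom_axioms_def
    using monoid.units_group[OF monoid] group_homeo_cantor hom by blast
  have "subgroup G (homeo_group cantor_space)"
    using group_hom.img_is_subgroup[OF gh] by (simp add: G_def units_of_def)
  moreover have "\<pi> \<in> iso (units_of S) ((homeo_group cantor_space)\<lparr>carrier := G\<rparr>)"
    unfolding iso_iff using \<pi>_inj \<pi>_mult
    by (auto intro!: homI simp: G_def units_of_def homeo_group_cantor)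
  moreover have "full_in cantor_space G"
    unfolding full_in_def
  proof (intro ballI impI)
    fix g assume g: "g \<in> carrier (homeo_group cantor_space)"
      and loc: "\<forall>x\<in>topspace cantor_space. \<exists>U. openin cantor_space U \<and> x \<in> U \<and> (\<exists>k\<in>G. \<forall>y\<in>U. g y = k y)"
    have "homeomorphic_map cantor_space cantor_space g" using g by (simp add: homeo_group_cantor)
    then have "bij g"
      using homeomorphic_imp_injective_map homeomorphic_imp_surjective_map by (fastforce simp: bij_def)
    then have p: "g permutes (h ` X)" unfolding img by (intro bij_imp_permutes) auto
    have "\<exists>a\<in>carrier S. \<Phi> a = pullback h g"
    proof (rule glue[OF pullback_bij(1)[OF inj p]], unfold pullback_bij(2)[OF inj p])
      show "X \<in> domains" by (rule X_in_domains)
      fix x assume x: "x \<in> X"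
      obtain U k where U: "openin cantor_space U" "h x \<in> U" "k \<in> G" "\<forall>y\<in>U. g y = k y"
        using loc[rule_format, of "h x"] by auto
      then obtain u where u: "u \<in> Units S" "k = \<pi> u" by (auto simp: G_def)
      obtain n where n: "cylinder (h x) n \<subseteq> U" using U unfolding openin_cantor_iff by blast
      obtain A where A: "A \<in> domains" "h ` A = cylinder (h x) n" using preimage[OF cylinder_clopen] by blast
      have AX: "A \<subseteq> X" using domains_subset[OF A(1)] .
      have "h x \<in> h ` A" using A(2) in_cylinder by simp
      then have "x \<in> A" using inj_on_image_mem_iff[OF inj x AX] by simp
      moreover have "\<Phi> u |` A = pullback h g |` A"
      proof
        fix x'
        show "(\<Phi> u |` A) x' = (pullback h g |` A) x'"
        proof (cases "x' \<in> A")
          case True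
          then have x': "x' \<in> X" using AX by blast
          obtain z where z: "\<Phi> u x' = Some z" "z \<in> X" "\<pi> u (h x') = h z" using unit_value'[OF u(1) x'] .
          have "h x' \<in> U" using True A(2) n by blast
          then have "g (h x') = h z" using U(4) z u by simp
          then show ?thesis using True x' z inj by (simp add: pullback_def[OF inj])
        qed simp
      qed
      ultimately show "\<exists>A\<in>domains. x \<in> A \<and> (\<exists>a\<in>carrier S. \<Phi> a |` A = pullback h g |` A)"
        using A(1) u(1) by (auto simp: unit_iff)
    qed
    then obtain a where a: "a \<in> carrier S" "\<Phi> a = pullback h g" by blast
    have "a \<in> Units S" "\<pi> a = g" using unit_perm_surj[OF inj p a] by (simp_all add: \<pi>_def)
    then show "g \<in> G" by (auto simp: G_def)
  qed
  moreover have "acts_minimally cantor_space G"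
    unfolding acts_minimally_def
  proof
    fix t
    have "s \<in> cantor_space closure_of ((\<lambda>g. g t) ` G)" for s
      unfolding in_closure_of
    proof (intro conjI allI impI)
      fix T assume T: "s \<in> T \<and> openin cantor_space T"
      then obtain n where n: "cylinder s n \<subseteq> T" unfolding openin_cantor_iff by blast
      obtain A where A: "A \<in> domains" "h ` A = cylinder s n" using preimage[OF cylinder_clopen] by blast
      have "A \<noteq> {}" using A(2) in_cylinder by blast
      moreover obtain x where x: "x \<in> X" "t = h x" using img by blast
      ultimately obtain u y where u: "u \<in> Units S" "y \<in> A" "\<Phi> u x = Some y"
        using unit_minimal[OF x(1) A(1)] by blast
      have "\<pi> u t = h y" using \<pi>_eq[OF u(1,3)] x by simp
      then have "\<pi> u t \<in> T" using u(2) A(2) n by blast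
      then show "\<exists>y. y \<in> (\<lambda>g. g t) ` G \<and> y \<in> T" using u(1) by (auto simp: G_def)
    qed simp
    then show "cantor_space closure_of ((\<lambda>g. g t) ` G) = topspace cantor_space" by auto
  qed
  moreover have "openin cantor_space (support_in cantor_space g) \<and> closedin cantor_space (support_in cantor_space g)"
    if gG: "g \<in> G" for g
  proof -
    obtain u where u: "u \<in> Units S" "g = \<pi> u" using gG by (auto simp: G_def)
    then have uc: "u \<in> carrier S" and ud: "dom (\<Phi> u) = X" by (auto simp: unit_iff)
    from fixed_domain[OF uc] obtain A where A: "A \<in> domains" and fixA: "\<forall>x\<in>A. \<Phi> u x = Some x"
      and max: "\<forall>B\<in>domains. B \<noteq> {} \<and> B \<inter> A = {} \<and> B \<subseteq> X \<longrightarrow> (\<exists>x\<in>B. \<Phi> u x \<noteq> Some x)"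
      unfolding ud by (elim bexE conjE) (rule that)
    have AX: "A \<subseteq> X" using domains_subset[OF A] .
    have "support_in cantor_space g = h ` (X - A)"
    proof
      show "support_in cantor_space g \<subseteq> h ` (X - A)"
      proof
        fix t assume t: "t \<in> support_in cantor_space g"
        obtain x where x: "x \<in> X" "t = h x" using img by blast
        have "x \<notin> A"
        proof
          assume "x \<in> A"
          then have "t \<in> h ` A" using x by blast
          moreover have "openin cantor_space (h ` A)" using clopen[OF AX] A by simp
          moreover have "\<forall>T. t \<in> T \<and> openin cantor_space T \<longrightarrow> (\<exists>s. g s \<noteq> s \<and> s \<in> T)"
            using t by (simp add: support_in_def in_closure_of)
          ultimately obtain s where s: "s \<in> h ` A" "g s \<noteq> s" by meson
          then obtain x' where x': "x' \<in> A" "s = h x'" by blast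
          then have "\<Phi> u x' = Some x'" using fixA by simp
          from \<pi>_eq[OF u(1) this] show False using s(2) x'(2) u(2) by simp
        qed
        then show "t \<in> h ` (X - A)" using x by blast
      qed
      show "h ` (X - A) \<subseteq> support_in cantor_space g"
      proof clarify
        fix x assume x: "x \<in> X" "x \<notin> A"
        show "h x \<in> support_in cantor_space g"
          unfolding support_in_def in_closure_of
        proof (intro conjI allI impI)
          fix T assume T: "h x \<in> T \<and> openin cantor_space T"
          then obtain n where n: "cylinder (h x) n \<subseteq> T" unfolding openin_cantor_iff by blast
          obtain B where B: "B \<in> domains" "h ` B = cylinder (h x) n" using preimage[OF cylinder_clopen] by blast
          have BX: "B \<subseteq> X" using domains_subset[OF B(1)] .
          have "h x \<in> h ` B" using B(2) in_cylinder by simp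
          then have xB: "x \<in> B" using inj_on_image_mem_iff[OF inj x(1) BX] by simp
          have "B - A \<in> domains" using B(1) A by (rule domains_Diff)
          moreover have "B - A \<noteq> {} \<and> (B - A) \<inter> A = {} \<and> B - A \<subseteq> X" using x xB BX by auto
          ultimately have "\<exists>x'\<in>B - A. \<Phi> u x' \<noteq> Some x'" by (rule max[rule_format])
          then obtain x' where x': "x' \<in> B" "\<Phi> u x' \<noteq> Some x'" by blast
          then have x'X: "x' \<in> X" using BX by blast
          obtain z where z: "\<Phi> u x' = Some z" "z \<in> X" "\<pi> u (h x') = h z" using unit_value'[OF u(1) x'X] .
          have "g (h x') \<noteq> h x'" using z x' x'X inj u(2) by (auto simp: inj_on_def)
          moreover have "h x' \<in> T" using x'(1) B(2) n by blast
          ultimately show "\<exists>y. y \<in> {x \<in> topspace cantor_space. g x \<noteq> x} \<and> y \<in> T" by auto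
        qed simp
      qed
    qed
    moreover have "X - A \<in> domains" using domains_Compl[OF A] .
    ultimately show ?thesis using clopen[of "X - A"] by simp
  qed
  moreover have "infinite (carrier S)"
    using F.infinite unfolding dom_image by blast
  ultimately show ?thesis using is_isoI by blast
qed

text \<open>
  If one point is isolated then all are, since each can be moved to the isolated one; by compactness the
  space is then finite.
\<close>

lemma isolated_points_dichotomy:
  "finite X \<and> (\<forall>x\<in>X. {x} \<in> domains) \<or> X \<noteq> {} \<and> (\<forall>x\<in>X. {x} \<notin> domains)"
proof (cases "\<exists>x\<in>X. {x} \<in> domains")
  case True
  then obtain x0 where x0: "x0 \<in> X" "{x0} \<in> domains" by blast
  have sing: "{x} \<in> domains" if x: "x \<in> X" for x
  proof -
    obtain a where a: "a \<in> carrier S" "\<Phi> a x = Some x0" using minimal[OF x x0(2)] by blast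
    then have "{x'. \<exists>y\<in>{x0}. \<Phi> a x' = Some y} = {x}" using rep_fun_inj by blast
    then show ?thesis using domains_preimage[OF a(1) x0(2)] by simp
  qed
  have "(\<lambda>x. {x}) ` X \<subseteq> domains" "X \<subseteq> \<Union>((\<lambda>x. {x}) ` X)" using sing by auto
  then obtain \<W> where W: "\<W> \<subseteq> (\<lambda>x. {x}) ` X" "finite \<W>" "X \<subseteq> \<Union>\<W>" using compact by meson
  have "finite (\<Union>\<W>)" using W(1,2) by (intro finite_Union) auto
  then have "finite X" using W(3) by (rule rev_finite_subset)
  then show ?thesis using sing by blast
next
  case False
  then show ?thesis by (cases "X = {}") simp_all
qed

end

section \<open>Arrows and their prefixes\<close>

context arrow_category
begin

abbreviation \<R> :: "('a \<rightharpoonup> 'a) set" where "\<R> \<equiv> carrier (R_monoid C)"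

lemma principalE:
  assumes "b \<in> principal C a"
  obtains c where "c \<in> Arr C" "src C a = tgt C c" "b = cmp C a c"
  using assms by (auto simp: principal_def)

lemma principalI: "c \<in> Arr C \<Longrightarrow> src C a = tgt C c \<Longrightarrow> cmp C a c \<in> principal C a"
  by (auto simp: principal_def)

lemma principal_Arr: "a \<in> Arr C \<Longrightarrow> b \<in> principal C a \<Longrightarrow> b \<in> Arr C"
  by (auto simp: principal_def cmp_closed)

lemma id_Arr: "e \<in> Ids C \<Longrightarrow> e \<in> Arr C"
  using Ids_subset by blast

lemma principal_refl: "a \<in> Arr C \<Longrightarrow> a \<in> principal C a"
  using principalI[of "src C a" a] by (simp add: cmp_src src_Ids tgt_id id_Arr)

lemma principal_trans:
  assumes a: "a \<in> Arr C" and b: "b \<in> principal C a" and c: "c \<in> principal C b"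
  shows "c \<in> principal C a"
proof -
  obtain p where p: "p \<in> Arr C" "src C a = tgt C p" "b = cmp C a p" using b by (rule principalE)
  obtain q where q: "q \<in> Arr C" "src C b = tgt C q" "c = cmp C b q" using c by (rule principalE)
  have "src C p = tgt C q" using p q a by (simp add: src_cmp)
  then have "c = cmp C a (cmp C p q)" "cmp C p q \<in> Arr C" "src C a = tgt C (cmp C p q)"
    using p q a by (simp_all add: cmp_assoc cmp_closed tgt_cmp)
  then show ?thesis using principalI by simp
qed

lemma principal_id_iff:
  assumes "e \<in> Ids C" shows "a \<in> principal C e \<longleftrightarrow> a \<in> Arr C \<and> tgt C a = e"
proof
  assume "a \<in> principal C e"
  then obtain c where c: "c \<in> Arr C" "src C e = tgt C c" "a = cmp C e c" by (rule principalE)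
  then have "tgt C c = e" using assms by (simp add: src_id)
  then have "a = c" using c tgt_cmp_id[of c] by simp
  then show "a \<in> Arr C \<and> tgt C a = e" using c \<open>tgt C c = e\<close> by simp
next
  assume a: "a \<in> Arr C \<and> tgt C a = e"
  then have "cmp C e a \<in> principal C e" using assms by (intro principalI) (auto simp: src_id)
  then show "a \<in> principal C e" using a tgt_cmp_id[of a] by auto
qed

lemma generated_right_ideal:
  assumes "X \<subseteq> Arr C" shows "right_ideal C (generated C X)"
  unfolding right_ideal_def
proof (intro conjI ballI impI)
  show "generated C X \<subseteq> Arr C" using assms principal_Arr by (auto simp: generated_def)
  fix r c assume r: "r \<in> generated C X" and c: "c \<in> Arr C" "src C r = tgt C c"
  obtain x where x: "x \<in> X" "r \<in> principal C x" using r by (auto simp: generated_def)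
  then have "cmp C r c \<in> principal C x"
    using assms principal_trans[OF _ x(2) principalI[OF c]] by blast
  then show "cmp C r c \<in> generated C X" using x(1) by (auto simp: generated_def)
qed

lemma fg_generated: "finite X \<Longrightarrow> X \<subseteq> Arr C \<Longrightarrow> fg_right_ideal C (generated C X)"
  using generated_right_ideal by (auto simp: fg_right_ideal_def)

lemma fgE:
  assumes "fg_right_ideal C R"
  obtains X where "finite X" "X \<subseteq> Arr C" "R = generated C X"
  using assms by (auto simp: fg_right_ideal_def)

lemma fg_Arr: "fg_right_ideal C R \<Longrightarrow> r \<in> R \<Longrightarrow> r \<in> Arr C"
  by (auto simp: fg_right_ideal_def right_ideal_def)

lemma fg_cmp: "fg_right_ideal C R \<Longrightarrow> r \<in> R \<Longrightarrow> c \<in> Arr C \<Longrightarrow> src C r = tgt C c \<Longrightarrow> cmp C r c \<in> R"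
  by (auto simp: fg_right_ideal_def right_ideal_def)

lemma fg_principal_subset: "fg_right_ideal C R \<Longrightarrow> r \<in> R \<Longrightarrow> s \<in> principal C r \<Longrightarrow> s \<in> R"
  using fg_cmp by (auto elim: principalE)

lemma fg_principal: "a \<in> Arr C \<Longrightarrow> fg_right_ideal C (principal C a)"
  using fg_generated[of "{a}"] by (simp add: generated_def)

lemma fg_Un:
  assumes "fg_right_ideal C R" "fg_right_ideal C R'" shows "fg_right_ideal C (R \<union> R')"
proof -
  obtain X where X: "finite X" "X \<subseteq> Arr C" "R = generated C X" using assms(1) by (rule fgE)
  obtain X' where X': "finite X'" "X' \<subseteq> Arr C" "R' = generated C X'" using assms(2) by (rule fgE)
  have "R \<union> R' = generated C (X \<union> X')" unfolding X X' by (simp add: generated_def)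
  then show ?thesis using fg_generated[of "X \<union> X'"] X X' by simp
qed

lemma fg_UN:
  assumes "finite I" "\<And>i. i \<in> I \<Longrightarrow> fg_right_ideal C (R i)"
  shows "fg_right_ideal C (\<Union>i\<in>I. R i)"
  using assms
proof (induction rule: finite_induct)
  case empty
  then show ?case using fg_generated[of "{}"] by (simp add: generated_def)
next
  case (insert i I)
  then show ?case using fg_Un by simp
qed

lemma fg_Int:
  assumes fa: "finitely_aligned C" and R: "fg_right_ideal C R" and R': "fg_right_ideal C R'"
  shows "fg_right_ideal C (R \<inter> R')"
proof -
  obtain X where X: "finite X" "X \<subseteq> Arr C" "R = generated C X" using R by (rule fgE)
  obtain X' where X': "finite X'" "X' \<subseteq> Arr C" "R' = generated C X'" using R' by (rule fgE)
  have "R \<inter> R' = (\<Union>p\<in>X \<times> X'. principal C (fst p) \<inter> principal C (snd p))"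
    unfolding X X' generated_def by auto
  moreover have "fg_right_ideal C (principal C a \<inter> principal C b)" if "a \<in> X" "b \<in> X'" for a b
  proof -
    have "a \<in> Arr C" "b \<in> Arr C" using X(2) X'(2) that by auto
    then have "\<exists>Y. finite Y \<and> Y \<subseteq> Arr C \<and> principal C a \<inter> principal C b = generated C Y"
      using fa by (simp add: finitely_aligned_def)
    then obtain Y where "finite Y" "Y \<subseteq> Arr C" "principal C a \<inter> principal C b = generated C Y"
      by (elim exE conjE)
    then show ?thesis using fg_generated by simp
  qed
  ultimately show ?thesis using fg_UN[of "X \<times> X'" "\<lambda>p. principal C (fst p) \<inter> principal C (snd p)"] X(1) X'(1) by auto
qed

lemma fg_whole: "finite (Ids C) \<Longrightarrow> fg_right_ideal C (Arr C)"
proof -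
  assume "finite (Ids C)"
  moreover have "generated C (Ids C) = Arr C"
    by (auto simp: generated_def principal_id_iff tgt_Ids)
  ultimately show ?thesis using fg_generated[OF _ Ids_subset] by simp
qed

text \<open>
  Membership in terms of the defined values only, so that compositions and inverses of partial
  functions can be treated without reference to \<^const>\<open>the\<close>.
\<close>

lemma R_carrier_iff:
  "\<theta> \<in> \<R> \<longleftrightarrow>
    fg_right_ideal C (dom \<theta>) \<and> fg_right_ideal C (ran \<theta>) \<and> inj_on \<theta> (dom \<theta>) \<and>
    (\<forall>a x. \<theta> a = Some x \<longrightarrow> src C x = src C a \<and>
      (\<forall>c\<in>Arr C. src C a = tgt C c \<longrightarrow> \<theta> (cmp C a c) = Some (cmp C x c)))"
  (is "?L \<longleftrightarrow> ?R")
proof -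
  have bij: "bij_betw (\<lambda>r. the (\<theta> r)) (dom \<theta>) R2 \<longleftrightarrow> inj_on \<theta> (dom \<theta>) \<and> R2 = ran \<theta>" for R2
  proof -
    have "inj_on (\<lambda>r. the (\<theta> r)) (dom \<theta>) \<longleftrightarrow> inj_on \<theta> (dom \<theta>)"
      by (auto simp: inj_on_def dom_def)
    moreover have "(\<lambda>r. the (\<theta> r)) ` dom \<theta> = ran \<theta>"
      by (force simp: ran_def image_iff)
    ultimately show ?thesis by (auto simp: bij_betw_def)
  qed
  show ?thesis
  proof
    assume ?L
    then obtain R1 R2 where R: "fg_right_ideal C R1" "fg_right_ideal C R2" "bijective_morphism C R1 R2 \<theta>"
      by (auto simp: R_monoid_def)
    then have d: "dom \<theta> = R1" and b: "inj_on \<theta> (dom \<theta>) \<and> R2 = ran \<theta>"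
      using bij[of R2] by (auto simp: bijective_morphism_def)
    have "src C x = src C a \<and> (\<forall>c\<in>Arr C. src C a = tgt C c \<longrightarrow> \<theta> (cmp C a c) = Some (cmp C x c))"
      if x: "\<theta> a = Some x" for a x
    proof (intro conjI ballI impI)
      have a: "a \<in> R1" using x d by blast
      have "src C (the (\<theta> a)) = src C a" using R(3) a by (simp add: bijective_morphism_def)
      then show "src C x = src C a" using x by simp
      fix c assume c: "c \<in> Arr C" "src C a = tgt C c"
      then have "cmp C a c \<in> dom \<theta>" using fg_cmp[OF R(1) a] d by simp
      then obtain y where "\<theta> (cmp C a c) = Some y" by blast
      moreover have "the (\<theta> (cmp C a c)) = cmp C (the (\<theta> a)) c"
        using R(3) a c by (simp add: bijective_morphism_def)
      ultimately show "\<theta> (cmp C a c) = Some (cmp C x c)" using x by simp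
    qed
    then show ?R using R d b by auto
  next
    assume R: ?R
    then have "bijective_morphism C (dom \<theta>) (ran \<theta>) \<theta>"
      using bij[of "ran \<theta>"] unfolding bijective_morphism_def by fastforce
    then show ?L using R by (auto simp: R_monoid_def)
  qed
qed

lemma R_carrierI:
  assumes "fg_right_ideal C (dom \<theta>)" "fg_right_ideal C (ran \<theta>)"
    "\<And>a b x. \<theta> a = Some x \<Longrightarrow> \<theta> b = Some x \<Longrightarrow> a = b"
    "\<And>a x. \<theta> a = Some x \<Longrightarrow> src C x = src C a"
    "\<And>a x c. \<theta> a = Some x \<Longrightarrow> c \<in> Arr C \<Longrightarrow> src C a = tgt C c \<Longrightarrow> \<theta> (cmp C a c) = Some (cmp C x c)"
  shows "\<theta> \<in> \<R>"
  unfolding R_carrier_iff using assms inj_mapI[of \<theta>] by blast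

lemma
  assumes "\<theta> \<in> \<R>"
  shows R_dom: "fg_right_ideal C (dom \<theta>)"
    and R_ran: "fg_right_ideal C (ran \<theta>)"
    and R_inj: "inj_on \<theta> (dom \<theta>)"
    and R_src: "\<theta> a = Some x \<Longrightarrow> src C x = src C a"
    and R_cmp: "\<theta> a = Some x \<Longrightarrow> c \<in> Arr C \<Longrightarrow> src C a = tgt C c \<Longrightarrow> \<theta> (cmp C a c) = Some (cmp C x c)"
    and R_Arr1: "\<theta> a = Some x \<Longrightarrow> a \<in> Arr C"
    and R_Arr2: "\<theta> a = Some x \<Longrightarrow> x \<in> Arr C"
proof -
  show "fg_right_ideal C (dom \<theta>)" "fg_right_ideal C (ran \<theta>)" "inj_on \<theta> (dom \<theta>)"
    "\<theta> a = Some x \<Longrightarrow> src C x = src C a"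
    "\<theta> a = Some x \<Longrightarrow> c \<in> Arr C \<Longrightarrow> src C a = tgt C c \<Longrightarrow> \<theta> (cmp C a c) = Some (cmp C x c)"
    using assms unfolding R_carrier_iff by auto
  then show "\<theta> a = Some x \<Longrightarrow> a \<in> Arr C" "\<theta> a = Some x \<Longrightarrow> x \<in> Arr C"
    using fg_Arr[of "dom \<theta>" a] fg_Arr[of "ran \<theta>" x] by (auto simp: ran_def dom_def)
qed

lemma R_identity: "fg_right_ideal C R \<Longrightarrow> Some |` R \<in> \<R>"
proof -
  assume R: "fg_right_ideal C R"
  have d: "dom (Some |` R) = R" "ran (Some |` R) = R"
    by (auto simp: dom_def ran_def restrict_Some_iff)
  show ?thesis by (rule R_carrierI) (auto simp: d R restrict_Some_iff fg_cmp)
qed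

lemma R_pinv:
  assumes \<theta>: "\<theta> \<in> \<R>"
  shows "pinv \<theta> \<in> \<R>"
proof -
  note inv = pinv_Some_iff[OF R_inj[OF \<theta>]]
  have d: "dom (pinv \<theta>) = ran \<theta>" "ran (pinv \<theta>) = dom \<theta>"
    by (auto simp: dom_def ran_def inv)
  show ?thesis
  proof (rule R_carrierI)
    fix x a c assume "pinv \<theta> x = Some a" "c \<in> Arr C" "src C x = tgt C c"
    then show "pinv \<theta> (cmp C x c) = Some (cmp C a c)"
      unfolding inv using R_cmp[OF \<theta>] R_src[OF \<theta>] by simp
  qed (use R_dom[OF \<theta>] R_ran[OF \<theta>] R_src[OF \<theta>] in \<open>auto simp: d inv\<close>)
qed

text \<open>
  The images of generators generate the image.
\<close>

lemma R_image_fg: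
  assumes \<theta>: "\<theta> \<in> \<R>" and R: "fg_right_ideal C R" "R \<subseteq> dom \<theta>"
  shows "fg_right_ideal C {x. \<exists>a\<in>R. \<theta> a = Some x}"
proof -
  obtain X where X: "finite X" "X \<subseteq> Arr C" "R = generated C X" using R(1) by (rule fgE)
  let ?Y = "(\<lambda>a. the (\<theta> a)) ` X"
  have XR: "X \<subseteq> R" using X principal_refl by (auto simp: generated_def)
  have val: "\<theta> a = Some (the (\<theta> a))" if "a \<in> X" for a using that XR R(2) by auto
  have "{x. \<exists>a\<in>R. \<theta> a = Some x} = generated C ?Y"
  proof (intro equalityI subsetI)
    fix x assume "x \<in> {x. \<exists>a\<in>R. \<theta> a = Some x}"
    then obtain a b where a: "\<theta> a = Some x" "b \<in> X" "a \<in> principal C b"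
      unfolding X generated_def by blast
    from a(3) obtain c where c: "c \<in> Arr C" "src C b = tgt C c" "a = cmp C b c" by (rule principalE)
    have "x = cmp C (the (\<theta> b)) c" using R_cmp[OF \<theta> val[OF a(2)] c(1,2)] a c by simp
    then have "x \<in> principal C (the (\<theta> b))"
      using c R_src[OF \<theta> val[OF a(2)]] by (auto intro!: principalI)
    then show "x \<in> generated C ?Y" using a(2) by (auto simp: generated_def)
  next
    fix x assume "x \<in> generated C ?Y"
    then obtain b where b: "b \<in> X" "x \<in> principal C (the (\<theta> b))" by (auto simp: generated_def)
    from b(2) obtain c where c: "c \<in> Arr C" "src C (the (\<theta> b)) = tgt C c" "x = cmp C (the (\<theta> b)) c"
      by (rule principalE)
    have s: "src C b = tgt C c" using c R_src[OF \<theta> val[OF b(1)]] by simp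
    have "\<theta> (cmp C b c) = Some x" using R_cmp[OF \<theta> val[OF b(1)] c(1) s] c by simp
    moreover have "cmp C b c \<in> R" using fg_cmp[OF R(1)] XR b c s by blast
    ultimately show "x \<in> {x. \<exists>a\<in>R. \<theta> a = Some x}" by blast
  qed
  moreover have "?Y \<subseteq> Arr C" using val R_Arr2[OF \<theta>] by blast
  ultimately show ?thesis using fg_generated[of ?Y] X(1) by simp
qed

text \<open>
  The domain and range of the composite correspond to the intersection of a domain and a range, which
  is finitely generated because \<open>C\<close> is finitely aligned.
\<close>

lemma R_comp:
  assumes fa: "finitely_aligned C"
    and \<theta>: "\<theta> \<in> \<R>" and \<eta>: "\<eta> \<in> \<R>"
  shows "\<theta> \<circ>\<^sub>m \<eta> \<in> \<R>"
proof (rule R_carrierI)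
  have I: "fg_right_ideal C (dom \<theta> \<inter> ran \<eta>)" by (rule fg_Int[OF fa R_dom[OF \<theta>] R_ran[OF \<eta>]])
  have "ran (\<theta> \<circ>\<^sub>m \<eta>) = {x. \<exists>a\<in>dom \<theta> \<inter> ran \<eta>. \<theta> a = Some x}"
    by (auto simp: ran_def map_comp_Some_iff)
  then show "fg_right_ideal C (ran (\<theta> \<circ>\<^sub>m \<eta>))" using R_image_fg[OF \<theta> I] by simp
  have "dom (\<theta> \<circ>\<^sub>m \<eta>) = {x. \<exists>a\<in>dom \<theta> \<inter> ran \<eta>. pinv \<eta> a = Some x}"
    unfolding pinv_Some_iff[OF R_inj[OF \<eta>]] by (auto simp: dom_def ran_def map_comp_Some_iff)
  moreover have "dom \<theta> \<inter> ran \<eta> \<subseteq> dom (pinv \<eta>)" using dom_pinv[OF R_inj[OF \<eta>]] by simp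
  ultimately show "fg_right_ideal C (dom (\<theta> \<circ>\<^sub>m \<eta>))" using R_image_fg[OF R_pinv[OF \<eta>] I] by simp
next
  fix a b x assume "(\<theta> \<circ>\<^sub>m \<eta>) a = Some x" "(\<theta> \<circ>\<^sub>m \<eta>) b = Some x"
  then show "a = b"
    using inj_mapD[OF R_inj[OF \<theta>]] inj_mapD[OF R_inj[OF \<eta>]] by (auto simp: map_comp_Some_iff)
next
  fix a x assume "(\<theta> \<circ>\<^sub>m \<eta>) a = Some x"
  then obtain y where y: "\<eta> a = Some y" "\<theta> y = Some x" by (auto simp: map_comp_Some_iff)
  then show s: "src C x = src C a" using R_src[OF \<theta>] R_src[OF \<eta>] by simp
  fix c assume "c \<in> Arr C" "src C a = tgt C c"
  then show "(\<theta> \<circ>\<^sub>m \<eta>) (cmp C a c) = Some (cmp C x c)"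
    using y R_src[OF \<eta> y(1)] R_cmp[OF \<theta> y(2)] R_cmp[OF \<eta> y(1)] by (simp add: map_comp_Some_iff)
qed

lemma R_monoid_rep:
  assumes "finitely_aligned C" "finite (Ids C)"
  shows "partial_bij_rep (R_monoid C) id (Arr C)"
proof -
  have m: "mult (R_monoid C) = (\<circ>\<^sub>m)" "one (R_monoid C) = Some |` Arr C" by (simp_all add: R_monoid_def)
  show ?thesis
  proof
    show "\<one>\<^bsub>R_monoid C\<^esub> \<in> \<R>" using R_identity[OF fg_whole] assms m by simp
    fix a b assume "a \<in> \<R>" "b \<in> \<R>"
    then show "a \<otimes>\<^bsub>R_monoid C\<^esub> b \<in> \<R>" using R_comp assms m by simp
    show "id (a \<otimes>\<^bsub>R_monoid C\<^esub> b) = id a \<circ>\<^sub>m id b" by (simp add: m)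
  next
    show "id \<one>\<^bsub>R_monoid C\<^esub> = Some |` Arr C" by (simp add: m)
    show "inj_on id (\<R>)" by simp
  next
    fix a assume a: "a \<in> \<R>"
    show "inj_on (id a) (dom (id a))" using R_inj[OF a] by simp
    show "dom (id a) \<subseteq> Arr C" using R_Arr1[OF a] by auto
    show "\<exists>b\<in>\<R>. id b = pinv (id a)" using R_pinv[OF a] by simp
  qed
qed

end

section \<open>Infinite paths of a higher rank graph\<close>

context k_graph
begin

text \<open>
  Both products are factorizations of one arrow into the same degrees.
\<close>

lemma cmp_eq_cmpD:
  assumes a: "a \<in> Arr C" "c \<in> Arr C" "src C a = tgt C c"
    and b: "b \<in> Arr C" "d \<in> Arr C" "src C b = tgt C d"
    and eq: "cmp C a c = cmp C b d" and deg: "deg a = deg b"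
  shows "a = b" "c = d"
proof -
  have d1: "deg (cmp C a c) = deg a + deg c" using a by (rule deg_cmp)
  have "deg (cmp C a c) = deg b + deg d" using deg_cmp[OF b] eq by simp
  then have dd: "deg c = deg d" using d1 deg by simp
  have "\<exists>!p. fst p \<in> Arr C \<and> snd p \<in> Arr C \<and> src C (fst p) = tgt C (snd p) \<and>
        cmp C a c = cmp C (fst p) (snd p) \<and> deg (fst p) = deg a \<and> deg (snd p) = deg c"
    using unique_factorization[OF cmp_closed[OF a] d1] .
  then have "(a, c) = (b, d)" by (rule ex1E) (use a b eq deg dd in \<open>metis fst_conv snd_conv\<close>)
  then show "a = b" "c = d" by simp_all
qed

lemma cmp_right_cancel:
  assumes a: "a \<in> Arr C" "c \<in> Arr C" "src C a = tgt C c"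
    and b: "b \<in> Arr C" "src C b = tgt C c" and eq: "cmp C a c = cmp C b c"
  shows "a = b"
proof -
  have "deg a + deg c = deg b + deg c" using deg_cmp[OF a] deg_cmp[OF b(1) a(2) b(2)] eq by simp
  then show ?thesis using cmp_eq_cmpD(1)[OF a b(1) a(2) b(2) eq] by simp
qed

lemma prefix_exists:
  assumes a: "a \<in> Arr C" and deg: "deg a = m + n"
  shows "\<exists>b\<in>Arr C. deg b = m \<and> a \<in> principal C b"
proof -
  obtain p where p: "fst p \<in> Arr C" "snd p \<in> Arr C" "src C (fst p) = tgt C (snd p)"
        "a = cmp C (fst p) (snd p)" "deg (fst p) = m"
    using unique_factorization[OF a deg] by (elim ex1E conjE)
  then show ?thesis using principalI[OF p(2,3)] by (intro bexI[of _ "fst p"]) auto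
qed

text \<open>
  An arrow has only one prefix of each degree, so the prefix \<open>x\<close> of \<open>d\<close> coincides with the prefix of
  \<open>c\<close> of the same degree.
\<close>

lemma prefixes_comparable:
  assumes x: "x \<in> Arr C" "d \<in> principal C x" and c: "c \<in> Arr C" "d \<in> principal C c"
    and deg: "deg c = deg x + n"
  shows "c \<in> principal C x"
proof -
  obtain y where y: "y \<in> Arr C" "deg y = deg x" "c \<in> principal C y" using prefix_exists[OF c(1) deg] by blast
  have "d \<in> principal C y" using principal_trans[OF y(1,3) c(2)] .
  then obtain q where q: "q \<in> Arr C" "src C y = tgt C q" "d = cmp C y q" by (rule principalE)
  obtain p where p: "p \<in> Arr C" "src C x = tgt C p" "d = cmp C x p" using x(2) by (rule principalE)
  have "y = x" using cmp_eq_cmpD(1)[OF y(1) q(1,2) x(1) p(1,2)] q p y(2) by simp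
  then show ?thesis using y by simp
qed

lemma degree_bound:
  assumes "finite Y" shows "\<exists>M. \<forall>y\<in>Y. \<exists>n. M = deg y + n"
proof (intro exI ballI)
  fix y assume "y \<in> Y"
  then show "(\<Sum>y\<in>Y. deg y) = deg y + (\<Sum>y\<in>Y - {y}. deg y)" using assms by (simp add: sum.remove)
qed

text \<open>
  An infinite path is encoded as the set of its finite initial segments.  Being directed, this
  set contains only one arrow of each degree.
\<close>

definition paths :: "'a set set" where
  "paths = {F. F \<subseteq> Arr C \<and> (\<forall>a\<in>F. \<forall>b\<in>Arr C. a \<in> principal C b \<longrightarrow> b \<in> F) \<and>
     (\<forall>a\<in>F. \<forall>b\<in>F. \<exists>c\<in>F. c \<in> principal C a \<and> c \<in> principal C b) \<and> (\<forall>m. \<exists>a\<in>F. deg a = m)}"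

lemma
  assumes "F \<in> paths"
  shows path_Arr: "a \<in> F \<Longrightarrow> a \<in> Arr C"
    and path_prefix: "a \<in> F \<Longrightarrow> b \<in> Arr C \<Longrightarrow> a \<in> principal C b \<Longrightarrow> b \<in> F"
    and path_directed: "a \<in> F \<Longrightarrow> b \<in> F \<Longrightarrow> \<exists>c\<in>F. c \<in> principal C a \<and> c \<in> principal C b"
    and path_degree: "\<exists>a\<in>F. deg a = m"
  using assms unfolding paths_def by blast+

lemma path_extension:
  assumes F: "F \<in> paths" and ab: "a \<in> F" "b \<in> F" "deg b = deg a + n"
  shows "b \<in> principal C a"
proof -
  obtain c where c: "c \<in> F" "c \<in> principal C a" "c \<in> principal C b" using path_directed[OF F ab(1,2)] by blast
  show ?thesis
    using prefixes_comparable[OF path_Arr[OF F ab(1)] c(2) path_Arr[OF F ab(2)] c(3) ab(3)] .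
qed

lemma path_cmpE:
  assumes F: "F \<in> paths" and ab: "a \<in> F" "b \<in> F"
  obtains p where "p \<in> Arr C" "src C a = tgt C p" "cmp C a p \<in> F" "cmp C a p \<in> principal C b"
proof -
  obtain c where c: "c \<in> F" "c \<in> principal C a" "c \<in> principal C b" using path_directed[OF F ab] by blast
  obtain p where "p \<in> Arr C" "src C a = tgt C p" "c = cmp C a p" using c(2) by (rule principalE)
  then show ?thesis using that c by blast
qed

lemma path_degreeE:
  assumes F: "F \<in> paths" and a: "a \<in> F"
  obtains p where "p \<in> Arr C" "src C a = tgt C p" "cmp C a p \<in> F" "deg p = m"
proof -
  obtain b where b: "b \<in> F" "deg b = deg a + m" using path_degree[OF F] by blast
  have "b \<in> principal C a" using path_extension[OF F a b] .
  then obtain p where p: "p \<in> Arr C" "src C a = tgt C p" "b = cmp C a p" by (rule principalE)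
  then have "deg p = m" using deg_cmp[OF path_Arr[OF F a] p(1,2)] b by simp
  then show ?thesis using that p b by blast
qed

text \<open>
  A path contains exactly one arrow of each degree, so paths that are comparable by inclusion coincide.
\<close>

lemma path_subset_eq:
  assumes F: "F \<in> paths" and G: "G \<in> paths" and sub: "F \<subseteq> G"
  shows "F = G"
proof
  show "G \<subseteq> F"
  proof
    fix b assume b: "b \<in> G"
    obtain a where a: "a \<in> F" "deg a = deg b" using path_degree[OF F] by blast
    have "a \<in> principal C b" using path_extension[OF G b, of a 0] a sub by auto
    then show "b \<in> F" using path_prefix[OF F a(1) path_Arr[OF G b]] by blast
  qed
qed (rule sub)

text \<open>
  Iterating the step gives a chain of arrows whose degrees grow without bound in every coordinate; their
  prefixes form a path.  With a trivial \<open>P\<close> this shows that every arrow lies on a path, and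
  with a suitable \<open>P\<close> it is the selection principle behind compactness.
\<close>

lemma path_through_hereditary:
  assumes a: "a \<in> Arr C" "P a"
    and step: "\<And>c. c \<in> Arr C \<Longrightarrow> P c \<Longrightarrow> \<exists>p\<in>Arr C. src C c = tgt C p \<and> deg p = 1 \<and> P (cmp C c p)"
  shows "\<exists>F\<in>paths. a \<in> F \<and> (\<forall>b\<in>F. \<exists>c\<in>F. c \<in> principal C b \<and> P c)"
proof -
  have "\<exists>f. \<forall>n. (f n \<in> Arr C \<and> P (f n) \<and> (n = 0 \<longrightarrow> f n = a)) \<and>
      (f (Suc n) \<in> principal C (f n) \<and> deg (f (Suc n)) = deg (f n) + 1)"
  proof (rule dependent_nat_choice)
    show "\<exists>x. x \<in> Arr C \<and> P x \<and> (0 = (0::nat) \<longrightarrow> x = a)" using a by blast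
    fix x and n :: nat assume x: "x \<in> Arr C \<and> P x \<and> (n = 0 \<longrightarrow> x = a)"
    then obtain p where p: "p \<in> Arr C" "src C x = tgt C p" "deg p = 1" "P (cmp C x p)" using step by blast
    have "cmp C x p \<in> principal C x" "cmp C x p \<in> Arr C" "deg (cmp C x p) = deg x + 1"
      using p x by (auto intro: principalI cmp_closed simp: deg_cmp)
    then show "\<exists>y. (y \<in> Arr C \<and> P y \<and> (Suc n = 0 \<longrightarrow> y = a)) \<and> y \<in> principal C x \<and> deg y = deg x + 1"
      using p(4) by blast
  qed
  then obtain f where f: "\<And>n. f n \<in> Arr C" "\<And>n. P (f n)" "f 0 = a"
    "\<And>n. f (Suc n) \<in> principal C (f n)" "\<And>n. deg (f (Suc n)) = deg (f n) + 1" by blast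
  have mono: "f (n + k) \<in> principal C (f n)" for n k
  proof (induction k)
    case 0 show ?case using principal_refl[OF f(1)] by simp
  next
    case (Suc k)
    show ?case using principal_trans[OF f(1) Suc.IH f(4)] by simp
  qed
  have deg_f: "deg (f n) $ i = deg (f 0) $ i + n" for n i
    by (induction n) (simp_all add: f(5))
  define F where "F = {b \<in> Arr C. \<exists>n. f n \<in> principal C b}"
  have fF: "f n \<in> F" for n using f(1) principal_refl[OF f(1)] by (auto simp: F_def)
  have "F \<in> paths"
    unfolding paths_def
  proof (intro CollectI conjI ballI allI impI)
    show "F \<subseteq> Arr C" by (auto simp: F_def)
  next
    fix b b' assume "b \<in> F" "b' \<in> Arr C" "b \<in> principal C b'"
    then show "b' \<in> F" using principal_trans unfolding F_def by blast
  next
    fix b b' assume "b \<in> F" "b' \<in> F"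
    then obtain n n' where b: "b \<in> Arr C" "f n \<in> principal C b" "b' \<in> Arr C" "f n' \<in> principal C b'"
      by (auto simp: F_def)
    have "f (n + n') \<in> principal C b" using principal_trans[OF b(1,2) mono] .
    moreover have "f (n' + n) \<in> principal C b'" using principal_trans[OF b(3,4) mono] .
    then have "f (n + n') \<in> principal C b'" by (simp add: add.commute)
    ultimately show "\<exists>c\<in>F. c \<in> principal C b \<and> c \<in> principal C b'" using fF by blast
  next
    fix m :: "nat ^ 'k"
    \<comment> \<open>\<open>N\<close> steps of degree \<open>(1, \<dots>, 1)\<close> suffice to exceed every coordinate of \<open>m\<close>\<close>
    define N where "N = (\<Sum>i\<in>UNIV. m $ i)"
    have "m $ i \<le> deg (f N) $ i" for i
    proof -
      have "m $ i \<le> N" unfolding N_def by (rule member_le_sum) auto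
      then show ?thesis using deg_f[of N i] by simp
    qed
    then have "deg (f N) = m + (deg (f N) - m)" by (simp add: vec_eq_iff)
    then obtain b where "b \<in> Arr C" "deg b = m" "f N \<in> principal C b" using prefix_exists[OF f(1)] by blast
    then show "\<exists>b\<in>F. deg b = m" by (auto simp: F_def)
  qed
  moreover have "a \<in> F" using fF[of 0] f(3) by simp
  moreover have "\<exists>c\<in>F. c \<in> principal C b \<and> P c" if b: "b \<in> F" for b
  proof -
    obtain n where "f n \<in> principal C b" using b by (auto simp: F_def)
    then show ?thesis using f(2)[of n] fF[of n] by blast
  qed
  ultimately show ?thesis by blast
qed

lemma path_through:
  assumes ns: "no_sources C deg" and a: "a \<in> Arr C"
  shows "\<exists>F\<in>paths. a \<in> F"
proof -
  have "\<exists>F\<in>paths. a \<in> F \<and> (\<forall>b\<in>F. \<exists>c\<in>F. c \<in> principal C b \<and> True)"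
  proof (rule path_through_hereditary[where P = "\<lambda>_. True"])
    fix c assume "c \<in> Arr C"
    then obtain p where "p \<in> Arr C" "tgt C p = src C c" "deg p = 1"
      using ns src_Ids unfolding no_sources_def by blast
    then show "\<exists>p\<in>Arr C. src C c = tgt C p \<and> deg p = 1 \<and> True" by (intro bexI[of _ p]) simp_all
  qed (simp_all add: a)
  then show ?thesis by blast
qed

definition through :: "'a \<Rightarrow> 'a set set" where
  "through a = {F \<in> paths. a \<in> F}"

text \<open>
  Call a set of paths thin if finitely many members of the cover contain it.  If the paths through an arrow
  are not thin, then neither are those through one of its finitely many extensions by degree
  \<open>(1, \<dots>, 1)\<close>.  This leads to a path with arbitrarily long initial segments of this kind; but some member
  of the cover contains all paths through one of its initial segments.
\<close>

lemma paths_compact: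
  assumes finI: "finite (Ids C)" and rf: "row_finite C deg"
    and op: "\<And>V F. V \<in> \<V> \<Longrightarrow> F \<in> V \<Longrightarrow> F \<in> paths \<Longrightarrow> \<exists>a\<in>F. through a \<subseteq> V"
    and cover: "paths \<subseteq> \<Union>\<V>"
  shows "\<exists>\<W>\<subseteq>\<V>. finite \<W> \<and> paths \<subseteq> \<Union>\<W>"
proof -
  define thin where "thin U \<longleftrightarrow> (\<exists>\<W>\<subseteq>\<V>. finite \<W> \<and> U \<subseteq> \<Union>\<W>)" for U
  have thin_UN: "thin (\<Union>i\<in>I. U i)" if "finite I" "\<And>i. i \<in> I \<Longrightarrow> thin (U i)"
    for I :: "'a set" and U
  proof -
    have "\<forall>i\<in>I. \<exists>\<W>. \<W> \<subseteq> \<V> \<and> finite \<W> \<and> U i \<subseteq> \<Union>\<W>" using that(2) by (auto simp: thin_def)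
    from bchoice[OF this] obtain \<W> where
      W: "\<forall>i\<in>I. \<W> i \<subseteq> \<V> \<and> finite (\<W> i) \<and> U i \<subseteq> \<Union>(\<W> i)" by (elim exE)
    show ?thesis
      unfolding thin_def
    proof (intro exI conjI)
      show "(\<Union>i\<in>I. \<W> i) \<subseteq> \<V>" "finite (\<Union>i\<in>I. \<W> i)" using W that(1) by auto
      show "(\<Union>i\<in>I. U i) \<subseteq> \<Union>(\<Union>i\<in>I. \<W> i)"
      proof (rule UN_least)
        fix i assume i: "i \<in> I"
        then have "U i \<subseteq> \<Union>(\<W> i)" using W by simp
        also have "\<dots> \<subseteq> \<Union>(\<Union>i\<in>I. \<W> i)" using i by (intro Union_mono) auto
        finally show "U i \<subseteq> \<Union>(\<Union>i\<in>I. \<W> i)" .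
      qed
    qed
  qed
  have thin_mono: "thin U" if "thin U'" "U \<subseteq> U'" for U U'
  proof -
    from that(1) obtain \<W> where "\<W> \<subseteq> \<V>" "finite \<W>" "U' \<subseteq> \<Union>\<W>" unfolding thin_def by (elim exE conjE)
    then show ?thesis using that(2) unfolding thin_def by (intro exI[of _ \<W>]) simp
  qed
  have thin_step: "\<exists>p\<in>Arr C. src C c = tgt C p \<and> deg p = 1 \<and> \<not> thin (through (cmp C c p))"
    if c: "c \<in> Arr C" "\<not> thin (through c)" for c
  proof (rule ccontr)
    assume no: "\<not> ?thesis"
    let ?I = "{p \<in> principal C (src C c). deg p = 1}"
    have "finite ?I" using rf src_Ids[OF c(1)] by (simp add: row_finite_def)
    moreover have "thin (through (cmp C c p))" if "p \<in> ?I" for p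
      using that no principal_id_iff[OF src_Ids[OF c(1)]] by auto
    ultimately have "thin (\<Union>p\<in>?I. through (cmp C c p))" by (rule thin_UN)
    moreover have "through c \<subseteq> (\<Union>p\<in>?I. through (cmp C c p))"
    proof
      fix F assume "F \<in> through c"
      then have F: "F \<in> paths" "c \<in> F" by (auto simp: through_def)
      obtain p where "p \<in> Arr C" "src C c = tgt C p" "cmp C c p \<in> F" "deg p = 1"
        using path_degreeE[OF F] .
      then show "F \<in> (\<Union>p\<in>?I. through (cmp C c p))"
        using F principal_id_iff[OF src_Ids[OF c(1)]] by (auto simp: through_def)
    qed
    ultimately show False using c(2) thin_mono by blast
  qed
  have thin_all: "thin (through c)" if c: "c \<in> Arr C" for c
  proof (rule ccontr)
    assume "\<not> thin (through c)"
    then obtain F where F: "F \<in> paths" "\<forall>b\<in>F. \<exists>d\<in>F. d \<in> principal C b \<and> \<not> thin (through d)"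
      using path_through_hereditary[OF c, of "\<lambda>c. \<not> thin (through c)"] thin_step by blast
    then obtain V where V: "V \<in> \<V>" "F \<in> V" using cover by blast
    then obtain b where b: "b \<in> F" "through b \<subseteq> V" using op F(1) by blast
    then obtain d where d: "d \<in> F" "d \<in> principal C b" "\<not> thin (through d)" using F(2) by blast
    have "through d \<subseteq> through b"
      using path_prefix[OF _ _ path_Arr[OF F(1) b(1)] d(2)] by (auto simp: through_def)
    then have "through d \<subseteq> \<Union>{V}" using b by blast
    then have "thin (through d)" unfolding thin_def using V(1) by (intro exI[of _ "{V}"]) simp
    then show False using d(3) by simp
  qed
  have "thin (\<Union>e\<in>Ids C. through e)" by (rule thin_UN[OF finI]) (simp add: thin_all id_Arr)
  moreover have "paths \<subseteq> (\<Union>e\<in>Ids C. through e)"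
  proof
    fix F assume F: "F \<in> paths"
    then obtain a where a: "a \<in> F" using path_degree by blast
    have aA: "a \<in> Arr C" using path_Arr[OF F a] .
    then have "tgt C a \<in> F" using path_prefix[OF F a, of "tgt C a"] by (simp add: id_Arr tgt_Ids principal_id_iff)
    then show "F \<in> (\<Union>e\<in>Ids C. through e)" using F tgt_Ids[OF aA] by (auto simp: through_def)
  qed
  ultimately have "thin paths" by (rule thin_mono)
  then show ?thesis by (simp add: thin_def)
qed

subsection \<open>The action on infinite paths\<close>

text \<open>
  The path \<open>x F'\<close>, where \<open>F = a F'\<close>.
\<close>

definition transplant :: "'a \<Rightarrow> 'a \<Rightarrow> 'a set \<Rightarrow> 'a set" where
  "transplant a x F = {b \<in> Arr C. \<exists>p\<in>Arr C. src C a = tgt C p \<and> cmp C a p \<in> F \<and> cmp C x p \<in> principal C b}"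

definition act :: "('a \<rightharpoonup> 'a) \<Rightarrow> 'a set \<rightharpoonup> 'a set" where
  "act \<theta> F = (if F \<in> paths \<and> F \<inter> dom \<theta> \<noteq> {}
     then Some {b \<in> Arr C. \<exists>a\<in>F. \<exists>x. \<theta> a = Some x \<and> x \<in> principal C b} else None)"

lemma transplantI:
  assumes F: "a \<in> Arr C" "x \<in> Arr C" "src C x = src C a"
    and p: "p \<in> Arr C" "src C a = tgt C p" "cmp C a p \<in> F"
  shows "cmp C x p \<in> transplant a x F"
proof -
  have "cmp C x p \<in> Arr C" using F p by (simp add: cmp_closed)
  then show ?thesis using p principal_refl by (auto simp: transplant_def)
qed

lemma transplant_path:
  assumes F: "F \<in> paths" "a \<in> F" and x: "x \<in> Arr C" "src C x = src C a"
  shows "transplant a x F \<in> paths" "x \<in> transplant a x F"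
proof -
  have a: "a \<in> Arr C" using path_Arr[OF F] .
  show "x \<in> transplant a x F"
    using transplantI[OF a x, of "src C a" F] a F x cmp_src[of a] cmp_src[of x]
    by (simp add: id_Arr src_Ids tgt_id)
  show "transplant a x F \<in> paths"
    unfolding paths_def
  proof (intro CollectI conjI ballI allI impI)
    show "transplant a x F \<subseteq> Arr C" by (auto simp: transplant_def)
  next
    fix b b' assume "b \<in> transplant a x F" "b' \<in> Arr C" "b \<in> principal C b'"
    then show "b' \<in> transplant a x F" using principal_trans[of b' b] unfolding transplant_def by blast
  next
    fix b b' assume "b \<in> transplant a x F" "b' \<in> transplant a x F"
    then obtain p p' where b: "b \<in> Arr C" "p \<in> Arr C" "src C a = tgt C p" "cmp C a p \<in> F" "cmp C x p \<in> principal C b"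
      and b': "b' \<in> Arr C" "p' \<in> Arr C" "src C a = tgt C p'" "cmp C a p' \<in> F" "cmp C x p' \<in> principal C b'"
      unfolding transplant_def by blast
    have key: "cmp C x q \<in> principal C b"
      if p: "p \<in> Arr C" "src C a = tgt C p" "cmp C x p \<in> principal C b" "b \<in> Arr C"
        and q: "q \<in> Arr C" "src C a = tgt C q" "cmp C a q \<in> principal C (cmp C a p)" for p q b
    proof -
      from q(3) obtain r where r: "r \<in> Arr C" "src C (cmp C a p) = tgt C r" "cmp C a q = cmp C (cmp C a p) r"
        by (rule principalE)
      have pr: "src C p = tgt C r" using r p a by (simp add: src_cmp)
      have "cmp C a q = cmp C a (cmp C p r)" using r pr p a by (simp add: cmp_assoc)
      then have "q = cmp C p r"
        using cmp_eq_cmpD(2)[OF a q(1,2) a, of "cmp C p r"] p r pr by (simp add: cmp_closed tgt_cmp)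
      then have "cmp C x q = cmp C (cmp C x p) r" using cmp_assoc[OF x(1) p(1) r(1)] x p pr by simp
      moreover have "cmp C (cmp C x p) r \<in> principal C (cmp C x p)"
        using principalI[OF r(1)] x p pr by (simp add: src_cmp)
      ultimately show ?thesis using principal_trans[OF p(4,3)] by simp
    qed
    obtain c where c: "c \<in> F" "c \<in> principal C (cmp C a p)" "c \<in> principal C (cmp C a p')"
      using path_directed[OF F(1) b(4) b'(4)] by blast
    have "c \<in> principal C a" using principal_trans[OF a principalI[OF b(2,3)] c(2)] .
    then obtain q where q: "q \<in> Arr C" "src C a = tgt C q" "c = cmp C a q" by (rule principalE)
    have "cmp C x q \<in> principal C b" "cmp C x q \<in> principal C b'"
      using key[OF b(2,3,5,1) q(1,2)] key[OF b'(2,3,5,1) q(1,2)] c q by simp_all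
    moreover have "cmp C x q \<in> transplant a x F" using transplantI[OF a x q(1,2)] q c by simp
    ultimately show "\<exists>c\<in>transplant a x F. c \<in> principal C b \<and> c \<in> principal C b'" by blast
  next
    fix m
    obtain p where p: "p \<in> Arr C" "src C a = tgt C p" "cmp C a p \<in> F" "deg p = m" using path_degreeE[OF F] .
    have "cmp C x p \<in> Arr C" "deg (cmp C x p) = m + deg x" using p x by (simp_all add: cmp_closed deg_cmp add.commute)
    then obtain b where "b \<in> Arr C" "deg b = m" "cmp C x p \<in> principal C b" using prefix_exists by blast
    then show "\<exists>b\<in>transplant a x F. deg b = m" using p by (auto simp: transplant_def)
  qed
qed

lemma transplant_transplant:
  assumes F: "F \<in> paths" "a \<in> F" and x: "x \<in> Arr C" "src C x = src C a" and y: "y \<in> Arr C" "src C y = src C a"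
  shows "transplant x y (transplant a x F) = transplant a y F"
proof (rule path_subset_eq[symmetric])
  have a: "a \<in> Arr C" using path_Arr[OF F] .
  show "transplant a y F \<in> paths" using transplant_path(1)[OF F y] .
  show "transplant x y (transplant a x F) \<in> paths"
    by (rule transplant_path(1)[OF transplant_path[OF F x]]) (use x y in auto)
  show "transplant a y F \<subseteq> transplant x y (transplant a x F)"
  proof
    fix b assume "b \<in> transplant a y F"
    then obtain p where p: "b \<in> Arr C" "p \<in> Arr C" "src C a = tgt C p" "cmp C a p \<in> F" "cmp C y p \<in> principal C b"
      unfolding transplant_def by blast
    have "cmp C x p \<in> transplant a x F" using transplantI[OF a x p(2,3,4)] .
    then show "b \<in> transplant x y (transplant a x F)" using p x unfolding transplant_def[of x] by auto
  qed
qed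

lemma transplant_same:
  assumes F: "F \<in> paths" "a \<in> F" shows "transplant a a F = F"
proof (rule path_subset_eq[symmetric])
  have a: "a \<in> Arr C" using path_Arr[OF F] .
  show "transplant a a F \<in> paths" using transplant_path(1)[OF F a] by simp
  show "F \<subseteq> transplant a a F"
  proof
    fix b assume b: "b \<in> F"
    obtain p where "p \<in> Arr C" "src C a = tgt C p" "cmp C a p \<in> F" "cmp C a p \<in> principal C b"
      using path_cmpE[OF F b] .
    then show "b \<in> transplant a a F" using path_Arr[OF F(1) b] by (auto simp: transplant_def)
  qed
qed (rule F)

text \<open>
  The result does not depend on the initial segment of \<open>F\<close> at which \<open>\<theta>\<close> is evaluated, because any two
  initial segments have a common extension in \<open>F\<close>.
\<close>

lemma act_eq:
  assumes \<theta>: "\<theta> \<in> \<R>" and F: "F \<in> paths" "a \<in> F" and x: "\<theta> a = Some x"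
  shows "act \<theta> F = Some (transplant a x F)"
proof -
  have a: "a \<in> Arr C" using path_Arr[OF F] .
  have "{b \<in> Arr C. \<exists>a\<in>F. \<exists>x. \<theta> a = Some x \<and> x \<in> principal C b} = transplant a x F" (is "?L = ?R")
  proof (intro equalityI subsetI)
    fix b assume "b \<in> ?L"
    then obtain c z where c: "b \<in> Arr C" "c \<in> F" "\<theta> c = Some z" "z \<in> principal C b" by blast
    obtain p where p: "p \<in> Arr C" "src C a = tgt C p" "cmp C a p \<in> F" "cmp C a p \<in> principal C c"
      using path_cmpE[OF F c(2)] .
    from p(4) obtain q where q: "q \<in> Arr C" "src C c = tgt C q" "cmp C a p = cmp C c q" by (rule principalE)
    have "cmp C x p = cmp C z q" using R_cmp[OF \<theta> x p(1,2)] R_cmp[OF \<theta> c(3) q(1,2)] q(3) by simp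
    moreover have "cmp C z q \<in> principal C z" using q R_src[OF \<theta> c(3)] by (simp add: principalI)
    ultimately have "cmp C x p \<in> principal C b" using principal_trans[OF c(1,4)] by simp
    then show "b \<in> ?R" using p c(1) by (auto simp: transplant_def)
  next
    fix b assume "b \<in> ?R"
    then obtain p where p: "b \<in> Arr C" "p \<in> Arr C" "src C a = tgt C p" "cmp C a p \<in> F" "cmp C x p \<in> principal C b"
      unfolding transplant_def by blast
    then show "b \<in> ?L" using R_cmp[OF \<theta> x p(2,3)] by blast
  qed
  then show ?thesis using F x by (auto simp: act_def)
qed

lemma act_NoneI: "F \<notin> paths \<or> F \<inter> dom \<theta> = {} \<Longrightarrow> act \<theta> F = None"
  by (auto simp: act_def)

lemma dom_act: "dom (act \<theta>) = {F \<in> paths. F \<inter> dom \<theta> \<noteq> {}}"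
  by (auto simp: act_def dom_def)

lemma act_SomeE:
  assumes \<theta>: "\<theta> \<in> \<R>" and G: "act \<theta> F = Some G"
  obtains a x where "F \<in> paths" "a \<in> F" "\<theta> a = Some x" "G = transplant a x F" "G \<in> paths" "x \<in> G"
proof -
  have F: "F \<in> paths" "F \<inter> dom \<theta> \<noteq> {}" using G by (auto simp: act_def split: if_splits)
  then obtain a x where a: "a \<in> F" "\<theta> a = Some x" by blast
  have "G = transplant a x F" using act_eq[OF \<theta> F(1) a] G by simp
  then show ?thesis
    using that[OF F(1) a] transplant_path[OF F(1) a(1) R_Arr2[OF \<theta> a(2)] R_src[OF \<theta> a(2)]] by simp
qed

lemma act_in:
  assumes \<theta>: "\<theta> \<in> \<R>" and F: "F \<in> paths" "a \<in> F" and x: "\<theta> a = Some x"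
  shows "\<exists>G\<in>paths. act \<theta> F = Some G \<and> x \<in> G"
  using act_eq[OF assms] transplant_path[OF F R_Arr2[OF \<theta> x] R_src[OF \<theta> x]] by simp

lemma act_identity:
  assumes R: "fg_right_ideal C R" shows "act (Some |` R) F = Some G \<longleftrightarrow> F \<in> paths \<and> F \<inter> R \<noteq> {} \<and> G = F"
proof (cases "F \<in> paths \<and> F \<inter> R \<noteq> {}")
  case True
  then obtain a where a: "a \<in> F" "(Some |` R) a = Some a" by (auto simp: restrict_Some_iff)
  show ?thesis using act_eq[OF R_identity[OF R] _ a] transplant_same[OF _ a(1)] True by auto
next
  case False
  then have "act (Some |` R) F = None" by (intro act_NoneI) (auto simp: restrict_map_def dom_def split: if_splits)
  then show ?thesis using False by auto
qed

lemma act_comp: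
  assumes fa: "finitely_aligned C" and \<theta>: "\<theta> \<in> \<R>" and \<eta>: "\<eta> \<in> \<R>"
  shows "act (\<theta> \<circ>\<^sub>m \<eta>) = act \<theta> \<circ>\<^sub>m act \<eta>"
proof
  fix F
  show "act (\<theta> \<circ>\<^sub>m \<eta>) F = (act \<theta> \<circ>\<^sub>m act \<eta>) F"
  proof (cases "F \<in> paths \<and> F \<inter> dom (\<theta> \<circ>\<^sub>m \<eta>) \<noteq> {}")
    case True
    then obtain a y where F: "F \<in> paths" and a: "a \<in> F" "(\<theta> \<circ>\<^sub>m \<eta>) a = Some y" by blast
    then obtain x where x: "\<eta> a = Some x" "\<theta> x = Some y" by (auto simp: map_comp_Some_iff)
    have xx: "x \<in> Arr C" "src C x = src C a" using R_Arr2[OF \<eta> x(1)] R_src[OF \<eta> x(1)] by simp_all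
    have yy: "y \<in> Arr C" "src C y = src C a" using R_Arr2[OF \<theta> x(2)] R_src[OF \<theta> x(2)] xx by simp_all
    have "act \<eta> F = Some (transplant a x F)" using act_eq[OF \<eta> F a(1) x(1)] .
    moreover have "act \<theta> (transplant a x F) = Some (transplant x y (transplant a x F))"
      using act_eq[OF \<theta> _ _ x(2)] transplant_path[OF F a(1) xx] by simp
    moreover have "act (\<theta> \<circ>\<^sub>m \<eta>) F = Some (transplant a y F)" using act_eq[OF R_comp[OF fa \<theta> \<eta>] F a] .
    ultimately show ?thesis using transplant_transplant[OF F a(1) xx yy] by (simp add: map_comp_def)
  next
    case False
    then have "act (\<theta> \<circ>\<^sub>m \<eta>) F = None" by (intro act_NoneI) auto
    moreover have "(act \<theta> \<circ>\<^sub>m act \<eta>) F \<noteq> Some H" for H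
    proof
      assume "(act \<theta> \<circ>\<^sub>m act \<eta>) F = Some H"
      then obtain G where G: "act \<eta> F = Some G" "act \<theta> G = Some H" by (auto simp: map_comp_Some_iff)
      obtain a x where a: "F \<in> paths" "a \<in> F" "\<eta> a = Some x" "G = transplant a x F" using act_SomeE[OF \<eta> G(1)] .
      obtain z y where z: "z \<in> G" "\<theta> z = Some y" using act_SomeE[OF \<theta> G(2)] .
      obtain p where p: "p \<in> Arr C" "src C a = tgt C p" "cmp C a p \<in> F" "cmp C x p \<in> principal C z"
        using z(1) a(4) unfolding transplant_def by blast
      have "cmp C x p \<in> dom \<theta>" using fg_principal_subset[OF R_dom[OF \<theta>] _ p(4)] z(2) by blast
      moreover have "\<eta> (cmp C a p) = Some (cmp C x p)" using R_cmp[OF \<eta> a(3) p(1,2)] .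
      ultimately have "cmp C a p \<in> dom (\<theta> \<circ>\<^sub>m \<eta>)" by (auto simp: map_comp_Some_iff dom_def)
      then show False using False a(1) p(3) by blast
    qed
    ultimately show ?thesis by (metis option.exhaust)
  qed
qed

lemma act_pinv_imp:
  assumes fa: "finitely_aligned C" and \<theta>: "\<theta> \<in> \<R>" and G: "act \<theta> F = Some G"
  shows "act (pinv \<theta>) G = Some F"
proof -
  have "pinv \<theta> \<circ>\<^sub>m \<theta> = Some |` dom \<theta>"
    using inj_mapD[OF R_inj[OF \<theta>]]
    by (intro map_eqI) (auto simp: map_comp_Some_iff pinv_Some_iff[OF R_inj[OF \<theta>]] restrict_Some_iff)
  then have "(act (pinv \<theta>) \<circ>\<^sub>m act \<theta>) F = act (Some |` dom \<theta>) F"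
    using act_comp[OF fa R_pinv[OF \<theta>] \<theta>] by simp
  also have "\<dots> = Some F"
  proof -
    obtain a x where "F \<in> paths" "a \<in> F" "\<theta> a = Some x" using act_SomeE[OF \<theta> G] .
    then show ?thesis unfolding act_identity[OF R_dom[OF \<theta>]] by blast
  qed
  finally show ?thesis using G by (simp add: map_comp_def)
qed

lemma act_pinv_iff:
  assumes fa: "finitely_aligned C" and \<theta>: "\<theta> \<in> \<R>"
  shows "act (pinv \<theta>) G = Some F \<longleftrightarrow> act \<theta> F = Some G"
proof
  have "pinv (pinv \<theta>) = \<theta>"
    using R_inj[OF \<theta>] R_inj[OF R_pinv[OF \<theta>]] by (intro map_eqI) (simp add: pinv_Some_iff)
  then show "act \<theta> F = Some G" if "act (pinv \<theta>) G = Some F"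
    using act_pinv_imp[OF fa R_pinv[OF \<theta>] that] by simp
qed (rule act_pinv_imp[OF assms])

lemma act_inj:
  assumes fa: "finitely_aligned C" and \<theta>: "\<theta> \<in> \<R>"
  shows "inj_on (act \<theta>) (dom (act \<theta>))"
proof (rule inj_mapI)
  fix F F' G assume "act \<theta> F = Some G" "act \<theta> F' = Some G"
  then have "act (pinv \<theta>) G = Some F" "act (pinv \<theta>) G = Some F'" using act_pinv_iff[OF assms] by auto
  then show "F = F'" by simp
qed

lemma act_pinv:
  assumes fa: "finitely_aligned C" and \<theta>: "\<theta> \<in> \<R>"
  shows "act (pinv \<theta>) = pinv (act \<theta>)"
  by (rule map_eqI) (simp add: act_pinv_iff[OF assms] pinv_Some_iff[OF act_inj[OF assms]])

end

section \<open>The Boolean inverse monoid of an aperiodic cofinal graph\<close>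

locale aperiodic_cofinal_graph = k_graph C deg
  for C :: "'a cat" and deg :: "'a \<Rightarrow> nat ^ 'k::finite" +
  assumes fa: "finitely_aligned C"
    and fin_Ids: "finite (Ids C)"
    and no_src: "no_sources C deg"
    and row_fin: "row_finite C deg"
    and aper: "aperiodic C"
    and cofin: "cofinal_category C"
begin

sublocale R: partial_bij_rep "R_monoid C" id "Arr C"
  by (rule R_monoid_rep[OF fa fin_Ids])

lemma path_meets:
  assumes F: "F \<in> paths" "a \<in> F" "b \<in> F" shows "\<not> independent C a b"
  using path_directed[OF F] unfolding independent_def by blast

lemma separating_extension:
  assumes "a \<in> Arr C" "b \<in> Arr C" "a \<noteq> b" "src C a = src C b"
  obtains u where "u \<in> Arr C" "src C a = tgt C u" "independent C (cmp C a u) (cmp C b u)"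
proof -
  have "\<exists>u\<in>Arr C. src C a = tgt C u \<and> independent C (cmp C a u) (cmp C b u)"
    using aper assms by (simp add: aperiodic_def)
  then show ?thesis using that by blast
qed

text \<open>
  If \<open>x \<noteq> y\<close> then some \<open>u\<close> makes \<open>x u\<close> and \<open>y u\<close> independent by aperiodicity.  But a path through
  \<open>a u\<close> is sent to a path through both of them.
\<close>

lemma values_eq:
  assumes \<theta>: "\<theta> \<in> \<R>" and \<eta>: "\<eta> \<in> \<R>" and x: "\<theta> a = Some x" and y: "\<eta> a = Some y"
    and eq: "\<And>F. F \<in> paths \<Longrightarrow> a \<in> F \<Longrightarrow> act \<theta> F = act \<eta> F"
  shows "x = y"
proof (rule ccontr)
  assume ne: "x \<noteq> y"
  have a: "a \<in> Arr C" using R_Arr1[OF \<theta> x] .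
  have s: "src C x = src C a" "src C y = src C a" using R_src[OF \<theta> x] R_src[OF \<eta> y] by simp_all
  obtain u where u: "u \<in> Arr C" "src C x = tgt C u" "independent C (cmp C x u) (cmp C y u)"
    using separating_extension[OF R_Arr2[OF \<theta> x] R_Arr2[OF \<eta> y] ne] s by auto
  have au: "src C a = tgt C u" using u s by simp
  have auA: "cmp C a u \<in> Arr C" using cmp_closed[OF a u(1) au] .
  obtain F where F: "F \<in> paths" "cmp C a u \<in> F" using path_through[OF no_src auA] by blast
  have aF: "a \<in> F" using path_prefix[OF F a principalI[OF u(1) au]] .
  obtain G where G: "G \<in> paths" "act \<theta> F = Some G" "cmp C x u \<in> G"
    using act_in[OF \<theta> F R_cmp[OF \<theta> x u(1) au]] by blast
  obtain H where H: "act \<eta> F = Some H" "cmp C y u \<in> H"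
    using act_in[OF \<eta> F R_cmp[OF \<eta> y u(1) au]] by blast
  have "G = H" using G(2) H(1) eq[OF F(1) aF] by simp
  then show False using path_meets[OF G(1,3)] H(2) u(3) by simp
qed

lemma restrict_in_R:
  assumes \<theta>: "\<theta> \<in> \<R>" and R: "fg_right_ideal C R"
  shows "\<theta> |` R \<in> \<R>"
proof -
  have "\<theta> \<circ>\<^sub>m (Some |` R) = \<theta> |` R"
    by (intro map_eqI) (auto simp: map_comp_Some_iff restrict_Some_iff)
  then show ?thesis using R_comp[OF fa \<theta> R_identity[OF R]] by simp
qed

subsection \<open>The Lenz congruence\<close>

text \<open>
  Below every nonzero element of the monoid lies its restriction to a principal right ideal, so
  it suffices to test the condition in the definition of the Lenz congruence on these restrictions.
\<close>

lemma lenz_half_iff: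
  assumes \<theta>: "\<theta> \<in> \<R>" and \<eta>: "\<eta> \<in> \<R>"
  shows "(\<forall>x\<in>\<R>. x \<noteq> Map.empty \<and> nat_le (R_monoid C) x \<theta> \<longrightarrow>
      (\<exists>w\<in>\<R>. w \<noteq> Map.empty \<and> nat_le (R_monoid C) w x \<and> nat_le (R_monoid C) w \<eta>)) \<longleftrightarrow>
    (\<forall>a\<in>dom \<theta>. \<exists>d\<in>principal C a. d \<in> dom \<theta> \<and> \<theta> d = \<eta> d)" (is "?L \<longleftrightarrow> ?R")
proof
  assume L: ?L
  show ?R
  proof
    fix a assume a: "a \<in> dom \<theta>"
    then have aA: "a \<in> Arr C" using R_Arr1[OF \<theta>] by blast
    let ?x = "\<theta> |` principal C a"
    have x: "?x \<in> \<R>" by (rule restrict_in_R[OF \<theta> fg_principal[OF aA]])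
    have "?x a \<noteq> None" using a principal_refl[OF aA] by auto
    then have "?x \<noteq> Map.empty" by auto
    moreover have "nat_le (R_monoid C) ?x \<theta>"
      unfolding R.nat_le_iff[OF x \<theta>] by (auto simp: map_le_def restrict_map_def dom_def split: if_splits)
    ultimately obtain w where w: "w \<in> \<R>" "w \<noteq> Map.empty" "nat_le (R_monoid C) w ?x" "nat_le (R_monoid C) w \<eta>"
      using L x by blast
    have le: "w \<subseteq>\<^sub>m ?x" "w \<subseteq>\<^sub>m \<eta>" using w R.nat_le_iff[OF w(1) x] R.nat_le_iff[OF w(1) \<eta>] by simp_all
    obtain d where d: "d \<in> dom w" using w(2) by (metis dom_eq_empty_conv ex_in_conv)
    have "w d = ?x d" "w d = \<eta> d" using le d by (simp_all add: map_le_def)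
    moreover obtain v where "w d = Some v" using d by blast
    ultimately have "?x d = Some v" "\<eta> d = Some v" by simp_all
    then have "d \<in> principal C a" "\<theta> d = \<eta> d" "d \<in> dom \<theta>"
      by (simp_all add: restrict_Some_iff domI)
    then show "\<exists>d\<in>principal C a. d \<in> dom \<theta> \<and> \<theta> d = \<eta> d" by blast
  qed
next
  assume R: ?R
  show ?L
  proof (intro ballI impI)
    fix x assume x: "x \<in> \<R>" and "x \<noteq> Map.empty \<and> nat_le (R_monoid C) x \<theta>"
    then have ne: "x \<noteq> Map.empty" and le: "x \<subseteq>\<^sub>m \<theta>" using R.nat_le_iff[OF x \<theta>] by simp_all
    obtain a where a: "a \<in> dom x" using ne by (metis dom_eq_empty_conv ex_in_conv)
    then have "a \<in> dom \<theta>" using map_le_implies_dom_le[OF le] by blast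
    then obtain d where d: "d \<in> principal C a" "d \<in> dom \<theta>" "\<theta> d = \<eta> d" using R by blast
    have dA: "d \<in> Arr C" using R_Arr1[OF \<theta>] d(2) by blast
    have sub: "principal C d \<subseteq> dom x"
      using fg_principal_subset[OF R_dom[OF x]] a d(1) by blast
    let ?w = "x |` principal C d"
    have w: "?w \<in> \<R>" by (rule restrict_in_R[OF x fg_principal[OF dA]])
    have dw: "dom ?w = principal C d" using sub by auto
    have "?w \<subseteq>\<^sub>m x" by (auto simp: map_le_def restrict_map_def dom_def split: if_splits)
    moreover have "?w \<subseteq>\<^sub>m \<eta>"
      unfolding map_le_def dw
    proof
      fix e assume e: "e \<in> principal C d"
      then obtain p where p: "p \<in> Arr C" "src C d = tgt C p" "e = cmp C d p" by (rule principalE)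
      obtain z where z: "\<theta> d = Some z" using d(2) by blast
      have "\<theta> e = \<eta> e" using R_cmp[OF \<theta> z p(1,2)] R_cmp[OF \<eta> _ p(1,2)] z d(3) p(3) by simp
      moreover have "x e = \<theta> e" using le sub e by (auto simp: map_le_def)
      ultimately show "?w e = \<eta> e" using e by simp
    qed
    moreover have "?w \<noteq> Map.empty"
    proof -
      have "d \<in> dom ?w" unfolding dw by (rule principal_refl[OF dA])
      then show ?thesis by (metis dom_empty empty_iff)
    qed
    ultimately show "\<exists>w\<in>\<R>. w \<noteq> Map.empty \<and> nat_le (R_monoid C) w x \<and> nat_le (R_monoid C) w \<eta>"
      using w by (intro bexI[of _ ?w]) (auto simp: R.nat_le_iff[OF w x] R.nat_le_iff[OF w \<eta>])
  qed
qed

text \<open>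
  Let \<open>M\<close> bound the degrees of generators of the domain of \<open>\<eta>\<close>, and let \<open>c\<close> be an initial segment of
  \<open>F\<close> of degree at least \<open>M\<close> in the domain of \<open>\<theta>\<close>.  Some extension of \<open>c\<close> lies in the domain of
  \<open>\<eta>\<close>; the generator that is a prefix of this extension is already a prefix of \<open>c\<close>, so \<open>\<eta>\<close> is defined
  at \<open>c\<close>.  If the values at \<open>c\<close> differed, aperiodicity would give an extension of \<open>c\<close> beyond
  which \<open>\<theta>\<close> and \<open>\<eta>\<close> agree nowhere.
\<close>

lemma dense_agreement_act:
  assumes \<theta>: "\<theta> \<in> \<R>" and \<eta>: "\<eta> \<in> \<R>"
    and dense: "\<And>a. a \<in> dom \<theta> \<Longrightarrow> \<exists>d\<in>principal C a. d \<in> dom \<theta> \<and> \<theta> d = \<eta> d"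
    and G: "act \<theta> F = Some G"
  shows "act \<eta> F = Some G"
proof -
  obtain a x0 where F: "F \<in> paths" and a: "a \<in> F" "\<theta> a = Some x0" using act_SomeE[OF \<theta> G] .
  obtain Y where Y: "finite Y" "Y \<subseteq> Arr C" "dom \<eta> = generated C Y" using R_dom[OF \<eta>] by (rule fgE)
  obtain M where M: "\<And>y. y \<in> Y \<Longrightarrow> \<exists>n. M = deg y + n" using degree_bound[OF Y(1)] by blast
  obtain p where p: "p \<in> Arr C" "src C a = tgt C p" "cmp C a p \<in> F" "deg p = M" using path_degreeE[OF F a(1)] .
  define c where "c = cmp C a p"
  have aA: "a \<in> Arr C" using path_Arr[OF F a(1)] .
  have cF: "c \<in> F" and cA: "c \<in> Arr C" using p path_Arr[OF F] by (auto simp: c_def)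
  obtain x where x: "\<theta> c = Some x" using R_cmp[OF \<theta> a(2) p(1,2)] by (simp add: c_def)
  have agree: "\<exists>d\<in>principal C c'. d \<in> dom \<eta> \<and> \<theta> d = \<eta> d" if c': "c' \<in> principal C c" for c'
  proof -
    have "c' \<in> dom \<theta>" using fg_principal_subset[OF R_dom[OF \<theta>] _ c'] x by blast
    then show ?thesis using dense by (metis domIff)
  qed
  have "c \<in> dom \<eta>"
  proof -
    obtain d where d: "d \<in> principal C c" "d \<in> dom \<eta>" using agree[OF principal_refl[OF cA]] by blast
    then obtain y where y: "y \<in> Y" "d \<in> principal C y" using Y(3) by (auto simp: generated_def)
    obtain n where n: "M = deg y + n" using M[OF y(1)] by blast
    have "deg c = deg y + (n + deg a)" using deg_cmp[OF aA p(1,2)] p(4) n by (simp add: c_def algebra_simps)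
    then have "c \<in> principal C y" using prefixes_comparable[of y d c] y Y(2) cA d(1) by blast
    then show ?thesis using y(1) Y(3) by (auto simp: generated_def)
  qed
  then obtain y where y: "\<eta> c = Some y" by blast
  have "x = y"
  proof (rule ccontr)
    assume ne: "x \<noteq> y"
    have s: "src C x = src C c" "src C y = src C c" using R_src[OF \<theta> x] R_src[OF \<eta> y] by simp_all
    have xA: "x \<in> Arr C" and yA: "y \<in> Arr C" using R_Arr2[OF \<theta> x] R_Arr2[OF \<eta> y] .
    obtain u where u: "u \<in> Arr C" "src C x = tgt C u" "independent C (cmp C x u) (cmp C y u)"
      using separating_extension[OF xA yA ne] s by auto
    have cu: "src C c = tgt C u" using u s by simp
    obtain d where d: "d \<in> principal C (cmp C c u)" "\<theta> d = \<eta> d" using agree[OF principalI[OF u(1) cu]] by blast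
    from d(1) obtain q where q: "q \<in> Arr C" "src C (cmp C c u) = tgt C q" "d = cmp C (cmp C c u) q" by (rule principalE)
    have uq: "src C u = tgt C q" using q cA u cu by (simp add: src_cmp)
    have "\<theta> d = Some (cmp C (cmp C x u) q)" "\<eta> d = Some (cmp C (cmp C y u) q)"
      using R_cmp[OF \<theta> R_cmp[OF \<theta> x u(1) cu] q(1,2)] R_cmp[OF \<eta> R_cmp[OF \<eta> y u(1) cu] q(1,2)] q(3) by simp_all
    then have eq: "cmp C (cmp C x u) q = cmp C (cmp C y u) q" using d(2) by simp
    have "cmp C (cmp C x u) q \<in> principal C (cmp C x u)" "cmp C (cmp C y u) q \<in> principal C (cmp C y u)"
      using q(1) uq u s xA yA by (auto intro!: principalI simp: src_cmp)
    then show False using u(3) eq by (auto simp: independent_def)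
  qed
  then show ?thesis using act_eq[OF \<theta> F cF x] act_eq[OF \<eta> F cF y] G by simp
qed

lemma lenz_iff:
  "(\<theta>, \<eta>) \<in> lenz (R_monoid C) Map.empty \<longleftrightarrow> \<theta> \<in> \<R> \<and> \<eta> \<in> \<R> \<and> act \<theta> = act \<eta>"
proof -
  let ?half = "\<lambda>\<theta> \<eta>. \<forall>a\<in>dom \<theta>. \<exists>d\<in>principal C a. d \<in> dom \<theta> \<and> \<theta> d = \<eta> d"
  have "(\<theta>, \<eta>) \<in> lenz (R_monoid C) Map.empty \<longleftrightarrow> \<theta> \<in> \<R> \<and> \<eta> \<in> \<R> \<and> ?half \<theta> \<eta> \<and> ?half \<eta> \<theta>"
    unfolding lenz_def mem_Collect_eq prod.case
    using lenz_half_iff[of \<theta> \<eta>] lenz_half_iff[of \<eta> \<theta>] by (intro iffI) simp_all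
  moreover have "act \<theta> = act \<eta> \<longleftrightarrow> ?half \<theta> \<eta> \<and> ?half \<eta> \<theta>" if \<theta>: "\<theta> \<in> \<R>" and \<eta>: "\<eta> \<in> \<R>"
  proof
    assume half: "?half \<theta> \<eta> \<and> ?half \<eta> \<theta>"
    show "act \<theta> = act \<eta>"
    proof (rule map_eqI, rule iffI)
      fix F G
      show "act \<eta> F = Some G" if "act \<theta> F = Some G"
        by (rule dense_agreement_act[OF \<theta> \<eta> _ that]) (use half in simp)
      show "act \<theta> F = Some G" if "act \<eta> F = Some G"
        by (rule dense_agreement_act[OF \<eta> \<theta> _ that]) (use half in simp)
    qed
  next
    assume eq: "act \<theta> = act \<eta>"
    have "?half \<theta> \<eta>" if \<theta>: "\<theta> \<in> \<R>" and \<eta>: "\<eta> \<in> \<R>" and eq: "act \<theta> = act \<eta>" for \<theta> \<eta>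
    proof
      fix a assume "a \<in> dom \<theta>"
      then obtain x where x: "\<theta> a = Some x" by blast
      have aA: "a \<in> Arr C" using R_Arr1[OF \<theta> x] .
      obtain F where F: "F \<in> paths" "a \<in> F" using path_through[OF no_src aA] by blast
      have "F \<in> dom (act \<theta>)" using F x unfolding dom_act by blast
      then have "F \<in> dom (act \<eta>)" using eq by simp
      then obtain b where b: "b \<in> F" "b \<in> dom \<eta>" unfolding dom_act by blast
      obtain c where c: "c \<in> F" "c \<in> principal C a" "c \<in> principal C b" using path_directed[OF F b(1)] by blast
      obtain x' where x': "\<theta> c = Some x'" using fg_principal_subset[OF R_dom[OF \<theta>] _ c(2)] x by blast
      obtain y' where y': "\<eta> c = Some y'" using fg_principal_subset[OF R_dom[OF \<eta>] b(2) c(3)] by blast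
      have "x' = y'" by (rule values_eq[OF \<theta> \<eta> x' y']) (simp add: eq)
      then show "\<exists>d\<in>principal C a. d \<in> dom \<theta> \<and> \<theta> d = \<eta> d" using c(2) x' y' by auto
    qed
    from this[OF \<theta> \<eta> eq] this[OF \<eta> \<theta> eq[symmetric]] show "?half \<theta> \<eta> \<and> ?half \<eta> \<theta>" ..
  qed
  ultimately show ?thesis by blast
qed

definition cls :: "('a \<rightharpoonup> 'a) \<Rightarrow> ('a \<rightharpoonup> 'a) set" where
  "cls \<theta> = {\<eta> \<in> \<R>. act \<eta> = act \<theta>}"

text \<open>
  All members of a class act in the same way, so that the choice does not matter.
\<close>

definition Act :: "('a \<rightharpoonup> 'a) set \<Rightarrow> 'a set \<rightharpoonup> 'a set" where
  "Act K = act (SOME \<theta>. \<theta> \<in> K)"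

lemma lenz_class: "\<theta> \<in> \<R> \<Longrightarrow> lenz (R_monoid C) Map.empty `` {\<theta>} = cls \<theta>"
  by (auto simp: cls_def lenz_iff)

lemma B_carrier: "carrier (B_monoid C) = cls ` \<R>"
  by (auto simp: B_monoid_def quotient_monoid_def quotient_def lenz_class)

lemma Act_cls: "\<theta> \<in> \<R> \<Longrightarrow> Act (cls \<theta>) = act \<theta>"
proof -
  assume \<theta>: "\<theta> \<in> \<R>"
  have "(SOME \<eta>. \<eta> \<in> cls \<theta>) \<in> cls \<theta>" by (rule someI[of _ \<theta>]) (simp add: cls_def \<theta>)
  then show ?thesis by (simp add: Act_def cls_def)
qed

lemma B_one: "\<one>\<^bsub>B_monoid C\<^esub> = cls (Some |` Arr C)"
  using lenz_class[OF R_identity[OF fg_whole[OF fin_Ids]]]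
  by (simp add: B_monoid_def quotient_monoid_def R_monoid_def)

lemma B_mult:
  assumes \<theta>: "\<theta> \<in> \<R>" and \<eta>: "\<eta> \<in> \<R>"
  shows "cls \<theta> \<otimes>\<^bsub>B_monoid C\<^esub> cls \<eta> = cls (\<theta> \<circ>\<^sub>m \<eta>)"
proof -
  have m: "mult (R_monoid C) = (\<circ>\<^sub>m)" by (simp add: R_monoid_def)
  have "lenz (R_monoid C) Map.empty `` {x \<circ>\<^sub>m y | x y. x \<in> cls \<theta> \<and> y \<in> cls \<eta>} = cls (\<theta> \<circ>\<^sub>m \<eta>)"
  proof (intro equalityI subsetI)
    fix z assume "z \<in> lenz (R_monoid C) Map.empty `` {x \<circ>\<^sub>m y | x y. x \<in> cls \<theta> \<and> y \<in> cls \<eta>}"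
    then obtain x y where xy: "x \<in> cls \<theta>" "y \<in> cls \<eta>" "(x \<circ>\<^sub>m y, z) \<in> lenz (R_monoid C) Map.empty" by blast
    then have "z \<in> \<R>" "act z = act (x \<circ>\<^sub>m y)" by (simp_all add: lenz_iff)
    moreover have "act (x \<circ>\<^sub>m y) = act (\<theta> \<circ>\<^sub>m \<eta>)"
      using xy(1,2) act_comp[OF fa] \<theta> \<eta> by (simp add: cls_def)
    ultimately show "z \<in> cls (\<theta> \<circ>\<^sub>m \<eta>)" by (simp add: cls_def)
  next
    fix z assume "z \<in> cls (\<theta> \<circ>\<^sub>m \<eta>)"
    then have "(\<theta> \<circ>\<^sub>m \<eta>, z) \<in> lenz (R_monoid C) Map.empty"
      using R_comp[OF fa \<theta> \<eta>] by (simp add: lenz_iff cls_def)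
    moreover have "\<theta> \<in> cls \<theta>" "\<eta> \<in> cls \<eta>" using \<theta> \<eta> by (simp_all add: cls_def)
    ultimately show "z \<in> lenz (R_monoid C) Map.empty `` {x \<circ>\<^sub>m y | x y. x \<in> cls \<theta> \<and> y \<in> cls \<eta>}" by blast
  qed
  then show ?thesis by (simp add: B_monoid_def quotient_monoid_def m)
qed

lemma B_bex: "(\<exists>K\<in>carrier (B_monoid C). P (Act K)) \<longleftrightarrow> (\<exists>\<theta>\<in>\<R>. P (act \<theta>))"
  by (simp add: B_carrier Act_cls)

lemma B_rep: "partial_bij_rep (B_monoid C) Act paths"
proof
  fix K L assume "K \<in> carrier (B_monoid C)" "L \<in> carrier (B_monoid C)"
  then obtain \<theta> \<eta> where K: "\<theta> \<in> \<R>" "K = cls \<theta>" and L: "\<eta> \<in> \<R>" "L = cls \<eta>" by (auto simp: B_carrier)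
  show "K \<otimes>\<^bsub>B_monoid C\<^esub> L \<in> carrier (B_monoid C)"
    using K L R_comp[OF fa] by (simp add: B_mult B_carrier)
  show "Act (K \<otimes>\<^bsub>B_monoid C\<^esub> L) = Act K \<circ>\<^sub>m Act L"
    using K L R_comp[OF fa] act_comp[OF fa] by (simp add: B_mult Act_cls)
next
  have one: "Some |` Arr C \<in> \<R>" by (rule R_identity[OF fg_whole[OF fin_Ids]])
  show "\<one>\<^bsub>B_monoid C\<^esub> \<in> carrier (B_monoid C)" using one by (simp add: B_one B_carrier)
  have "F \<inter> Arr C \<noteq> {}" if "F \<in> paths" for F
    using path_degree[OF that] path_Arr[OF that] by blast
  then show "Act \<one>\<^bsub>B_monoid C\<^esub> = Some |` paths"
    unfolding B_one Act_cls[OF one]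
    by (intro map_eqI) (auto simp: act_identity[OF fg_whole[OF fin_Ids]] restrict_Some_iff)
next
  show "inj_on Act (carrier (B_monoid C))"
  proof (rule inj_onI)
    fix K L assume "K \<in> carrier (B_monoid C)" "L \<in> carrier (B_monoid C)" and eq: "Act K = Act L"
    then obtain \<theta> \<eta> where K: "\<theta> \<in> \<R>" "K = cls \<theta>" and L: "\<eta> \<in> \<R>" "L = cls \<eta>" by (auto simp: B_carrier)
    then have "act \<theta> = act \<eta>" using eq by (simp add: Act_cls)
    then show "K = L" using K L by (simp add: cls_def)
  qed
next
  fix K assume "K \<in> carrier (B_monoid C)"
  then obtain \<theta> where K: "\<theta> \<in> \<R>" "K = cls \<theta>" by (auto simp: B_carrier)
  show "dom (Act K) \<subseteq> paths" using K by (simp add: Act_cls dom_act)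
  show "inj_on (Act K) (dom (Act K))" using K act_inj[OF fa] by (simp add: Act_cls)
  show "\<exists>L\<in>carrier (B_monoid C). Act L = pinv (Act K)"
    using K R_pinv[OF K(1)] act_pinv[OF fa K(1)]
    by (intro bexI[of _ "cls (pinv \<theta>)"]) (simp_all add: Act_cls B_carrier)
qed

definition ideal_paths :: "'a set \<Rightarrow> 'a set set" where
  "ideal_paths R = {F \<in> paths. F \<inter> R \<noteq> {}}"

text \<open>
  Whether a path meets \<open>R\<close> is decided by its initial segment of degree \<open>M\<close>, where \<open>M\<close> bounds the degrees
  of the generators; the finitely many arrows of degree \<open>M\<close> outside \<open>R\<close> therefore generate a complement.
\<close>

lemma ideal_paths_Compl:
  assumes R: "fg_right_ideal C R"
  shows "\<exists>R'. fg_right_ideal C R' \<and> ideal_paths R' = paths - ideal_paths R"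
proof -
  obtain Y where Y: "finite Y" "Y \<subseteq> Arr C" "R = generated C Y" using R by (rule fgE)
  obtain M where M: "\<And>y. y \<in> Y \<Longrightarrow> \<exists>n. M = deg y + n" using degree_bound[OF Y(1)] by blast
  \<comment> \<open>row finiteness leaves finitely many such arrows for each of the finitely many codomains\<close>
  define Z where "Z = {c \<in> Arr C. deg c = M \<and> c \<notin> R}"
  have "Z \<subseteq> (\<Union>e\<in>Ids C. {c \<in> principal C e. deg c = M})"
    using tgt_Ids by (auto simp: Z_def principal_id_iff)
  moreover have "finite (\<Union>e\<in>Ids C. {c \<in> principal C e. deg c = M})"
    using fin_Ids row_fin by (auto simp: row_finite_def)
  ultimately have Z: "finite Z" by (rule finite_subset)
  have ZA: "Z \<subseteq> Arr C" by (auto simp: Z_def)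
  have "ideal_paths (generated C Z) = paths - ideal_paths R"
  proof (intro equalityI subsetI)
    fix F assume "F \<in> ideal_paths (generated C Z)"
    then obtain z c where F: "F \<in> paths" "c \<in> F" "z \<in> Z" "c \<in> principal C z"
      by (auto simp: ideal_paths_def generated_def)
    have zF: "z \<in> F" using path_prefix[OF F(1,2) _ F(4)] F(3) ZA by blast
    have "F \<inter> R = {}"
    proof (rule ccontr)
      assume "F \<inter> R \<noteq> {}"
      then obtain r y where r: "r \<in> F" "y \<in> Y" "r \<in> principal C y" unfolding Y generated_def by blast
      have yF: "y \<in> F" using path_prefix[OF F(1) r(1) _ r(3)] r(2) Y(2) by blast
      obtain n where "M = deg y + n" using M[OF r(2)] by blast
      then have "z \<in> principal C y" using path_extension[OF F(1) yF zF] F(3) by (simp add: Z_def)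
      then have "z \<in> R" using r(2) Y(3) by (auto simp: generated_def)
      then show False using F(3) by (simp add: Z_def)
    qed
    then show "F \<in> paths - ideal_paths R" using F(1) by (simp add: ideal_paths_def)
  next
    fix F assume "F \<in> paths - ideal_paths R"
    then have F: "F \<in> paths" "F \<inter> R = {}" by (auto simp: ideal_paths_def)
    obtain c where c: "c \<in> F" "deg c = M" using path_degree[OF F(1)] by blast
    have cA: "c \<in> Arr C" using path_Arr[OF F(1) c(1)] .
    then have "c \<in> Z" using c F(2) by (auto simp: Z_def)
    then have "c \<in> generated C Z" using principal_refl[OF cA] by (auto simp: generated_def)
    then show "F \<in> ideal_paths (generated C Z)" using F(1) c(1) by (auto simp: ideal_paths_def)
  qed
  then show ?thesis using fg_generated[OF Z ZA] by blast
qed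

text \<open>
  If two actions and their inverses are compatible, then \<open>values_eq\<close>, applied to the morphisms and to
  their inverses, shows that the morphisms themselves are compatible, so their union represents the join.
\<close>

lemma B_boolean_rep: "boolean_rep (B_monoid C) Act paths"
proof -
  interpret partial_bij_rep "B_monoid C" Act paths by (rule B_rep)
  show ?thesis
  proof
    fix K L assume KL: "K \<in> carrier (B_monoid C)" "L \<in> carrier (B_monoid C)"
      and agree: "\<And>F G H. Act K F = Some G \<Longrightarrow> Act L F = Some H \<Longrightarrow> G = H"
      and agree': "\<And>F G H. Act K F = Some H \<Longrightarrow> Act L G = Some H \<Longrightarrow> F = G"
    then obtain \<theta> \<eta> where K: "\<theta> \<in> \<R>" "K = cls \<theta>" and L: "\<eta> \<in> \<R>" "L = cls \<eta>" by (auto simp: B_carrier)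
    note ag = agree[unfolded K(2) L(2) Act_cls[OF K(1)] Act_cls[OF L(1)]]
      and ag' = agree'[unfolded K(2) L(2) Act_cls[OF K(1)] Act_cls[OF L(1)]]
    have common: "x = y"
      if \<theta>: "\<theta> \<in> \<R>" and \<eta>: "\<eta> \<in> \<R>" and xy: "\<theta> a = Some x" "\<eta> a = Some y"
        and ag: "\<And>F G H. act \<theta> F = Some G \<Longrightarrow> act \<eta> F = Some H \<Longrightarrow> G = H" for \<theta> \<eta> a x y
    proof (rule values_eq[OF \<theta> \<eta> xy])
      fix F assume F: "F \<in> paths" "a \<in> F"
      obtain G where G: "act \<theta> F = Some G" using act_in[OF \<theta> F xy(1)] by blast
      obtain H where H: "act \<eta> F = Some H" using act_in[OF \<eta> F xy(2)] by blast
      show "act \<theta> F = act \<eta> F" using ag[OF G H] G H by simp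
    qed
    have val: "x = y" if "\<theta> a = Some x" "\<eta> a = Some y" for a x y
      by (rule common[OF K(1) L(1) that ag])
    have inj: "a = b" if "\<theta> a = Some x" "\<eta> b = Some x" for a b x
    proof (rule common[OF R_pinv[OF K(1)] R_pinv[OF L(1)]])
      show "pinv \<theta> x = Some a" "pinv \<eta> x = Some b"
        using that by (simp_all add: pinv_Some_iff[OF R_inj[OF K(1)]] pinv_Some_iff[OF R_inj[OF L(1)]])
      fix F G H assume "act (pinv \<theta>) F = Some G" "act (pinv \<eta>) F = Some H"
      then show "G = H" using act_pinv_iff[OF fa K(1)] act_pinv_iff[OF fa L(1)] ag' by simp
    qed
    define \<zeta> where "\<zeta> = \<theta> ++ \<eta>"
    have \<zeta>_iff: "\<zeta> a = Some x \<longleftrightarrow> \<theta> a = Some x \<or> \<eta> a = Some x" for a x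
    proof (cases "\<eta> a")
      case None
      then show ?thesis by (simp add: \<zeta>_def map_add_def)
    next
      case (Some y)
      then show ?thesis using val[of a x y] by (auto simp: \<zeta>_def map_add_def)
    qed
    have \<zeta>: "\<zeta> \<in> \<R>"
    proof (rule R_carrierI)
      have "dom \<zeta> = dom \<theta> \<union> dom \<eta>" by (auto simp: \<zeta>_def)
      then show "fg_right_ideal C (dom \<zeta>)" using fg_Un[OF R_dom[OF K(1)] R_dom[OF L(1)]] by simp
      have "ran \<zeta> = ran \<theta> \<union> ran \<eta>" by (auto simp: ran_def \<zeta>_iff)
      then show "fg_right_ideal C (ran \<zeta>)" using fg_Un[OF R_ran[OF K(1)] R_ran[OF L(1)]] by simp
    next
      fix a b x assume "\<zeta> a = Some x" "\<zeta> b = Some x"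
      then show "a = b" unfolding \<zeta>_iff
        using inj[of a x b] inj[of b x a] inj_mapD[OF R_inj[OF K(1)], of a x b] inj_mapD[OF R_inj[OF L(1)], of a x b]
        by auto
    next
      fix a x c assume "\<zeta> a = Some x"
      then show "src C x = src C a" unfolding \<zeta>_iff using R_src[OF K(1)] R_src[OF L(1)] by auto
    next
      fix a x c assume "\<zeta> a = Some x" "c \<in> Arr C" "src C a = tgt C c"
      then show "\<zeta> (cmp C a c) = Some (cmp C x c)"
        unfolding \<zeta>_iff using R_cmp[OF K(1)] R_cmp[OF L(1)] by auto
    qed
    have "act \<zeta> = act \<theta> ++ act \<eta>"
    proof
      fix F
      show "act \<zeta> F = (act \<theta> ++ act \<eta>) F"
      proof (cases "F \<in> paths \<and> F \<inter> dom \<eta> \<noteq> {}")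
        case True
        then obtain a x where F: "F \<in> paths" "a \<in> F" and x: "\<eta> a = Some x" by blast
        have "act \<zeta> F = act \<eta> F" using act_eq[OF \<zeta> F] act_eq[OF L(1) F x] x by (simp add: \<zeta>_iff)
        then show ?thesis using act_eq[OF L(1) F x] by (simp add: map_add_def)
      next
        case no: False
        then have n: "act \<eta> F = None" by (intro act_NoneI) blast
        show ?thesis
        proof (cases "F \<in> paths \<and> F \<inter> dom \<theta> \<noteq> {}")
          case True
          then obtain a x where F: "F \<in> paths" "a \<in> F" and x: "\<theta> a = Some x" by blast
          have "act \<zeta> F = act \<theta> F" using act_eq[OF \<zeta> F] act_eq[OF K(1) F x] x by (simp add: \<zeta>_iff)
          then show ?thesis using n by (simp add: map_add_def)
        next
          case False
          then have "act \<theta> F = None" "act \<zeta> F = None"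
            using no by (auto intro!: act_NoneI simp: \<zeta>_def)
          then show ?thesis using n by (simp add: map_add_def)
        qed
      qed
    qed
    then have "\<exists>\<zeta>\<in>\<R>. act \<zeta> = Act K ++ Act L" using \<zeta> K L by (auto simp: Act_cls)
    then show "\<exists>c\<in>carrier (B_monoid C). Act c = Act K ++ Act L"
      using B_bex[of "\<lambda>f. f = Act K ++ Act L"] by simp
  next
    fix K assume "K \<in> carrier (B_monoid C)"
    then obtain \<theta> where K: "\<theta> \<in> \<R>" "K = cls \<theta>" by (auto simp: B_carrier)
    obtain R' where R': "fg_right_ideal C R'" "ideal_paths R' = paths - ideal_paths (dom \<theta>)"
      using ideal_paths_Compl[OF R_dom[OF K(1)]] by blast
    have "F \<in> paths \<and> F \<inter> R' \<noteq> {} \<longleftrightarrow> F \<in> paths - dom (act \<theta>)" for F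
      using R'(2) unfolding dom_act ideal_paths_def by blast
    then have "act (Some |` R') = Some |` (paths - dom (Act K))"
      using K by (intro map_eqI) (auto simp: act_identity[OF R'(1)] restrict_Some_iff Act_cls)
    then show "\<exists>c\<in>carrier (B_monoid C). Act c = Some |` (paths - dom (Act K))"
      using B_bex[of "\<lambda>f. f = Some |` (paths - dom (Act K))"] R_identity[OF R'(1)] by blast
  qed
qed

text \<open>
  A bijective morphism is determined by its values on a finite set of generators.
\<close>

lemma R_countable: "countable \<R>"
proof -
  have "\<forall>\<theta>\<in>\<R>. \<exists>Y. finite Y \<and> Y \<subseteq> Arr C \<and> dom \<theta> = generated C Y"
    using R_dom by (simp add: fg_right_ideal_def)
  from bchoice[OF this] obtain gens where
    "\<forall>\<theta>\<in>\<R>. finite (gens \<theta>) \<and> gens \<theta> \<subseteq> Arr C \<and> dom \<theta> = generated C (gens \<theta>)" by (elim exE)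
  note gens = bspec[OF this]
  define \<Gamma> where "\<Gamma> \<theta> = (\<lambda>y. (y, the (\<theta> y))) ` gens \<theta>" for \<theta> :: "'a \<rightharpoonup> 'a"
  have \<Gamma>_iff: "(y, z) \<in> \<Gamma> \<theta> \<longleftrightarrow> y \<in> gens \<theta> \<and> \<theta> y = Some z" if \<theta>: "\<theta> \<in> \<R>" for \<theta> y z
  proof -
    have "gens \<theta> \<subseteq> dom \<theta>" using gens[OF \<theta>] principal_refl by (auto 0 3 simp only: generated_def)
    then show ?thesis by (auto simp: \<Gamma>_def image_iff)
  qed
  have sub: "\<eta> a = Some x"
    if \<theta>: "\<theta> \<in> \<R>" and \<eta>: "\<eta> \<in> \<R>" and eq: "\<Gamma> \<theta> = \<Gamma> \<eta>" and x: "\<theta> a = Some x" for \<theta> \<eta> a x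
  proof -
    have "a \<in> generated C (gens \<theta>)" using gens[OF \<theta>] x by blast
    then obtain y where y: "y \<in> gens \<theta>" "a \<in> principal C y" by (auto simp: generated_def)
    from y(2) obtain c where c: "c \<in> Arr C" "src C y = tgt C c" "a = cmp C y c" by (rule principalE)
    have in_\<Gamma>: "(y, the (\<theta> y)) \<in> \<Gamma> \<theta>" using y(1) by (simp add: \<Gamma>_def)
    have "\<theta> y = Some (the (\<theta> y))" using in_\<Gamma> unfolding \<Gamma>_iff[OF \<theta>] ..
    moreover have "\<eta> y = Some (the (\<theta> y))" using in_\<Gamma> unfolding eq \<Gamma>_iff[OF \<eta>] ..
    ultimately show ?thesis using R_cmp[OF \<theta> _ c(1,2)] R_cmp[OF \<eta> _ c(1,2)] x c(3) by simp
  qed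
  have "inj_on \<Gamma> \<R>"
  proof (rule inj_onI)
    fix \<theta> \<eta> assume eq: "\<theta> \<in> \<R>" "\<eta> \<in> \<R>" "\<Gamma> \<theta> = \<Gamma> \<eta>"
    show "\<theta> = \<eta>"
      by (rule map_eqI, rule iffI, erule sub[OF eq], erule sub[OF eq(2,1) eq(3)[symmetric]])
  qed
  moreover have "\<Gamma> ` \<R> \<subseteq> {G. finite G \<and> G \<subseteq> Arr C \<times> Arr C}"
  proof clarify
    fix \<theta> assume \<theta>: "\<theta> \<in> \<R>"
    have "finite (\<Gamma> \<theta>)" using gens[OF \<theta>] by (simp add: \<Gamma>_def)
    moreover have "\<Gamma> \<theta> \<subseteq> Arr C \<times> Arr C"
      using R_Arr1[OF \<theta>] R_Arr2[OF \<theta>] by (auto simp: \<Gamma>_iff[OF \<theta>])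
    ultimately show "finite (\<Gamma> \<theta>) \<and> \<Gamma> \<theta> \<subseteq> Arr C \<times> Arr C" ..
  qed
  moreover have "countable {G. finite G \<and> G \<subseteq> Arr C \<times> Arr C}"
    using countable_Arr by (intro countable_Collect_finite_subset) simp
  ultimately show ?thesis using countable_image_inj_on[OF countable_subset] by blast
qed

lemma B_ample_rep: "ample_rep (B_monoid C) Act paths"
proof -
  interpret boolean_rep "B_monoid C" Act paths by (rule B_boolean_rep)
  have domains_iff: "A \<in> domains \<longleftrightarrow> (\<exists>R. fg_right_ideal C R \<and> A = ideal_paths R)" for A
  proof
    assume "A \<in> domains"
    then obtain K where "K \<in> carrier (B_monoid C)" "A = dom (Act K)" by (auto simp only: domains_def mem_Collect_eq)
    then obtain \<theta> where "\<theta> \<in> \<R>" "A = dom (act \<theta>)" by (auto simp: B_carrier Act_cls)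
    then show "\<exists>R. fg_right_ideal C R \<and> A = ideal_paths R"
      using R_dom by (auto simp: dom_act ideal_paths_def)
  next
    assume "\<exists>R. fg_right_ideal C R \<and> A = ideal_paths R"
    then obtain R where R: "fg_right_ideal C R" "A = ideal_paths R" by blast
    have "dom (Some |` R) = R" by (auto simp: restrict_map_def dom_def)
    then have "A = dom (Act (cls (Some |` R)))"
      using R R_identity by (simp add: Act_cls dom_act ideal_paths_def)
    moreover have "cls (Some |` R) \<in> carrier (B_monoid C)" using R_identity[OF R(1)] by (simp add: B_carrier)
    ultimately show "A \<in> domains" by (rule domainsI[rotated])
  qed
  have through_domain: "through a \<in> domains" if a: "a \<in> Arr C" for a
  proof -
    have "F \<inter> principal C a \<noteq> {} \<longleftrightarrow> a \<in> F" if F: "F \<in> paths" for F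
      using path_prefix[OF F _ a] principal_refl[OF a] by blast
    then have "through a = ideal_paths (principal C a)" by (auto simp: through_def ideal_paths_def)
    then show ?thesis using fg_principal[OF a] domains_iff by blast
  qed
  have through_in: "\<exists>a\<in>F. through a \<subseteq> A" if A: "A \<in> domains" and F: "F \<in> A" for A F
  proof -
    obtain R where R: "fg_right_ideal C R" "A = ideal_paths R" using A domains_iff by blast
    then obtain a where "a \<in> F" "a \<in> R" using F by (auto simp: ideal_paths_def)
    then show ?thesis using R by (auto simp: ideal_paths_def through_def)
  qed
  show ?thesis
  proof
    show "countable (carrier (B_monoid C))" using R_countable by (simp add: B_carrier)
  next
    fix F G assume F: "F \<in> paths" and G: "G \<in> paths" and ne: "F \<noteq> G"
    then obtain a where a: "a \<in> F" "a \<notin> G" using path_subset_eq by blast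
    then show "\<exists>A\<in>domains. F \<in> A \<and> G \<notin> A"
      using F through_domain[OF path_Arr[OF F a(1)]] by (intro bexI[of _ "through a"]) (auto simp: through_def)
  next
    fix \<V> assume V: "\<V> \<subseteq> domains" "paths \<subseteq> \<Union>\<V>"
    show "\<exists>\<W>\<subseteq>\<V>. finite \<W> \<and> paths \<subseteq> \<Union>\<W>"
    proof (rule paths_compact[OF fin_Ids row_fin _ V(2)])
      fix V F assume "V \<in> \<V>" "F \<in> V"
      then show "\<exists>a\<in>F. through a \<subseteq> V" using through_in[of V F] V(1) by blast
    qed
  next
    fix F A assume F: "F \<in> paths" and A: "A \<in> domains" "A \<noteq> {}"
    then obtain F' where F': "F' \<in> A" by blast
    obtain a where a: "a \<in> F'" "through a \<subseteq> A" using through_in[OF A(1) F'] by blast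
    have "F' \<in> paths" using F' domains_subset[OF A(1)] by blast
    then have aA: "a \<in> Arr C" using path_Arr a(1) by blast
    obtain c0 where c0: "c0 \<in> F" using path_degree[OF F] by blast
    define e where "e = tgt C c0"
    have c0A: "c0 \<in> Arr C" using path_Arr[OF F c0] .
    have e: "e \<in> Ids C" "e \<in> F"
      using tgt_Ids[OF c0A] path_prefix[OF F c0, of e] c0A by (simp_all add: e_def id_Arr principal_id_iff)
    \<comment> \<open>cofinality connects some initial segment \<open>y\<close> of \<open>F\<close> with \<open>a\<close>: since \<open>Y\<close> is large, a segment
      of \<open>F\<close> whose degree bounds those of \<open>Y\<close> depends on, hence extends, an element of \<open>Y\<close>\<close>
    obtain Y where Y: "finite Y" "large_in C Y e"
      and conn: "\<forall>y\<in>Y. \<exists>b\<in>Arr C. tgt C b = src C a \<and> src C b = src C y"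
      using cofin src_Ids[OF aA] e(1) unfolding cofinal_category_def by meson
    have YA: "Y \<subseteq> Arr C" using Y(2) principal_Arr[OF id_Arr[OF e(1)]] by (auto simp: large_in_def)
    obtain M where M: "\<And>y. y \<in> Y \<Longrightarrow> \<exists>n. M = deg y + n" using degree_bound[OF Y(1)] by blast
    obtain c where c: "c \<in> F" "deg c = M" using path_degree[OF F] by blast
    have cA: "c \<in> Arr C" using path_Arr[OF F c(1)] .
    have "c \<in> principal C e" using path_extension[OF F e(2) c(1), of M] c(2) deg_id[OF e(1)] by simp
    then obtain y where y: "y \<in> Y" "\<not> independent C c y" using Y(2) by (auto simp: large_in_def)
    then obtain d where d: "d \<in> principal C c" "d \<in> principal C y" by (auto simp: independent_def)
    have yA: "y \<in> Arr C" using y(1) YA by blast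
    obtain n where "M = deg y + n" using M[OF y(1)] by blast
    then have "c \<in> principal C y" using prefixes_comparable[OF yA d(2) cA d(1)] c(2) by simp
    then have yF: "y \<in> F" using path_prefix[OF F c(1) yA] by blast
    obtain b where b: "b \<in> Arr C" "tgt C b = src C a" "src C b = src C y" using conn y(1) by blast
    define z where "z = cmp C a b"
    have z: "z \<in> Arr C" "src C z = src C y" "z \<in> principal C a"
      using b aA by (simp_all add: z_def cmp_closed src_cmp principalI)
    \<comment> \<open>the isomorphism \<open>y c \<mapsto> z c\<close> of principal right ideals\<close>
    define \<theta> where "\<theta> x = (if x \<in> principal C y then Some (cmp C z (THE c. c \<in> Arr C \<and> src C y = tgt C c \<and> x = cmp C y c)) else None)" for x
    have \<theta>_iff: "\<theta> x = Some w \<longleftrightarrow> (\<exists>c\<in>Arr C. src C y = tgt C c \<and> x = cmp C y c \<and> w = cmp C z c)" for x w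
    proof -
      have the: "(THE c'. c' \<in> Arr C \<and> src C y = tgt C c' \<and> cmp C y c = cmp C y c') = c"
        if c: "c \<in> Arr C" "src C y = tgt C c" for c
      proof (rule the_equality)
        fix c' assume c': "c' \<in> Arr C \<and> src C y = tgt C c' \<and> cmp C y c = cmp C y c'"
        then have "c = c'" using cmp_eq_cmpD(2)[OF yA c yA, of c'] by simp
        then show "c' = c" ..
      qed (simp add: c)
      show ?thesis
      proof
        assume w: "\<theta> x = Some w"
        then have "x \<in> principal C y" by (auto simp: \<theta>_def split: if_splits)
        then obtain c where c: "c \<in> Arr C" "src C y = tgt C c" "x = cmp C y c" by (rule principalE)
        then have "w = cmp C z c" using w the[OF c(1,2)] principalI[OF c(1,2)] by (simp add: \<theta>_def)
        then show "\<exists>c\<in>Arr C. src C y = tgt C c \<and> x = cmp C y c \<and> w = cmp C z c" using c by blast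
      next
        assume "\<exists>c\<in>Arr C. src C y = tgt C c \<and> x = cmp C y c \<and> w = cmp C z c"
        then obtain c where c: "c \<in> Arr C" "src C y = tgt C c" "x = cmp C y c" "w = cmp C z c" by blast
        then show "\<theta> x = Some w" using the[OF c(1,2)] principalI[OF c(1,2)] by (simp add: \<theta>_def)
      qed
    qed
    have \<theta>: "\<theta> \<in> \<R>"
    proof (rule R_carrierI)
      have "dom \<theta> = principal C y" by (auto simp: \<theta>_def dom_def)
      then show "fg_right_ideal C (dom \<theta>)" using fg_principal[OF yA] by simp
      have "ran \<theta> = principal C z"
        using z(2) by (auto simp: ran_def \<theta>_iff principal_def)
      then show "fg_right_ideal C (ran \<theta>)" using fg_principal[OF z(1)] by simp
    next
      fix x x' w assume "\<theta> x = Some w" "\<theta> x' = Some w"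
      then obtain c c' where c: "c \<in> Arr C" "src C y = tgt C c" "x = cmp C y c" "w = cmp C z c"
        and c': "c' \<in> Arr C" "src C y = tgt C c'" "x' = cmp C y c'" "w = cmp C z c'"
        unfolding \<theta>_iff by blast
      have "c = c'" using cmp_eq_cmpD(2)[OF z(1) c(1) _ z(1) c'(1)] c c' z(2) by simp
      then show "x = x'" using c c' by simp
    next
      fix x w assume "\<theta> x = Some w"
      then show "src C w = src C x" using yA z by (auto simp: \<theta>_iff src_cmp)
    next
      fix x w c assume "\<theta> x = Some w" "c \<in> Arr C" "src C x = tgt C c"
      then obtain p where p: "p \<in> Arr C" "src C y = tgt C p" "x = cmp C y p" "w = cmp C z p"
        and c: "c \<in> Arr C" "src C x = tgt C c" unfolding \<theta>_iff by blast
      have "src C p = tgt C c" using p c yA by (simp add: src_cmp)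
      then show "\<theta> (cmp C x c) = Some (cmp C w c)"
        unfolding \<theta>_iff using p c yA z
        by (intro bexI[of _ "cmp C p c"]) (simp_all add: cmp_closed cmp_assoc tgt_cmp)
    qed
    have "\<theta> y = Some z"
      unfolding \<theta>_iff using yA z cmp_src[OF yA] cmp_src[OF z(1)] src_Ids[OF yA]
      by (intro bexI[of _ "src C y"]) (simp_all add: id_Arr tgt_id)
    then obtain G where G: "G \<in> paths" "act \<theta> F = Some G" "z \<in> G" using act_in[OF \<theta> F yF] by blast
    have "a \<in> G" using path_prefix[OF G(1,3) aA z(3)] .
    then have "G \<in> A" using a(2) G(1) by (auto simp: through_def)
    then show "\<exists>K\<in>carrier (B_monoid C). \<exists>G\<in>A. Act K F = Some G"
      using B_bex[of "\<lambda>f. \<exists>G\<in>A. f F = Some G"] \<theta> G(2) by blast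
  next
    fix K assume "K \<in> carrier (B_monoid C)"
    then obtain \<theta> where \<theta>: "\<theta> \<in> \<R>" "K = cls \<theta>" by (auto simp: B_carrier)
    have AK: "Act K = act \<theta>" using \<theta> by (simp add: Act_cls)
    obtain Y where Y: "finite Y" "Y \<subseteq> Arr C" "dom \<theta> = generated C Y" using R_dom[OF \<theta>(1)] by (rule fgE)
    \<comment> \<open>the ideal of all fixed arrows: by right cancellation, \<open>y c\<close> is fixed only if \<open>y\<close> is\<close>
    define R where "R = generated C {y \<in> Y. \<theta> y = Some y}"
    have R: "fg_right_ideal C R" unfolding R_def using Y by (intro fg_generated) auto
    have R_iff: "r \<in> R \<longleftrightarrow> \<theta> r = Some r" for r
    proof
      assume "r \<in> R"
      then obtain y where y: "\<theta> y = Some y" "r \<in> principal C y" by (auto simp: R_def generated_def)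
      from y(2) obtain c where c: "c \<in> Arr C" "src C y = tgt C c" "r = cmp C y c" by (rule principalE)
      then show "\<theta> r = Some r" using R_cmp[OF \<theta>(1) y(1) c(1,2)] by simp
    next
      assume r: "\<theta> r = Some r"
      then obtain y where y: "y \<in> Y" "r \<in> principal C y" using Y(3) by (auto simp: generated_def)
      from y(2) obtain c where c: "c \<in> Arr C" "src C y = tgt C c" "r = cmp C y c" by (rule principalE)
      have yA: "y \<in> Arr C" using y(1) Y(2) by blast
      have "y \<in> dom \<theta>" using y(1) Y principal_refl[OF yA] by (auto simp: generated_def)
      then obtain x where x: "\<theta> y = Some x" by blast
      have s: "src C x = tgt C c" using R_src[OF \<theta>(1) x] c by simp
      have "cmp C x c = cmp C y c" using R_cmp[OF \<theta>(1) x c(1,2)] r c by simp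
      then have "x = y" using cmp_right_cancel[OF R_Arr2[OF \<theta>(1) x] c(1) s yA c(2)] by simp
      then show "r \<in> R" using x y by (auto simp: R_def generated_def)
    qed
    let ?A = "ideal_paths R"
    have "\<forall>F\<in>?A. act \<theta> F = Some F"
    proof
      fix F assume "F \<in> ?A"
      then obtain r where F: "F \<in> paths" "r \<in> F" and r: "\<theta> r = Some r" by (auto simp: ideal_paths_def R_iff)
      show "act \<theta> F = Some F" using act_eq[OF \<theta>(1) F r] transplant_same[OF F] by simp
    qed
    moreover have "\<exists>F\<in>B. act \<theta> F \<noteq> Some F"
      if B: "B \<in> domains" "B \<noteq> {}" "B \<inter> ?A = {}" "B \<subseteq> dom (act \<theta>)" for B
    proof -
      obtain F where FB: "F \<in> B" using B(2) by blast
      then have F: "F \<in> paths" "F \<notin> ?A" "F \<inter> dom \<theta> \<noteq> {}" using B(3,4) by (auto simp: dom_act)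
      then obtain a where a: "a \<in> F" "a \<in> dom \<theta>" by blast
      obtain b where b: "b \<in> F" "through b \<subseteq> B" using through_in[OF B(1) FB] by blast
      obtain c where c: "c \<in> F" "c \<in> principal C a" "c \<in> principal C b" using path_directed[OF F(1) a(1) b(1)] by blast
      have cA: "c \<in> Arr C" and bA: "b \<in> Arr C" using path_Arr[OF F(1)] c(1) b(1) by auto
      obtain x where x: "\<theta> c = Some x" using fg_principal_subset[OF R_dom[OF \<theta>(1)] a(2) c(2)] by blast
      have "x \<noteq> c" using F(1,2) c(1) x by (auto simp: ideal_paths_def R_iff)
      then obtain u where u: "u \<in> Arr C" "src C x = tgt C u" "independent C (cmp C x u) (cmp C c u)"
        using separating_extension[OF R_Arr2[OF \<theta>(1) x] cA _ R_src[OF \<theta>(1) x]] by blast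
      have cu: "src C c = tgt C u" using u R_src[OF \<theta>(1) x] by simp
      \<comment> \<open>every path through \<open>c u\<close> is moved to one through \<open>x u\<close>, hence is not fixed\<close>
      obtain F' where F': "F' \<in> paths" "cmp C c u \<in> F'"
        using path_through[OF no_src cmp_closed[OF cA u(1) cu]] by blast
      have cF': "c \<in> F'" using path_prefix[OF F' cA principalI[OF u(1) cu]] .
      have "b \<in> F'" using path_prefix[OF F'(1) cF' bA c(3)] .
      then have "F' \<in> B" using b(2) F'(1) by (auto simp: through_def)
      moreover have "act \<theta> F' \<noteq> Some F'"
      proof
        assume eq: "act \<theta> F' = Some F'"
        have "cmp C x u \<in> F'" using act_in[OF \<theta>(1) F' R_cmp[OF \<theta>(1) x u(1) cu]] eq by auto
        then show False using path_meets[OF F'(1) _ F'(2)] u(3) by blast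
      qed
      ultimately show ?thesis by blast
    qed
    moreover have "?A \<in> domains" using R domains_iff by blast
    ultimately show "\<exists>A\<in>domains. (\<forall>F\<in>A. Act K F = Some F) \<and>
      (\<forall>B\<in>domains. B \<noteq> {} \<and> B \<inter> A = {} \<and> B \<subseteq> dom (Act K) \<longrightarrow> (\<exists>F\<in>B. Act K F \<noteq> Some F))"
      unfolding AK by blast
  qed
qed

end

theorem theorem7p15:
  fixes C :: "'a cat" and deg :: "'a \<Rightarrow> nat ^ 'k::finite"
  assumes "k_graph C deg"
    and "finitely_aligned C"
    and "finite (Ids C)"
    and "no_sources C deg"
    and "row_finite C deg"
    and "aperiodic C"
    and "cofinal_category C"
  shows "boolean_inverse_monoid (B_monoid C) \<and>
    ((finite (carrier (B_monoid C)) \<and>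
      (\<exists>X :: nat set. finite X \<and> B_monoid C \<cong> symmetric_inverse_monoid X) \<and>
      (\<exists>n. units_of (B_monoid C) \<cong> sym_group n))
     \<or>
     (countable (carrier (B_monoid C)) \<and> infinite (carrier (B_monoid C)) \<and>
      (\<exists>G. subgroup G (homeo_group cantor_space) \<and>
           units_of (B_monoid C) \<cong> (homeo_group cantor_space)\<lparr>carrier := G\<rparr> \<and>
           full_in cantor_space G \<and>
           acts_minimally cantor_space G \<and>
           (\<forall>g\<in>G. openin cantor_space (support_in cantor_space g) \<and>
                  closedin cantor_space (support_in cantor_space g)))))"
proof -
  interpret aperiodic_cofinal_graph C deg
    using assms unfolding aperiodic_cofinal_graph_def aperiodic_cofinal_graph_axioms_def by blast
  interpret B: ample_rep "B_monoid C" Act paths by (rule B_ample_rep)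
  from B.isolated_points_dichotomy show ?thesis
  proof
    assume "finite paths \<and> (\<forall>F\<in>paths. {F} \<in> B.domains)"
    then have "finite paths" "\<And>F. F \<in> paths \<Longrightarrow> {F} \<in> B.domains" by simp_all
    from B.boolean_inverse_monoid disjI1[OF B.finite_case[OF this]] show ?thesis by (rule conjI)
  next
    assume "paths \<noteq> {} \<and> (\<forall>F\<in>paths. {F} \<notin> B.domains)"
    then have "paths \<noteq> {}" "\<And>F. F \<in> paths \<Longrightarrow> {F} \<notin> B.domains" by simp_all
    from conjI[OF B.countable_carrier B.cantor_case[OF this]]
    show ?thesis by (rule conjI[OF B.boolean_inverse_monoid disjI2])
  qed
qed

end
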